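(* Let $s\in(0,1)$. There exists a constant $C=C(s)\ge 1$ such that for all $x,v\in\mathbb{R}$ the fundamental solution $p_s$ of the fractional Kolmogorov equation at time $t=1$ satisfies $$C^{-1}\,\Phi(x,v)\le p_s\Big(1,x+\frac v2,v\Big)\le C\,\Phi(x,v),\qquad \Phi(x,v):=\frac{1}{(1+|x|+|v|)^{2+2s}}\;\frac{1}{\big(1+(2|x|-|v|)_+\big)^{2s}}.$$
   Context: The fractional Kolmogorov equation in one spatial dimension is $\partial_t u+v\,\partial_x u+(-\Delta_v)^s u=0$ in $(0,\infty)\times\mathbb{R}\times\mathbb{R}$ with $u(0,\cdot,\cdot)=u_0$ on $\mathbb{R}\times\mathbb{R}$, where $u=u(t,x,v)$ and $(-\Delta_v)^s$ is the fractional Laplacian in $v$, normalized to have Fourier symbol $|\phi|^{2s}$. Its fundamental solution $p_s$ is given, for $t>0$ and $x,v\in\mathbb{R}$, by $$p_s(t,x,v)=\frac{1}{(2\pi)^2}\int_{\mathbb{R}}\int_{\mathbb{R}}e^{i(x\xi+v\phi)}\exp\Big(-\int_0^t|\phi+u\xi|^{2s}\,du\Big)\,d\xi\,d\phi .$$ Notation: $r_+=\max\{r,0\}$. *)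

theory Defs
  imports "HOL-Analysis.Analysis"
begin

text \<open>Fundamental solution of \<open>u\<^sub>t + v u\<^sub>x + (-\<Delta>\<^sub>v)\<^sup>s u = 0\<close> on \<open>\<real> \<times> \<real>\<close>, given by its Fourier
  representation; the fractional Laplacian has symbol \<open>\<bar>\<phi>\<bar>\<^sup>2\<^sup>s\<close>. It is meant for \<open>t > 0\<close>. It is complex-valued
  because the Fourier integral is; that it is in fact real is not built into the definition.\<close>

definition kolmogorov_kernel :: "real \<Rightarrow> real \<Rightarrow> real \<Rightarrow> real \<Rightarrow> complex" where
  "kolmogorov_kernel s t x v =
     complex_of_real (1 / (2 * pi)\<^sup>2) *
     (LINT \<phi>|lborel. LINT \<xi>|lborel.
        exp (\<i> * complex_of_real (x * \<xi> + v * \<phi>)) *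
        complex_of_real (exp (- (LINT u:{0..t}|lborel. \<bar>\<phi> + u * \<xi>\<bar> powr (2 * s)))))"

definition kolmogorov_profile :: "real \<Rightarrow> real \<Rightarrow> real \<Rightarrow> real" where
  "kolmogorov_profile s x v =
     1 / (1 + \<bar>x\<bar> + \<bar>v\<bar>) powr (2 + 2 * s) *
     (1 / (1 + max (2 * \<bar>x\<bar> - \<bar>v\<bar>) 0) powr (2 * s))"

end

theory Submission
  imports Defs "HOL-Probability.Probability"
begin

text \<open>Put \<open>\<alpha> = 2s\<close> and write points as \<open>z = (v, x)\<close>, frequencies as \<open>\<zeta> = (\<phi>, \<xi>)\<close>. The
Levy-Khintchine formula for \<open>\<bar>a\<bar>\<^sup>\<alpha>\<close> turns the exponent \<open>\<integral>\<^sub>0\<^sup>1 \<bar>\<phi> + u\<xi>\<bar>\<^sup>\<alpha> du\<close> into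
\<open>\<integral> (1 - cos (y \<bullet> \<zeta>)) n(y) dy\<close>, where \<open>n\<close> is a multiple of \<open>\<bar>v\<bar>\<close> to the power \<open>-2-\<alpha>\<close> on the double
cone swept out by the points \<open>(r, ur)\<close> with \<open>0 \<le> u \<le> 1\<close> (\<open>levy_khintchine\<close>). So the kernel at time
one is the density of a planar stable law whose jumps lie in this cone. After the shift of \<open>x\<close> by
\<open>v/2\<close> the cone is \<open>2\<bar>x\<bar> \<le> \<bar>v\<bar>\<close>, and \<open>(2\<bar>x\<bar> - \<bar>v\<bar>)\<^sub>+\<close> measures the distance to it. A far point in the
cone is reached by one large jump, with density \<open>(1 + \<bar>x\<bar> + \<bar>v\<bar>)\<close> to the power \<open>-2-\<alpha>\<close>; at distance \<open>d\<close>
from the cone a second jump of size about \<open>d\<close> is necessary, and it costs the factor \<open>(1 + d)\<close> to the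
power \<open>-\<alpha>\<close>.

Analytically, the jumps are split at size one. The large jumps have an integrable density \<open>n\<^sub>1\<close>, so the
exponential of their part of the exponent expands in powers of the Fourier transform of \<open>n\<^sub>1\<close>, and the
kernel is the sum over \<open>k\<close> of the \<open>k\<close>-fold convolutions of \<open>n\<^sub>1\<close> with \<open>g\<close>, divided by \<open>k!\<close>
(\<open>kolmogorov_kernel_compound\<close>). Here \<open>g\<close> is a constant times the inverse Fourier transform of the
exponential of the remaining part. In this argument an inverse Fourier transform is only ever
convolved with an integrable function, which multiplies its symbol (\<open>convolve_inv_fourier\<close>); Fubini's
theorem therefore replaces Fourier inversion throughout.

Three facts about \<open>g\<close> are needed: it is nonnegative, it decays exponentially, and it is positive near
the origin. For the first two, the jumps of size less than \<open>\<epsilon>\<close> are replaced by a Gaussian whose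
variance dominates theirs. The result is a sum of convolutions of nonnegative functions, hence
nonnegative, and a weight \<open>exp (\<theta> \<bullet> z)\<close> passes through convolutions, so that it merely tilts the jump
density and the Gaussian. The tilted Fourier transforms have an integrable majorant independent of
\<open>\<epsilon>\<close> (\<open>norm_approx_fourier_le\<close>), and the limit \<open>\<epsilon> \<rightarrow> 0\<close> gives the claim for \<open>g\<close>.

The upper bound follows from \<open>g \<le> A \<Phi>\<close> and from the convolution inequality \<open>n\<^sub>1 * \<Phi> \<le> K \<Phi>\<close>
(\<open>profile_convolution_bound\<close>): the series is at most \<open>A exp(K) \<Phi>\<close>. For the lower bound all terms of
the series are nonnegative, and the single term \<open>k = 2\<close> already dominates a multiple of \<open>\<Phi>\<close> at every
point (\<open>two_jump_lower_bound\<close>).\<close>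

section \<open>Inverse Fourier transforms and exponentials of convolution operators\<close>

definition inv_fourier :: "('a::euclidean_space \<Rightarrow> complex) \<Rightarrow> 'a \<Rightarrow> complex" where
  "inv_fourier m z = (\<integral>\<zeta>. cis (z \<bullet> \<zeta>) * m \<zeta> \<partial>lborel)"

definition fourier :: "('a::euclidean_space \<Rightarrow> real) \<Rightarrow> 'a \<Rightarrow> complex" where
  "fourier n \<zeta> = (\<integral>y. of_real (n y) * cis (- (y \<bullet> \<zeta>)) \<partial>lborel)"

definition convolve :: "('a::euclidean_space \<Rightarrow> real) \<Rightarrow> ('a \<Rightarrow> real) \<Rightarrow> 'a \<Rightarrow> real" where
  "convolve n f z = (\<integral>y. n y * f (z - y) \<partial>lborel)"

text \<open>The exponential of the operator \<open>convolve n\<close>, applied to \<open>f\<close>. If \<open>f\<close> is a probability density, then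
up to the factor \<open>exp (- \<integral> n)\<close> this is the density of \<open>f\<close> plus an independent compound Poisson
variable with jump density \<open>n\<close>.\<close>

definition compound :: "('a::euclidean_space \<Rightarrow> real) \<Rightarrow> ('a \<Rightarrow> real) \<Rightarrow> 'a \<Rightarrow> real" where
  "compound n f z = (\<Sum>k. (convolve n ^^ k) f z / fact k)"

lemma cis_measurable [measurable]: "cis \<in> borel_measurable borel"
  by (intro borel_measurable_continuous_onI continuous_intros)

lemma integrable_cis_mult:
  fixes m :: "'a::euclidean_space \<Rightarrow> complex"
  assumes [measurable]: "h \<in> borel_measurable borel" and m: "integrable lborel m"
  shows "integrable lborel (\<lambda>\<zeta>. cis (h \<zeta>) * m \<zeta>)"
proof -
  note [measurable] = borel_measurable_integrable[OF m]
  show ?thesis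
    by (rule Bochner_Integration.integrable_bound[OF m]) (auto simp: norm_mult)
qed

lemma inv_fourier_measurable [measurable (raw)]:
  fixes m :: "'a::euclidean_space \<Rightarrow> complex"
  assumes m: "integrable lborel m"
  shows "inv_fourier m \<in> borel_measurable borel"
proof -
  note [measurable] = borel_measurable_integrable[OF m]
  show ?thesis unfolding inv_fourier_def by measurable
qed

lemma norm_inv_fourier_le:
  fixes m :: "'a::euclidean_space \<Rightarrow> complex"
  shows "norm (inv_fourier m z) \<le> (\<integral>\<zeta>. norm (m \<zeta>) \<partial>lborel)"
  unfolding inv_fourier_def by (rule order_trans[OF integral_norm_bound]) (simp add: norm_mult)

lemma continuous_inv_fourier:
  fixes m :: "'a::euclidean_space \<Rightarrow> complex"
  assumes m: "integrable lborel m"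
  shows "continuous_on UNIV (inv_fourier m)"
proof -
  note [measurable] = borel_measurable_integrable[OF m]
  have "continuous (at z) (inv_fourier m)" for z
    unfolding continuous_at_sequentially
  proof (intro allI impI)
    fix X assume X: "X \<longlonglongrightarrow> z"
    show "(inv_fourier m \<circ> X) \<longlonglongrightarrow> inv_fourier m z"
      unfolding comp_def inv_fourier_def
    proof (rule integral_dominated_convergence[OF _ _ integrable_norm[OF m]])
      show "AE \<zeta> in lborel. (\<lambda>i. cis (X i \<bullet> \<zeta>) * m \<zeta>) \<longlonglongrightarrow> cis (z \<bullet> \<zeta>) * m \<zeta>"
      proof (rule AE_I2)
        fix \<zeta>
        have "continuous_on UNIV cis" by (intro continuous_intros)
        moreover have "(\<lambda>i. X i \<bullet> \<zeta>) \<longlonglongrightarrow> z \<bullet> \<zeta>" by (intro tendsto_intros X)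
        ultimately have "(\<lambda>i. cis (X i \<bullet> \<zeta>)) \<longlonglongrightarrow> cis (z \<bullet> \<zeta>)"
          by (rule continuous_on_tendsto_compose) auto
        then show "(\<lambda>i. cis (X i \<bullet> \<zeta>) * m \<zeta>) \<longlonglongrightarrow> cis (z \<bullet> \<zeta>) * m \<zeta>"
          by (rule tendsto_mult_right)
      qed
    qed (auto simp: norm_mult)
  qed
  then show ?thesis by (simp add: continuous_at_imp_continuous_on)
qed

lemma fourier_measurable [measurable (raw)]:
  fixes n :: "'a::euclidean_space \<Rightarrow> real"
  assumes n: "integrable lborel n"
  shows "fourier n \<in> borel_measurable borel"
proof -
  note [measurable] = borel_measurable_integrable[OF n]
  show ?thesis unfolding fourier_def by measurable
qed

lemma norm_fourier_le:
  fixes n :: "'a::euclidean_space \<Rightarrow> real"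
  shows "norm (fourier n \<zeta>) \<le> (\<integral>y. \<bar>n y\<bar> \<partial>lborel)"
  unfolding fourier_def by (rule order_trans[OF integral_norm_bound]) (simp add: norm_mult)

text \<open>The convolution theorem in the form that starts from a function given as an inverse transform: only
Fubini's theorem is involved.\<close>

lemma convolve_inv_fourier:
  fixes n f :: "'a::euclidean_space \<Rightarrow> real"
  assumes n: "integrable lborel n" and m: "integrable lborel m"
    and f: "\<And>z. of_real (f z) = inv_fourier m z"
  shows "of_real (convolve n f z) = inv_fourier (\<lambda>\<zeta>. fourier n \<zeta> * m \<zeta>) z"
proof -
  note [measurable] = borel_measurable_integrable[OF m] borel_measurable_integrable[OF n]
  have "integrable (lborel \<Otimes>\<^sub>M lborel) (\<lambda>(y, \<zeta>). of_real (n y) * (cis ((z - y) \<bullet> \<zeta>) * m \<zeta>))"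
    by (rule lborel_pair.Fubini_integrable)
      (auto simp: norm_mult n m integrable_norm intro!: integrable_mult_right integrable_mult_left integrable_cis_mult)
  then have "(\<integral>\<zeta>. (\<integral>y. of_real (n y) * (cis ((z - y) \<bullet> \<zeta>) * m \<zeta>) \<partial>lborel) \<partial>lborel)
      = (\<integral>y. (\<integral>\<zeta>. of_real (n y) * (cis ((z - y) \<bullet> \<zeta>) * m \<zeta>) \<partial>lborel) \<partial>lborel)"
    by (rule lborel_pair.Fubini_integral)
  also have "\<dots> = (\<integral>y. of_real (n y) * of_real (f (z - y)) \<partial>lborel)"
    by (simp add: f inv_fourier_def)
  also have "\<dots> = of_real (convolve n f z)"
    unfolding convolve_def integral_complex_of_real[symmetric] by simp
  finally have "of_real (convolve n f z)
      = (\<integral>\<zeta>. (\<integral>y. of_real (n y) * (cis ((z - y) \<bullet> \<zeta>) * m \<zeta>) \<partial>lborel) \<partial>lborel)" ..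
  also have "\<dots> = inv_fourier (\<lambda>\<zeta>. fourier n \<zeta> * m \<zeta>) z"
  proof -
    have "(\<integral>y. of_real (n y) * (cis ((z - y) \<bullet> \<zeta>) * m \<zeta>) \<partial>lborel)
        = cis (z \<bullet> \<zeta>) * (fourier n \<zeta> * m \<zeta>)" for \<zeta>
    proof -
      have "(\<integral>y. of_real (n y) * (cis ((z - y) \<bullet> \<zeta>) * m \<zeta>) \<partial>lborel)
          = (\<integral>y. (of_real (n y) * cis (- (y \<bullet> \<zeta>))) * (cis (z \<bullet> \<zeta>) * m \<zeta>) \<partial>lborel)"
        by (intro Bochner_Integration.integral_cong refl)
          (simp add: inner_diff_left cis_mult[symmetric] cis_divide[symmetric] divide_simps mult_ac
             flip: cis_inverse)
      also have "\<dots> = fourier n \<zeta> * (cis (z \<bullet> \<zeta>) * m \<zeta>)" unfolding fourier_def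
        by (rule integral_mult_left_zero)
      finally show ?thesis by (simp only: mult_ac)
    qed
    then show ?thesis by (simp add: inv_fourier_def)
  qed
  finally show ?thesis .
qed

lemma integrable_bounded_mult:
  fixes m h :: "'a::euclidean_space \<Rightarrow> complex"
  assumes [measurable]: "h \<in> borel_measurable borel" and m: "integrable lborel m"
    and B: "\<And>x. norm (h x) \<le> B"
  shows "integrable lborel (\<lambda>\<zeta>. h \<zeta> * m \<zeta>)"
proof -
  note [measurable] = borel_measurable_integrable[OF m]
  have "integrable lborel (\<lambda>\<zeta>. of_real B * m \<zeta>)" using m by simp
  then show ?thesis
  proof (rule Bochner_Integration.integrable_bound)
    have "norm (h x * m x) \<le> norm (of_real B * m x)" for x
      using B[of x] by (auto simp: norm_mult intro!: mult_right_mono)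
    then show "AE x in lborel. norm (h x * m x) \<le> norm (of_real B * m x)" by simp
  qed simp
qed

lemma integrable_fourier_power:
  fixes n :: "'a::euclidean_space \<Rightarrow> real"
  assumes n: "integrable lborel n" and m: "integrable lborel m"
  shows "integrable lborel (\<lambda>\<zeta>. fourier n \<zeta> ^ k * m \<zeta>)"
proof (rule integrable_bounded_mult[OF _ m])
  show "(\<lambda>\<zeta>. fourier n \<zeta> ^ k) \<in> borel_measurable borel"
    using fourier_measurable[OF n] by measurable
  show "norm (fourier n x ^ k) \<le> (\<integral>y. \<bar>n y\<bar> \<partial>lborel) ^ k" for x
    by (simp add: norm_power power_mono norm_fourier_le)
qed

lemma convolve_power_inv_fourier:
  fixes n f :: "'a::euclidean_space \<Rightarrow> real"
  assumes n: "integrable lborel n" and m: "integrable lborel m"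
    and f: "\<And>z. of_real (f z) = inv_fourier m z"
  shows "of_real ((convolve n ^^ k) f z) = inv_fourier (\<lambda>\<zeta>. fourier n \<zeta> ^ k * m \<zeta>) z"
proof (induction k arbitrary: z)
  case 0 then show ?case by (simp add: f)
next
  case (Suc k)
  from convolve_inv_fourier[OF n integrable_fourier_power[OF n m] Suc]
  show ?case by (simp add: mult_ac)
qed

text \<open>Convolution with \<open>n\<close> multiplies the symbol by \<open>fourier n\<close>, so its exponential multiplies by
\<open>exp (fourier n)\<close>. Since \<open>fourier n\<close> is bounded by the integral of \<open>\<bar>n\<bar>\<close>, the exponential series may be
integrated term by term against \<open>m\<close>.\<close>

theorem compound_inv_fourier:
  fixes n f :: "'a::euclidean_space \<Rightarrow> real"
  assumes n: "integrable lborel n" and m: "integrable lborel m"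
    and f: "\<And>z. of_real (f z) = inv_fourier m z"
  shows "summable (\<lambda>k. (convolve n ^^ k) f z / fact k)"
    and "of_real (compound n f z) = inv_fourier (\<lambda>\<zeta>. exp (fourier n \<zeta>) * m \<zeta>) z"
proof -
  note [measurable] = borel_measurable_integrable[OF m] fourier_measurable[OF n]
  define L where "L = (\<integral>y. \<bar>n y\<bar> \<partial>lborel)"
  define t where "t k \<zeta> = cis (z \<bullet> \<zeta>) * (fourier n \<zeta> ^ k /\<^sub>R fact k * m \<zeta>)" for k \<zeta>
  have t_norm: "norm (t k \<zeta>) \<le> (L ^ k / fact k) * norm (m \<zeta>)" for k \<zeta>
    by (auto simp: t_def norm_mult norm_power L_def divide_inverse mult_ac
        intro!: mult_mono power_mono norm_fourier_le)
  have L0: "L \<ge> 0" by (simp add: L_def)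
  have sL: "summable (\<lambda>k. L ^ k / fact k)"
    using summable_exp[of L] by (simp add: divide_inverse mult.commute)
  have t_int: "integrable lborel (t k)" for k
  proof -
    have "integrable lborel (\<lambda>\<zeta>. cis (z \<bullet> \<zeta>) * (fourier n \<zeta> ^ k * m \<zeta>))"
      by (rule integrable_cis_mult) (auto intro: integrable_fourier_power n m)
    then have "integrable lborel (\<lambda>\<zeta>. (cis (z \<bullet> \<zeta>) * (fourier n \<zeta> ^ k * m \<zeta>)) /\<^sub>R fact k)" by simp
    moreover have "t k = (\<lambda>\<zeta>. (cis (z \<bullet> \<zeta>) * (fourier n \<zeta> ^ k * m \<zeta>)) /\<^sub>R fact k)"
      by (simp add: t_def scaleR_conv_of_real mult_ac fun_eq_iff)
    ultimately show ?thesis by simp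
  qed
  have 1: "AE \<zeta> in lborel. summable (\<lambda>k. norm (t k \<zeta>))"
    by (rule AE_I2, rule summable_comparison_test'[OF summable_mult2[OF sL]])
       (use t_norm in auto)
  have 2: "summable (\<lambda>k. \<integral>\<zeta>. norm (t k \<zeta>) \<partial>lborel)"
  proof (rule summable_comparison_test'[OF summable_mult2[OF sL]])
    fix k
    have "(\<integral>\<zeta>. norm (t k \<zeta>) \<partial>lborel) \<le> (\<integral>\<zeta>. (L ^ k / fact k) * norm (m \<zeta>) \<partial>lborel)"
      using t_int m by (intro integral_mono t_norm integrable_norm integrable_mult_right) auto
    then show "norm (\<integral>\<zeta>. norm (t k \<zeta>) \<partial>lborel) \<le> L ^ k / fact k * (\<integral>\<zeta>. norm (m \<zeta>) \<partial>lborel)"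
      by simp
  qed
  have sums: "(\<lambda>k. \<integral>\<zeta>. t k \<zeta> \<partial>lborel) sums (\<integral>\<zeta>. (\<Sum>k. t k \<zeta>) \<partial>lborel)"
    by (rule sums_integral[OF t_int 1 2])
  have a: "(\<integral>\<zeta>. t k \<zeta> \<partial>lborel) = of_real ((convolve n ^^ k) f z / fact k)" for k
  proof -
    have "(\<integral>\<zeta>. t k \<zeta> \<partial>lborel) = (\<integral>\<zeta>. (cis (z \<bullet> \<zeta>) * (fourier n \<zeta> ^ k * m \<zeta>)) /\<^sub>R fact k \<partial>lborel)"
      by (simp add: t_def scaleR_conv_of_real mult_ac)
    also have "\<dots> = of_real ((convolve n ^^ k) f z) /\<^sub>R fact k"
      unfolding convolve_power_inv_fourier[OF n m f] inv_fourier_def by simp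
    finally show ?thesis by (simp add: scaleR_conv_of_real divide_inverse mult.commute)
  qed
  have b: "(\<integral>\<zeta>. (\<Sum>k. t k \<zeta>) \<partial>lborel) = inv_fourier (\<lambda>\<zeta>. exp (fourier n \<zeta>) * m \<zeta>) z"
  proof -
    have "(\<Sum>k. t k \<zeta>) = cis (z \<bullet> \<zeta>) * (exp (fourier n \<zeta>) * m \<zeta>)" for \<zeta>
      unfolding t_def
      by (rule sums_unique[symmetric], intro sums_mult sums_mult2 exp_converges)
    then show ?thesis by (simp add: inv_fourier_def)
  qed
  have c: "(\<lambda>k. of_real ((convolve n ^^ k) f z / fact k)) sums inv_fourier (\<lambda>\<zeta>. exp (fourier n \<zeta>) * m \<zeta>) z"
    using sums unfolding a b .
  have "summable (\<lambda>k. complex_of_real ((convolve n ^^ k) f z / fact k))"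
    using c by (rule sums_summable)
  then show d: "summable (\<lambda>k. (convolve n ^^ k) f z / fact k)"
    by (simp only: summable_complex_of_real)
  have "(\<lambda>k. of_real ((convolve n ^^ k) f z / fact k)) sums complex_of_real (compound n f z)"
    using d unfolding compound_def sums_of_real_iff by (rule summable_sums)
  with c show "of_real (compound n f z) = inv_fourier (\<lambda>\<zeta>. exp (fourier n \<zeta>) * m \<zeta>) z"
    by (metis sums_unique2)
qed

lemma convolve_measurable [measurable (raw)]:
  fixes n f :: "'a::euclidean_space \<Rightarrow> real"
  assumes [measurable]: "n \<in> borel_measurable borel" "f \<in> borel_measurable borel"
  shows "convolve n f \<in> borel_measurable borel"
  unfolding convolve_def by measurable

lemma convolve_power_measurable [measurable (raw)]:
  fixes n f :: "'a::euclidean_space \<Rightarrow> real"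
  assumes [measurable]: "n \<in> borel_measurable borel" "f \<in> borel_measurable borel"
  shows "(convolve n ^^ k) f \<in> borel_measurable borel"
  by (induction k) (simp_all add: convolve_measurable)

lemma convolve_power_nonneg:
  fixes n f :: "'a::euclidean_space \<Rightarrow> real"
  assumes "\<And>y. n y \<ge> 0" "\<And>z. f z \<ge> 0"
  shows "(convolve n ^^ k) f z \<ge> 0"
  using assms by (induction k arbitrary: z) (auto simp: convolve_def intro!: integral_nonneg_AE)

lemma compound_nonneg:
  fixes n f :: "'a::euclidean_space \<Rightarrow> real"
  assumes "\<And>y. n y \<ge> 0" "\<And>z. f z \<ge> 0" "summable (\<lambda>k. (convolve n ^^ k) f z / fact k)"
  shows "compound n f z \<ge> 0"
  unfolding compound_def using assms by (intro suminf_nonneg) (auto simp: convolve_power_nonneg)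

lemma compound_ge_term:
  fixes n f :: "'a::euclidean_space \<Rightarrow> real"
  assumes "\<And>y. n y \<ge> 0" "\<And>z. f z \<ge> 0" "summable (\<lambda>k. (convolve n ^^ k) f z / fact k)"
  shows "(convolve n ^^ k) f z / fact k \<le> compound n f z"
  unfolding compound_def
  using sum_le_suminf[of "\<lambda>k. (convolve n ^^ k) f z / fact k" "{k}"] assms
  by (auto simp: convolve_power_nonneg)

lemma convolve_le:
  fixes n f \<Phi> :: "'a::euclidean_space \<Rightarrow> real"
  assumes [measurable]: "n \<in> borel_measurable borel" "f \<in> borel_measurable borel" "\<Phi> \<in> borel_measurable borel"
    and n: "\<And>y. n y \<ge> 0" and f: "\<And>z. 0 \<le> f z" "\<And>z. f z \<le> A * \<Phi> z"
    and "A \<ge> 0" "K \<ge> 0" "\<Phi> z \<ge> 0"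
    and K: "(\<integral>\<^sup>+y. ennreal (n y * \<Phi> (z - y)) \<partial>lborel) \<le> ennreal (K * \<Phi> z)"
  shows "convolve n f z \<le> (A * K) * \<Phi> z"
proof -
  have "convolve n f z = enn2real (\<integral>\<^sup>+y. ennreal (n y * f (z - y)) \<partial>lborel)"
    unfolding convolve_def using n f by (intro integral_eq_nn_integral) auto
  also have "\<dots> \<le> (A * K) * \<Phi> z"
  proof (rule enn2real_leI)
    have "(\<integral>\<^sup>+y. ennreal (n y * f (z - y)) \<partial>lborel) \<le> (\<integral>\<^sup>+y. ennreal A * ennreal (n y * \<Phi> (z - y)) \<partial>lborel)"
    proof (rule nn_integral_mono)
      fix y
      have "n y * f (z - y) \<le> n y * (A * \<Phi> (z - y))" by (intro mult_left_mono f n)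
      then show "ennreal (n y * f (z - y)) \<le> ennreal A * ennreal (n y * \<Phi> (z - y))"
        using \<open>A \<ge> 0\<close> by (auto simp: ennreal_mult'[symmetric] mult.left_commute intro!: ennreal_leI)
    qed
    also have "\<dots> = ennreal A * (\<integral>\<^sup>+y. ennreal (n y * \<Phi> (z - y)) \<partial>lborel)"
      by (rule nn_integral_cmult) simp
    also have "\<dots> \<le> ennreal A * ennreal (K * \<Phi> z)"
      by (intro mult_left_mono K) simp
    also have "\<dots> = ennreal ((A * K) * \<Phi> z)"
      using \<open>A \<ge> 0\<close> by (simp add: ennreal_mult'[symmetric] mult.assoc)
    finally show "(\<integral>\<^sup>+y. ennreal (n y * f (z - y)) \<partial>lborel) \<le> ennreal ((A * K) * \<Phi> z)" .
  qed (use assms in auto)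
  finally show ?thesis .
qed

text \<open>A function that convolution with \<open>n\<close> multiplies by at most \<open>K\<close> controls every term of the series by
\<open>K ^ k / k!\<close>, hence the sum by \<open>exp K\<close>.\<close>

lemma compound_le:
  fixes n f \<Phi> :: "'a::euclidean_space \<Rightarrow> real"
  assumes [measurable]: "n \<in> borel_measurable borel" "f \<in> borel_measurable borel" "\<Phi> \<in> borel_measurable borel"
    and n: "\<And>y. n y \<ge> 0" and f: "\<And>z. 0 \<le> f z" "\<And>z. f z \<le> A * \<Phi> z"
    and A: "A \<ge> 0" and K0: "K \<ge> 0" and \<Phi>: "\<And>z. \<Phi> z \<ge> 0"
    and K: "\<And>z. (\<integral>\<^sup>+y. ennreal (n y * \<Phi> (z - y)) \<partial>lborel) \<le> ennreal (K * \<Phi> z)"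
    and summable: "summable (\<lambda>k. (convolve n ^^ k) f z / fact k)"
  shows "compound n f z \<le> A * exp K * \<Phi> z"
proof -
  have le: "(convolve n ^^ k) f z \<le> (A * K ^ k) * \<Phi> z" for k z
  proof (induction k arbitrary: z)
    case 0 then show ?case using f by simp
  next
    case (Suc k)
    have "convolve n ((convolve n ^^ k) f) z \<le> (A * K ^ k * K) * \<Phi> z"
      by (rule convolve_le) (use assms Suc in \<open>auto intro: convolve_power_nonneg\<close>)
    then show ?case by (simp add: mult_ac)
  qed
  have s: "(\<lambda>k. K ^ k / fact k) sums exp K"
    using exp_converges[of K] by (simp add: divide_inverse mult.commute)
  have s': "(\<lambda>k. (A * \<Phi> z) * (K ^ k / fact k)) sums ((A * \<Phi> z) * exp K)"
    by (rule sums_mult[OF s])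
  have "compound n f z \<le> (\<Sum>k. (A * \<Phi> z) * (K ^ k / fact k))"
    unfolding compound_def
  proof (rule suminf_le[OF _ summable sums_summable[OF s']])
    show "(convolve n ^^ k) f z / fact k \<le> (A * \<Phi> z) * (K ^ k / fact k)" for k
      using divide_right_mono[OF le[of k z], of "fact k"] by (simp add: mult_ac)
  qed
  also have "\<dots> = A * exp K * \<Phi> z" using sums_unique[OF s'] by (simp add: mult_ac)
  finally show ?thesis .
qed

text \<open>Because \<open>exp (\<theta> \<bullet> z) = exp (\<theta> \<bullet> y) * exp (\<theta> \<bullet> (z - y))\<close>, an exponential weight distributes over a
convolution. This is how exponential decay is obtained below without moving any contour.\<close>

lemma exp_convolve_power:
  fixes n f :: "'a::euclidean_space \<Rightarrow> real"
  shows "exp (\<theta> \<bullet> z) * (convolve n ^^ k) f z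
    = (convolve (\<lambda>y. exp (\<theta> \<bullet> y) * n y) ^^ k) (\<lambda>y. exp (\<theta> \<bullet> y) * f y) z"
proof (induction k arbitrary: z)
  case (Suc k)
  have "exp (\<theta> \<bullet> z) * (convolve n ^^ Suc k) f z
      = (\<integral>y. exp (\<theta> \<bullet> z) * (n y * (convolve n ^^ k) f (z - y)) \<partial>lborel)"
    by (simp add: convolve_def)
  also have "\<dots> = (\<integral>y. (exp (\<theta> \<bullet> y) * n y) * (exp (\<theta> \<bullet> (z - y)) * (convolve n ^^ k) f (z - y)) \<partial>lborel)"
    by (intro Bochner_Integration.integral_cong refl)
      (simp add: inner_diff_right exp_diff)
  also have "\<dots> = (convolve (\<lambda>y. exp (\<theta> \<bullet> y) * n y) ^^ Suc k) (\<lambda>y. exp (\<theta> \<bullet> y) * f y) z"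
    unfolding Suc.IH by (simp add: convolve_def)
  finally show ?case .
qed simp

lemma exp_compound:
  fixes n f :: "'a::euclidean_space \<Rightarrow> real"
  assumes "summable (\<lambda>k. (convolve n ^^ k) f z / fact k)"
  shows "exp (\<theta> \<bullet> z) * compound n f z
    = compound (\<lambda>y. exp (\<theta> \<bullet> y) * n y) (\<lambda>y. exp (\<theta> \<bullet> y) * f y) z"
  unfolding compound_def suminf_mult[OF assms, symmetric] exp_convolve_power[symmetric]
  by simp

section \<open>Integrals of powers on the line\<close>

lemma nn_integral_abs_le:
  fixes h :: "real \<Rightarrow> ennreal"
  assumes [measurable]: "h \<in> borel_measurable borel"
  shows "(\<integral>\<^sup>+x. h \<bar>x\<bar> \<partial>lborel) \<le> 2 * (\<integral>\<^sup>+x. h x * indicator {0..} x \<partial>lborel)"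
proof -
  have "(\<integral>\<^sup>+x. h \<bar>x\<bar> \<partial>lborel)
      \<le> (\<integral>\<^sup>+x. h x * indicator {0..} x + h (0 + (-1) * x) * indicator {0..} (0 + (-1) * x) \<partial>lborel)"
    by (intro nn_integral_mono) (auto split: split_indicator simp: abs_if)
  also have "\<dots> = (\<integral>\<^sup>+x. h x * indicator {0..} x \<partial>lborel)
      + (\<integral>\<^sup>+x. h (0 + (-1) * x) * indicator {0..} (0 + (-1) * x) \<partial>lborel)"
    by (intro nn_integral_add) auto
  also have "(\<integral>\<^sup>+x. h (0 + (-1) * x) * indicator {0..} (0 + (-1) * x) \<partial>lborel)
      = (\<integral>\<^sup>+x. h x * indicator {0..} x \<partial>lborel)"
    using nn_integral_real_affine[of "\<lambda>x. h x * indicator {0..} x" "-1" 0] by simp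
  finally show ?thesis by (simp add: mult_2)
qed

text \<open>Applied once per variable, this bounds the integral of an inverse power of \<open>1 + \<bar>x\<bar> + \<bar>v\<bar>\<close> over the
plane, and it also yields the tail of a pure power.\<close>

lemma nn_integral_shifted_powr_le:
  fixes a \<beta> :: real
  assumes "a > 0" "\<beta> > 0"
  shows "(\<integral>\<^sup>+x. ennreal ((a + \<bar>x\<bar>) powr (-1 - \<beta>)) \<partial>lborel) \<le> ennreal (2 / \<beta> * a powr (-\<beta>))"
proof -
  have "(\<integral>\<^sup>+x. ennreal ((a + \<bar>x\<bar>) powr (-1 - \<beta>)) \<partial>lborel)
      \<le> 2 * (\<integral>\<^sup>+x. ennreal ((a + x) powr (-1 - \<beta>)) * indicator {0..} x \<partial>lborel)"
    by (rule nn_integral_abs_le) simp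
  also have "(\<integral>\<^sup>+x. ennreal ((a + x) powr (-1 - \<beta>)) * indicator {0..} x \<partial>lborel)
      = (\<integral>\<^sup>+x. ennreal ((a + 1 * x) powr (-1 - \<beta>)) * indicator {a..} (a + 1 * x) \<partial>lborel)"
    by (intro nn_integral_cong) (auto split: split_indicator)
  also have "\<dots> = (\<integral>\<^sup>+x. ennreal (x powr (-1 - \<beta>)) * indicator {a..} x \<partial>lborel)"
    by (subst (2) nn_integral_real_affine[where c = 1 and t = a]) auto
  also have "\<dots> = ennreal (-(a powr ((-1 - \<beta>) + 1)) / ((-1 - \<beta>) + 1))"
    using assms by (intro nn_integral_has_integral_lebesgue' has_integral_powr_to_inf) auto
  also have "2 * \<dots> = ennreal (2 / \<beta> * a powr (-\<beta>))"
    by (subst ennreal_numeral[symmetric], subst ennreal_mult'[symmetric]) (auto simp: field_simps)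
  finally show ?thesis .
qed

lemma nn_integral_centred_powr_le:
  fixes a \<beta> c :: real
  assumes "a > 0" "\<beta> > 0"
  shows "(\<integral>\<^sup>+x. ennreal ((a + \<bar>c - x\<bar>) powr (-1 - \<beta>)) \<partial>lborel) \<le> ennreal (2 / \<beta> * a powr (-\<beta>))"
proof -
  have "(\<integral>\<^sup>+x. ennreal ((a + \<bar>c - x\<bar>) powr (-1 - \<beta>)) \<partial>lborel)
      = (\<integral>\<^sup>+x. ennreal ((a + \<bar>x\<bar>) powr (-1 - \<beta>)) \<partial>lborel)"
    using nn_integral_real_affine[of "\<lambda>x. ennreal ((a + \<bar>x\<bar>) powr (-1 - \<beta>))" "-1" c] by simp
  then show ?thesis using nn_integral_shifted_powr_le[OF assms] by simp
qed

text \<open>On \<open>x \<ge> r\<close> the variable \<open>x\<close> exceeds half of \<open>r + x\<close>. A tail integral over \<open>x \<ge> r\<close> can thus be bounded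
by an integral over the whole line of a function without a cut-off.\<close>

lemma powr_le_shifted_powr:
  fixes r x \<gamma> :: real
  assumes "r \<le> x" "0 < r" "\<gamma> \<ge> 0"
  shows "x powr (-\<gamma>) \<le> 2 powr \<gamma> * (r + x) powr (-\<gamma>)"
proof -
  have "x powr (-\<gamma>) \<le> ((r + x) / 2) powr (-\<gamma>)"
    using assms by (intro powr_mono2') auto
  also have "\<dots> = 2 powr \<gamma> * (r + x) powr (-\<gamma>)"
    using assms by (simp add: powr_divide powr_minus divide_simps)
  finally show ?thesis .
qed

lemma power2_mult_powr: "x\<^sup>2 * \<bar>x\<bar> powr a = \<bar>x\<bar> powr (2 + a)" for x a :: real
  by (cases "x = 0") (simp_all add: powr_add)

lemma nn_integral_powr_tail_le:
  fixes r \<beta> :: real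
  assumes "r > 0" "\<beta> > 0"
  shows "(\<integral>\<^sup>+x. ennreal (\<bar>x\<bar> powr (-1 - \<beta>) * indicator {r..} \<bar>x\<bar>) \<partial>lborel)
    \<le> ennreal (2 powr (1 + \<beta>) * (2 / \<beta>) * r powr (-\<beta>))"
proof -
  have "(\<integral>\<^sup>+x. ennreal (\<bar>x\<bar> powr (-1 - \<beta>) * indicator {r..} \<bar>x\<bar>) \<partial>lborel)
     \<le> (\<integral>\<^sup>+x. ennreal (2 powr (1 + \<beta>)) * ennreal ((r + \<bar>x\<bar>) powr (-1 - \<beta>)) \<partial>lborel)"
    using powr_le_shifted_powr[of r "\<bar>x\<bar>" "1 + \<beta>" for x] assms
    by (intro nn_integral_mono) (auto simp: ennreal_mult'[symmetric] intro!: ennreal_leI split: split_indicator)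
  also have "\<dots> = ennreal (2 powr (1 + \<beta>)) * (\<integral>\<^sup>+x. ennreal ((r + \<bar>x\<bar>) powr (-1 - \<beta>)) \<partial>lborel)"
    by (rule nn_integral_cmult) simp
  also have "\<dots> \<le> ennreal (2 powr (1 + \<beta>)) * ennreal (2 / \<beta> * r powr (-\<beta>))"
    by (intro mult_left_mono nn_integral_shifted_powr_le assms) simp
  also have "\<dots> = ennreal (2 powr (1 + \<beta>) * (2 / \<beta>) * r powr (-\<beta>))"
    by (simp add: ennreal_mult'[symmetric] mult.assoc)
  finally show ?thesis .
qed

lemma nn_integral_powr_near_0_le:
  fixes r \<gamma> :: real
  assumes "r \<ge> 0" "\<gamma> > 0"
  shows "(\<integral>\<^sup>+x. ennreal (\<bar>x\<bar> powr (\<gamma> - 1) * indicator {..r} \<bar>x\<bar>) \<partial>lborel) \<le> ennreal (2 / \<gamma> * r powr \<gamma>)"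
proof -
  have "(\<integral>\<^sup>+x. ennreal (\<bar>x\<bar> powr (\<gamma> - 1) * indicator {..r} \<bar>x\<bar>) \<partial>lborel)
    \<le> 2 * (\<integral>\<^sup>+x. ennreal (x powr (\<gamma> - 1) * indicator {..r} x) * indicator {0..} x \<partial>lborel)"
    by (rule nn_integral_abs_le) simp
  also have "(\<integral>\<^sup>+x. ennreal (x powr (\<gamma> - 1) * indicator {..r} x) * indicator {0..} x \<partial>lborel)
     = (\<integral>\<^sup>+x. ennreal (x powr (\<gamma> - 1)) * indicator {0..r} x \<partial>lborel)"
    by (intro nn_integral_cong) (auto split: split_indicator)
  also have "\<dots> = ennreal (r powr ((\<gamma> - 1) + 1) / ((\<gamma> - 1) + 1))"
    using assms by (intro nn_integral_has_integral_lebesgue' has_integral_powr_from_0) auto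
  also have "2 * \<dots> = ennreal (2 / \<gamma> * r powr \<gamma>)"
    by (subst ennreal_numeral[symmetric], subst ennreal_mult'[symmetric]) auto
  finally show ?thesis .
qed

section \<open>The Levy-Khintchine representation of the exponent\<close>

lemma one_minus_cos_le: "1 - cos x \<le> x\<^sup>2 / 2" for x :: real
proof -
  have "1 - cos x = 2 * (sin (x / 2))\<^sup>2"
    using cos_double_sin[of "x / 2"] by simp
  also have "\<dots> \<le> 2 * (x / 2)\<^sup>2"
    by (intro mult_left_mono iffD1[OF abs_le_square_iff] abs_sin_x_le_abs_x) simp
  finally show ?thesis by (simp add: power2_eq_square)
qed

text \<open>The normalisation in \<open>\<integral> (1 - cos (r a)) \<bar>r\<bar>\<^sup>-\<^sup>1\<^sup>-\<^sup>\<alpha> dr = levy_const \<alpha> * \<bar>a\<bar>\<^sup>\<alpha>\<close>; the power of \<open>\<bar>a\<bar>\<close> comes from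
rescaling \<open>r\<close>.\<close>

definition levy_const :: "real \<Rightarrow> real" where
  "levy_const \<alpha> = (\<integral>r. (1 - cos r) * \<bar>r\<bar> powr (-1 - \<alpha>) \<partial>lborel)"

lemma levy_const_integrable:
  fixes \<alpha> :: real
  assumes "0 < \<alpha>" "\<alpha> < 2"
  shows "integrable lborel (\<lambda>r. (1 - cos r) * \<bar>r\<bar> powr (-1 - \<alpha>))"
proof (rule integrableI_bounded)
  have "ennreal (norm ((1 - cos r) * \<bar>r\<bar> powr (-1 - \<alpha>)))
     \<le> ennreal (\<bar>r\<bar> powr ((2 - \<alpha>) - 1) * indicator {..1} \<bar>r\<bar>)
      + 2 * ennreal (\<bar>r\<bar> powr (-1 - \<alpha>) * indicator {1..} \<bar>r\<bar>)" for r :: real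
  proof (cases "\<bar>r\<bar> \<le> 1")
    case True
    have "1 - cos r \<le> r\<^sup>2" using one_minus_cos_le[of r] zero_le_power2[of r] by linarith
    then have "(1 - cos r) * \<bar>r\<bar> powr (-1 - \<alpha>) \<le> r\<^sup>2 * \<bar>r\<bar> powr (-1 - \<alpha>)"
      by (intro mult_right_mono) auto
    also have "r\<^sup>2 * \<bar>r\<bar> powr (-1 - \<alpha>) = \<bar>r\<bar> powr ((2 - \<alpha>) - 1)"
      using power2_mult_powr[of r "-1 - \<alpha>"] by simp
    finally have "ennreal (norm ((1 - cos r) * \<bar>r\<bar> powr (-1 - \<alpha>)))
        \<le> ennreal (\<bar>r\<bar> powr ((2 - \<alpha>) - 1) * indicator {..1} \<bar>r\<bar>)"
      using True by (intro ennreal_leI) (simp add: abs_mult)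
    then show ?thesis by (rule order_trans) simp
  next
    case False
    have "(1 - cos r) * \<bar>r\<bar> powr (-1 - \<alpha>) \<le> 2 * \<bar>r\<bar> powr (-1 - \<alpha>)"
      using cos_ge_minus_one[of r] by (intro mult_right_mono) auto
    then have "ennreal (norm ((1 - cos r) * \<bar>r\<bar> powr (-1 - \<alpha>))) \<le> ennreal (2 * \<bar>r\<bar> powr (-1 - \<alpha>))"
      by (intro ennreal_leI) (simp add: abs_mult)
    then show ?thesis using False by (simp add: ennreal_mult')
  qed
  then have "(\<integral>\<^sup>+r. ennreal (norm ((1 - cos r) * \<bar>r\<bar> powr (-1 - \<alpha>))) \<partial>lborel)
    \<le> (\<integral>\<^sup>+r. ennreal (\<bar>r\<bar> powr ((2 - \<alpha>) - 1) * indicator {..1} \<bar>r\<bar>)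
      + 2 * ennreal (\<bar>r\<bar> powr (-1 - \<alpha>) * indicator {1..} \<bar>r\<bar>) \<partial>lborel)"
    by (rule nn_integral_mono)
  also have "\<dots> = (\<integral>\<^sup>+r. ennreal (\<bar>r\<bar> powr ((2 - \<alpha>) - 1) * indicator {..1} \<bar>r\<bar>) \<partial>lborel)
      + 2 * (\<integral>\<^sup>+r. ennreal (\<bar>r\<bar> powr (-1 - \<alpha>) * indicator {1..} \<bar>r\<bar>) \<partial>lborel)"
    by (subst nn_integral_add, simp, simp) (subst nn_integral_cmult, auto)
  also have "\<dots> < \<infinity>"
    using le_less_trans[OF nn_integral_powr_near_0_le[of 1 "2 - \<alpha>"] ennreal_less_top]
      le_less_trans[OF nn_integral_powr_tail_le[of 1 \<alpha>] ennreal_less_top] assms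
    by (simp add: ennreal_mult_less_top)
  finally show "(\<integral>\<^sup>+r. ennreal (norm ((1 - cos r) * \<bar>r\<bar> powr (-1 - \<alpha>))) \<partial>lborel) < \<infinity>" .
qed simp

lemma levy_const_pos:
  assumes "0 < \<alpha>" "\<alpha> < 2"
  shows "levy_const \<alpha> > 0"
proof -
  define c where "c = (1 - cos 1) * 2 powr (-1 - \<alpha>)"
  have "cos (1::real) < cos 0" using pi_gt3 by (intro cos_monotone_0_pi) auto
  then have c: "c > 0" by (simp add: c_def)
  have "c * indicator {1..2} r \<le> (1 - cos r) * \<bar>r\<bar> powr (-1 - \<alpha>)" for r :: real
  proof (cases "r \<in> {1..2}")
    case True
    then have "cos r \<le> cos 1" using pi_gt3 by (intro cos_monotone_0_pi_le) auto
    moreover have "2 powr (-1 - \<alpha>) \<le> \<bar>r\<bar> powr (-1 - \<alpha>)"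
      using True assms by (intro powr_mono2') auto
    ultimately show ?thesis using True by (auto simp: c_def intro!: mult_mono)
  qed simp
  then have "(\<integral>r. c * indicator {1..2::real} r \<partial>lborel) \<le> levy_const \<alpha>"
    unfolding levy_const_def by (intro integral_mono levy_const_integrable assms) auto
  with c show ?thesis by simp
qed

lemma levy_khintchine_1d:
  fixes a :: real
  assumes \<alpha>: "0 < \<alpha>" "\<alpha> < 2"
  shows "(\<integral>\<^sup>+r. ennreal ((1 - cos (r * a)) * \<bar>r\<bar> powr (-1 - \<alpha>) / levy_const \<alpha>) \<partial>lborel) = ennreal (\<bar>a\<bar> powr \<alpha>)"
proof (cases "a = 0")
  case False
  define h where "h r = (1 - cos r) * \<bar>r\<bar> powr (-1 - \<alpha>)" for r :: real
  have h: "(1 - cos (r * a)) * \<bar>r\<bar> powr (-1 - \<alpha>) = \<bar>a\<bar> powr (1 + \<alpha>) * h (0 + a * r)" for r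
    using False powr_minus[of "\<bar>a\<bar>" "1 + \<alpha>"] by (simp add: h_def abs_mult powr_mult mult.commute)
  have int: "integrable lborel (\<lambda>r. h (0 + a * r))"
    using lborel_integrable_real_affine[OF levy_const_integrable[OF \<alpha>] False, of 0] unfolding h_def by simp
  have "levy_const \<alpha> = \<bar>a\<bar> * (\<integral>r. h (0 + a * r) \<partial>lborel)"
    using lborel_integral_real_affine[OF False, of h 0] by (simp add: levy_const_def h_def)
  then have eq: "(\<integral>r. h (0 + a * r) \<partial>lborel) = levy_const \<alpha> / \<bar>a\<bar>" using False by simp
  have "(\<integral>\<^sup>+r. ennreal ((1 - cos (r * a)) * \<bar>r\<bar> powr (-1 - \<alpha>) / levy_const \<alpha>) \<partial>lborel)
      = (\<integral>\<^sup>+r. ennreal (\<bar>a\<bar> powr (1 + \<alpha>) / levy_const \<alpha> * h (0 + a * r)) \<partial>lborel)"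
    unfolding h by simp
  also have "\<dots> = ennreal (\<integral>r. \<bar>a\<bar> powr (1 + \<alpha>) / levy_const \<alpha> * h (0 + a * r) \<partial>lborel)"
    using int levy_const_pos[OF \<alpha>]
    by (intro nn_integral_eq_integral integrable_mult_right) (auto simp: h_def)
  also have "\<dots> = ennreal (\<bar>a\<bar> powr \<alpha>)"
    using eq False levy_const_pos[OF \<alpha>] by (simp add: powr_add)
  finally show ?thesis .
qed (use \<alpha> in simp)

text \<open>A jump \<open>r\<close> of the velocity when the time \<open>u\<close> is left moves the final \<open>(v, x)\<close> by \<open>(r, u r)\<close>. This
is the density of all such jumps: the image of \<open>\<bar>r\<bar>\<^sup>-\<^sup>1\<^sup>-\<^sup>\<alpha> dr du\<close> on the cone \<open>x / v \<in> {0..1}\<close>, where the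
map \<open>u \<mapsto> u r\<close> contributes the extra power of \<open>\<bar>v\<bar>\<close>. At \<open>v = 0\<close> the value is \<open>0\<close>, because
\<open>0 powr a = 0\<close>.\<close>

definition levy_density :: "real \<Rightarrow> real \<times> real \<Rightarrow> real" where
  "levy_density \<alpha> y =
     (if \<bar>2 * snd y - fst y\<bar> \<le> \<bar>fst y\<bar> then \<bar>fst y\<bar> powr (-2 - \<alpha>) / levy_const \<alpha> else 0)"

definition symbol :: "real \<Rightarrow> real \<times> real \<Rightarrow> real" where
  "symbol \<alpha> \<zeta> = (LINT u:{0..1}|lborel. \<bar>fst \<zeta> + u * snd \<zeta>\<bar> powr \<alpha>)"

lemma levy_density_measurable [measurable]: "levy_density \<alpha> \<in> borel_measurable borel"
  unfolding levy_density_def borel_prod[symmetric] by measurable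

lemma levy_density_nonneg: "0 < \<alpha> \<Longrightarrow> \<alpha> < 2 \<Longrightarrow> 0 \<le> levy_density \<alpha> y"
  using levy_const_pos[of \<alpha>] by (simp add: levy_density_def)

lemma levy_density_minus: "levy_density \<alpha> (- y) = levy_density \<alpha> y"
  by (simp add: levy_density_def abs_minus_commute)

text \<open>The substitution \<open>x = u v\<close> in the inner variable.\<close>

lemma nn_integral_levy_density:
  fixes F :: "real \<times> real \<Rightarrow> ennreal"
  assumes [measurable]: "F \<in> borel_measurable borel"
  shows "(\<integral>\<^sup>+y. ennreal (levy_density \<alpha> y) * F y \<partial>lborel)
    = (\<integral>\<^sup>+v. ennreal (\<bar>v\<bar> powr (-1 - \<alpha>) / levy_const \<alpha>)
        * (\<integral>\<^sup>+u. F (v, u * v) * indicator {0..1} u \<partial>lborel) \<partial>lborel)"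
proof -
  have [measurable]: "F \<in> borel_measurable (borel \<Otimes>\<^sub>M borel)"
    "levy_density \<alpha> \<in> borel_measurable (borel \<Otimes>\<^sub>M borel)"
    using assms levy_density_measurable by (simp_all add: borel_prod)
  have "(\<integral>\<^sup>+y. ennreal (levy_density \<alpha> y) * F y \<partial>lborel)
      = (\<integral>\<^sup>+v. (\<integral>\<^sup>+x. ennreal (levy_density \<alpha> (v, x)) * F (v, x) \<partial>lborel) \<partial>lborel)"
    unfolding lborel_prod[symmetric] by (subst lborel.nn_integral_fst[symmetric]) auto
  also have "\<dots> = (\<integral>\<^sup>+v. ennreal (\<bar>v\<bar> powr (-1 - \<alpha>) / levy_const \<alpha>)
        * (\<integral>\<^sup>+u. F (v, u * v) * indicator {0..1} u \<partial>lborel) \<partial>lborel)"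
  proof (rule nn_integral_cong)
    fix v :: real
    show "(\<integral>\<^sup>+x. ennreal (levy_density \<alpha> (v, x)) * F (v, x) \<partial>lborel)
      = ennreal (\<bar>v\<bar> powr (-1 - \<alpha>) / levy_const \<alpha>)
        * (\<integral>\<^sup>+u. F (v, u * v) * indicator {0..1} u \<partial>lborel)"
    proof (cases "v = 0")
      case True
      have "levy_density \<alpha> (0, x) = 0" for x by (simp add: levy_density_def)
      with True show ?thesis by simp
    next
      case False
      have cone: "\<bar>2 * (u * v) - v\<bar> \<le> \<bar>v\<bar> \<longleftrightarrow> u \<in> {0..1}" for u
      proof -
        have "\<bar>2 * (u * v) - v\<bar> = \<bar>v\<bar> * \<bar>2 * u - 1\<bar>" by (simp add: abs_mult[symmetric] algebra_simps)
        also have "\<dots> \<le> \<bar>v\<bar> \<longleftrightarrow> \<bar>2 * u - 1\<bar> \<le> 1" using False by (simp add: mult_le_cancel_left1)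
        finally show ?thesis by auto
      qed
      have v: "\<bar>v\<bar> * \<bar>v\<bar> powr (-2 - \<alpha>) = \<bar>v\<bar> powr (-1 - \<alpha>)"
        using False powr_add[of "\<bar>v\<bar>" 1 "-2 - \<alpha>"] by simp
      have [measurable]: "(\<lambda>x. F (v, x)) \<in> borel_measurable borel" "(\<lambda>x. levy_density \<alpha> (v, x)) \<in> borel_measurable borel"
        by measurable
      have "(\<integral>\<^sup>+x. ennreal (levy_density \<alpha> (v, x)) * F (v, x) \<partial>lborel)
        = ennreal \<bar>v\<bar> * (\<integral>\<^sup>+u. ennreal (levy_density \<alpha> (v, 0 + v * u)) * F (v, 0 + v * u) \<partial>lborel)"
        using False by (subst nn_integral_real_affine[where c = v and t = 0]) auto
      also have "\<dots> = ennreal \<bar>v\<bar> * (\<integral>\<^sup>+u. ennreal (\<bar>v\<bar> powr (-2 - \<alpha>) / levy_const \<alpha>)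
          * (F (v, u * v) * indicator {0..1} u) \<partial>lborel)"
      proof (rule arg_cong[where f = "(*) (ennreal \<bar>v\<bar>)"], rule nn_integral_cong)
        fix u
        have "levy_density \<alpha> (v, 0 + v * u) = (if u \<in> {0..1} then \<bar>v\<bar> powr (-2 - \<alpha>) / levy_const \<alpha> else 0)"
          using cone[of u] by (simp add: levy_density_def mult.commute)
        then show "ennreal (levy_density \<alpha> (v, 0 + v * u)) * F (v, 0 + v * u)
          = ennreal (\<bar>v\<bar> powr (-2 - \<alpha>) / levy_const \<alpha>) * (F (v, u * v) * indicator {0..1} u)"
          by (simp add: mult.commute[of v])
      qed
      also have "\<dots> = ennreal \<bar>v\<bar> * (ennreal (\<bar>v\<bar> powr (-2 - \<alpha>) / levy_const \<alpha>)
          * (\<integral>\<^sup>+u. F (v, u * v) * indicator {0..1} u \<partial>lborel))"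
        by (subst nn_integral_cmult) auto
      also have "\<dots> = ennreal (\<bar>v\<bar> powr (-1 - \<alpha>) / levy_const \<alpha>)
          * (\<integral>\<^sup>+u. F (v, u * v) * indicator {0..1} u \<partial>lborel)"
        by (simp add: mult.assoc[symmetric] ennreal_mult'[symmetric] v)
      finally show ?thesis .
    qed
  qed
  finally show ?thesis .
qed

lemma nn_integral_levy_density_fst:
  fixes F :: "real \<Rightarrow> ennreal"
  assumes [measurable]: "F \<in> borel_measurable borel"
  shows "(\<integral>\<^sup>+y. ennreal (levy_density \<alpha> y) * F (fst y) \<partial>lborel)
    = (\<integral>\<^sup>+v. ennreal (\<bar>v\<bar> powr (-1 - \<alpha>) / levy_const \<alpha>) * F v \<partial>lborel)"
proof -
  have "(\<lambda>y::real\<times>real. F (fst y)) \<in> borel_measurable borel"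
    unfolding borel_prod[symmetric] by measurable
  from nn_integral_levy_density[OF this, of \<alpha>] show ?thesis
    by (simp add: nn_integral_cmult)
qed

lemma levy_density_tail:
  assumes \<alpha>: "0 < \<alpha>" "\<alpha> < 2" and "r > 0"
  shows "(\<integral>\<^sup>+y. ennreal (levy_density \<alpha> y * indicator {r..} \<bar>fst y\<bar>) \<partial>lborel)
    \<le> ennreal (2 powr (1 + \<alpha>) * (2 / \<alpha>) / levy_const \<alpha> * r powr (-\<alpha>))"
proof -
  have "(\<integral>\<^sup>+y. ennreal (levy_density \<alpha> y * indicator {r..} \<bar>fst y\<bar>) \<partial>lborel)
    = (\<integral>\<^sup>+y. ennreal (levy_density \<alpha> y) * indicator {r..} \<bar>fst y\<bar> \<partial>lborel)"
    by (intro nn_integral_cong) (auto split: split_indicator)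
  also have "\<dots> = (\<integral>\<^sup>+v. ennreal (\<bar>v\<bar> powr (-1 - \<alpha>) / levy_const \<alpha>) * indicator {r..} \<bar>v\<bar> \<partial>lborel)"
    by (rule nn_integral_levy_density_fst) simp
  also have "\<dots> = (\<integral>\<^sup>+v. ennreal (1 / levy_const \<alpha>) * ennreal (\<bar>v\<bar> powr (-1 - \<alpha>) * indicator {r..} \<bar>v\<bar>) \<partial>lborel)"
    using levy_const_pos[OF \<alpha>]
    by (intro nn_integral_cong) (auto simp: ennreal_mult'[symmetric] split: split_indicator)
  also have "\<dots> = ennreal (1 / levy_const \<alpha>) * (\<integral>\<^sup>+v. ennreal (\<bar>v\<bar> powr (-1 - \<alpha>) * indicator {r..} \<bar>v\<bar>) \<partial>lborel)"
    by (rule nn_integral_cmult) simp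
  also have "\<dots> \<le> ennreal (1 / levy_const \<alpha>) * ennreal (2 powr (1 + \<alpha>) * (2 / \<alpha>) * r powr (-\<alpha>))"
    by (intro mult_left_mono nn_integral_powr_tail_le assms) simp
  also have "\<dots> = ennreal (2 powr (1 + \<alpha>) * (2 / \<alpha>) / levy_const \<alpha> * r powr (-\<alpha>))"
    using levy_const_pos[OF \<alpha>] by (simp add: ennreal_mult'[symmetric] mult_ac)
  finally show ?thesis .
qed

lemma levy_density_second_moment:
  assumes \<alpha>: "0 < \<alpha>" "\<alpha> < 2" and "r \<ge> 0"
  shows "(\<integral>\<^sup>+y. ennreal (levy_density \<alpha> y * ((fst y)\<^sup>2 * indicator {..r} \<bar>fst y\<bar>)) \<partial>lborel)
    \<le> ennreal (2 / (2 - \<alpha>) / levy_const \<alpha> * r powr (2 - \<alpha>))"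
proof -
  have "(\<integral>\<^sup>+y. ennreal (levy_density \<alpha> y * ((fst y)\<^sup>2 * indicator {..r} \<bar>fst y\<bar>)) \<partial>lborel)
    = (\<integral>\<^sup>+y. ennreal (levy_density \<alpha> y) * ennreal ((fst y)\<^sup>2 * indicator {..r} \<bar>fst y\<bar>) \<partial>lborel)"
    by (intro nn_integral_cong) (auto simp: ennreal_mult'' split: split_indicator)
  also have "\<dots> = (\<integral>\<^sup>+v. ennreal (\<bar>v\<bar> powr (-1 - \<alpha>) / levy_const \<alpha>) * ennreal (v\<^sup>2 * indicator {..r} \<bar>v\<bar>) \<partial>lborel)"
    by (rule nn_integral_levy_density_fst) simp
  also have "\<dots> = (\<integral>\<^sup>+v. ennreal (1 / levy_const \<alpha>) * ennreal (\<bar>v\<bar> powr ((2 - \<alpha>) - 1) * indicator {..r} \<bar>v\<bar>) \<partial>lborel)"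
  proof (intro nn_integral_cong)
    fix v :: real
    have "\<bar>v\<bar> powr (-1 - \<alpha>) * v\<^sup>2 = \<bar>v\<bar> powr ((2 - \<alpha>) - 1)"
      using power2_mult_powr[of v "-1 - \<alpha>"] by (simp add: mult.commute)
    then have "\<bar>v\<bar> powr (-1 - \<alpha>) / levy_const \<alpha> * (v\<^sup>2 * indicator {..r} \<bar>v\<bar>)
       = 1 / levy_const \<alpha> * (\<bar>v\<bar> powr ((2 - \<alpha>) - 1) * indicator {..r} \<bar>v\<bar>)"
      by (simp split: split_indicator)
    then show "ennreal (\<bar>v\<bar> powr (-1 - \<alpha>) / levy_const \<alpha>) * ennreal (v\<^sup>2 * indicator {..r} \<bar>v\<bar>)
      = ennreal (1 / levy_const \<alpha>) * ennreal (\<bar>v\<bar> powr ((2 - \<alpha>) - 1) * indicator {..r} \<bar>v\<bar>)"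
      by (simp only: ennreal_mult''[symmetric] zero_le_mult_iff zero_le_power2 indicator_pos_le powr_ge_zero simp_thms)
  qed
  also have "\<dots> = ennreal (1 / levy_const \<alpha>) * (\<integral>\<^sup>+v. ennreal (\<bar>v\<bar> powr ((2 - \<alpha>) - 1) * indicator {..r} \<bar>v\<bar>) \<partial>lborel)"
    by (rule nn_integral_cmult) simp
  also have "\<dots> \<le> ennreal (1 / levy_const \<alpha>) * ennreal (2 / (2 - \<alpha>) * r powr (2 - \<alpha>))"
    using assms by (intro mult_left_mono nn_integral_powr_near_0_le) simp_all
  also have "\<dots> = ennreal (2 / (2 - \<alpha>) / levy_const \<alpha> * r powr (2 - \<alpha>))"
    using levy_const_pos[OF \<alpha>] by (simp add: ennreal_mult'[symmetric] mult_ac)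
  finally show ?thesis .
qed

lemma symbol_integrable:
  fixes a b \<alpha> :: real
  assumes "0 < \<alpha>"
  shows "set_integrable lborel {0..1} (\<lambda>u. \<bar>a + u * b\<bar> powr \<alpha>)"
proof (rule borel_integrable_atLeastAtMost')
  show "continuous_on {0..1} (\<lambda>u. \<bar>a + u * b\<bar> powr \<alpha>)"
    by (intro continuous_on_powr' continuous_intros) (use assms in auto)
qed

text \<open>In the variables \<open>(v, u)\<close> of \<open>nn_integral_levy_density\<close> one has \<open>y \<bullet> \<zeta> = v (\<phi> + u \<xi>)\<close>. After the order
of integration is exchanged, the one-dimensional formula applies for each \<open>u\<close>.\<close>

theorem levy_khintchine:
  assumes \<alpha>: "0 < \<alpha>" "\<alpha> < 2"
  shows "has_bochner_integral lborel (\<lambda>y. (1 - cos (y \<bullet> \<zeta>)) * levy_density \<alpha> y) (symbol \<alpha> \<zeta>)"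
proof (rule has_bochner_integral_nn_integral)
  obtain \<phi> \<xi> where \<zeta>: "\<zeta> = (\<phi>, \<xi>)" by (cases \<zeta>)
  have pos: "0 \<le> symbol \<alpha> \<zeta>"
    unfolding symbol_def set_lebesgue_integral_def by (intro integral_nonneg_AE) auto
  then show "0 \<le> symbol \<alpha> \<zeta>" .
  have "(\<integral>\<^sup>+y. ennreal ((1 - cos (y \<bullet> \<zeta>)) * levy_density \<alpha> y) \<partial>lborel)
      = (\<integral>\<^sup>+y. ennreal (levy_density \<alpha> y) * ennreal (1 - cos (y \<bullet> \<zeta>)) \<partial>lborel)"
    by (intro nn_integral_cong) (simp add: ennreal_mult'' mult.commute)
  also have "\<dots> = (\<integral>\<^sup>+v. ennreal (\<bar>v\<bar> powr (-1 - \<alpha>) / levy_const \<alpha>)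
      * (\<integral>\<^sup>+u. ennreal (1 - cos ((v, u * v) \<bullet> \<zeta>)) * indicator {0..1} u \<partial>lborel) \<partial>lborel)"
    by (rule nn_integral_levy_density) simp
  also have "\<dots> = (\<integral>\<^sup>+v. (\<integral>\<^sup>+u. ennreal ((1 - cos (v * (\<phi> + u * \<xi>))) * \<bar>v\<bar> powr (-1 - \<alpha>) / levy_const \<alpha>)
      * indicator {0..1} u \<partial>lborel) \<partial>lborel)"
  proof (rule nn_integral_cong)
    fix v :: real
    have "ennreal (\<bar>v\<bar> powr (-1 - \<alpha>) / levy_const \<alpha>)
        * (\<integral>\<^sup>+u. ennreal (1 - cos ((v, u * v) \<bullet> \<zeta>)) * indicator {0..1} u \<partial>lborel)
      = (\<integral>\<^sup>+u. ennreal (\<bar>v\<bar> powr (-1 - \<alpha>) / levy_const \<alpha>)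
          * (ennreal (1 - cos ((v, u * v) \<bullet> \<zeta>)) * indicator {0..1} u) \<partial>lborel)"
      by (rule nn_integral_cmult[symmetric]) (simp add: \<zeta> inner_prod_def)
    also have "\<dots> = (\<integral>\<^sup>+u. ennreal ((1 - cos (v * (\<phi> + u * \<xi>))) * \<bar>v\<bar> powr (-1 - \<alpha>) / levy_const \<alpha>)
        * indicator {0..1} u \<partial>lborel)"
    proof (rule nn_integral_cong)
      fix u :: real
      have "(v, u * v) \<bullet> \<zeta> = v * (\<phi> + u * \<xi>)" by (simp add: \<zeta> inner_prod_def algebra_simps)
      then show "ennreal (\<bar>v\<bar> powr (-1 - \<alpha>) / levy_const \<alpha>)
          * (ennreal (1 - cos ((v, u * v) \<bullet> \<zeta>)) * indicator {0..1} u)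
        = ennreal ((1 - cos (v * (\<phi> + u * \<xi>))) * \<bar>v\<bar> powr (-1 - \<alpha>) / levy_const \<alpha>)
          * indicator {0..1} u"
        by (simp add: mult.assoc[symmetric] ennreal_mult''[symmetric] mult.commute[of "1 - cos _"])
    qed
    finally show "ennreal (\<bar>v\<bar> powr (-1 - \<alpha>) / levy_const \<alpha>)
        * (\<integral>\<^sup>+u. ennreal (1 - cos ((v, u * v) \<bullet> \<zeta>)) * indicator {0..1} u \<partial>lborel)
      = (\<integral>\<^sup>+u. ennreal ((1 - cos (v * (\<phi> + u * \<xi>))) * \<bar>v\<bar> powr (-1 - \<alpha>) / levy_const \<alpha>)
        * indicator {0..1} u \<partial>lborel)" .
  qed
  also have "\<dots> = (\<integral>\<^sup>+u. (\<integral>\<^sup>+v. ennreal ((1 - cos (v * (\<phi> + u * \<xi>))) * \<bar>v\<bar> powr (-1 - \<alpha>) / levy_const \<alpha>)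
      * indicator {0..1} u \<partial>lborel) \<partial>lborel)"
    by (rule lborel_pair.Fubini') simp
  also have "\<dots> = (\<integral>\<^sup>+u. ennreal (\<bar>\<phi> + u * \<xi>\<bar> powr \<alpha>) * indicator {0..1} u \<partial>lborel)"
    by (subst nn_integral_multc) (simp_all add: levy_khintchine_1d[OF \<alpha>])
  also have "\<dots> = (\<integral>\<^sup>+u. ennreal (indicator {0..1} u *\<^sub>R \<bar>\<phi> + u * \<xi>\<bar> powr \<alpha>) \<partial>lborel)"
    by (intro nn_integral_cong) (auto split: split_indicator)
  also have "\<dots> = ennreal (symbol \<alpha> \<zeta>)"
    using symbol_integrable[OF \<alpha>(1), of \<phi> \<xi>] unfolding symbol_def \<zeta> set_lebesgue_integral_def set_integrable_def
    by (simp add: nn_integral_eq_integral)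
  finally show "(\<integral>\<^sup>+y. ennreal ((1 - cos (y \<bullet> \<zeta>)) * levy_density \<alpha> y) \<partial>lborel) = ennreal (symbol \<alpha> \<zeta>)" .
qed (use levy_density_nonneg[OF \<alpha>] in auto)

lemma symbol_measurable [measurable]: "symbol \<alpha> \<in> borel_measurable borel"
  unfolding symbol_def set_lebesgue_integral_def borel_prod[symmetric] by measurable

text \<open>For \<open>\<alpha> \<le> 2\<close> and \<open>\<bar>a\<bar> \<le> M\<close> one has \<open>\<bar>a\<bar>\<^sup>\<alpha> \<ge> M\<^sup>\<alpha>\<^sup>-\<^sup>2 a\<^sup>2\<close>, which reduces the claim to \<open>\<alpha> = 2\<close>. There the integral
is a positive definite quadratic form, so the symbol cannot degenerate in any direction.\<close>

lemma symbol_ge: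
  assumes \<alpha>: "0 < \<alpha>" "\<alpha> < 2"
  shows "(\<bar>\<phi>\<bar> + \<bar>\<xi>\<bar>) powr \<alpha> / 32 \<le> symbol \<alpha> (\<phi>, \<xi>)"
proof (cases "\<phi> = 0 \<and> \<xi> = 0")
  case True
  then show ?thesis using \<alpha> by (simp add: symbol_def)
next
  case False
  define M where "M = \<bar>\<phi>\<bar> + \<bar>\<xi>\<bar>"
  have M: "M > 0" using False by (auto simp: M_def)
  have sq: "M powr (\<alpha> - 2) * (\<phi> + u * \<xi>)\<^sup>2 \<le> \<bar>\<phi> + u * \<xi>\<bar> powr \<alpha>" if "u \<in> {0..1}" for u
  proof (cases "\<phi> + u * \<xi> = 0")
    case False
    have "\<bar>\<phi> + u * \<xi>\<bar> \<le> \<bar>\<phi>\<bar> + u * \<bar>\<xi>\<bar>"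
      using that abs_triangle_ineq[of \<phi> "u * \<xi>"] by (simp add: abs_mult)
    also have "\<dots> \<le> M" using that by (simp add: M_def mult_left_le_one_le)
    finally have "M powr (\<alpha> - 2) \<le> \<bar>\<phi> + u * \<xi>\<bar> powr (\<alpha> - 2)"
      using \<alpha> False by (intro powr_mono2') auto
    then have "M powr (\<alpha> - 2) * (\<phi> + u * \<xi>)\<^sup>2 \<le> \<bar>\<phi> + u * \<xi>\<bar> powr (\<alpha> - 2) * (\<phi> + u * \<xi>)\<^sup>2"
      by (intro mult_right_mono) auto
    also have "\<dots> = \<bar>\<phi> + u * \<xi>\<bar> powr \<alpha>"
      using power2_mult_powr[of "\<phi> + u * \<xi>" "\<alpha> - 2"] by (simp add: mult.commute)
    finally show ?thesis .
  qed simp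
  \<comment> \<open>\<open>\<phi>\<^sup>2 + \<phi>\<xi> + \<xi>\<^sup>2/3 - (\<phi>\<^sup>2 + \<xi>\<^sup>2)/16\<close> is \<open>1/240\<close> times \<open>(15\<phi> + 8\<xi>)\<^sup>2 + \<xi>\<^sup>2\<close>, and \<open>M\<^sup>2 \<le> 2(\<phi>\<^sup>2 + \<xi>\<^sup>2)\<close>.\<close>
  have quad: "M\<^sup>2 / 32 \<le> \<phi>\<^sup>2 + \<phi> * \<xi> + \<xi>\<^sup>2 / 3"
  proof -
    have "M\<^sup>2 = \<phi>\<^sup>2 + \<xi>\<^sup>2 + 2 * \<bar>\<phi>\<bar> * \<bar>\<xi>\<bar>" by (simp add: M_def power2_sum)
    moreover have "0 \<le> (\<bar>\<phi>\<bar> - \<bar>\<xi>\<bar>)\<^sup>2" by simp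
    ultimately have "M\<^sup>2 \<le> 2 * (\<phi>\<^sup>2 + \<xi>\<^sup>2)" by (simp add: power2_diff)
    moreover have "0 \<le> \<xi>\<^sup>2" by simp
    moreover have "0 \<le> (15 * \<phi> + 8 * \<xi>)\<^sup>2" by simp
    moreover have "(15 * \<phi> + 8 * \<xi>)\<^sup>2 = 225 * \<phi>\<^sup>2 + 240 * (\<phi> * \<xi>) + 64 * \<xi>\<^sup>2"
      by (simp add: power2_eq_square algebra_simps)
    ultimately have "0 \<le> 240 * (\<phi>\<^sup>2 + \<phi> * \<xi> + \<xi>\<^sup>2 / 3 - M\<^sup>2 / 32)"
      by argo
    then show ?thesis by simp
  qed
  have "(\<integral>u. (M powr (\<alpha> - 2) * (\<phi> + u * \<xi>)\<^sup>2) * indicator {0..1} u \<partial>lborel)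
      = M powr (\<alpha> - 2) * (\<phi>\<^sup>2 * 1 + \<phi> * \<xi> * 1\<^sup>2 + \<xi>\<^sup>2 * 1 ^ 3 / 3)
       - M powr (\<alpha> - 2) * (\<phi>\<^sup>2 * 0 + \<phi> * \<xi> * 0\<^sup>2 + \<xi>\<^sup>2 * 0 ^ 3 / 3)"
    by (rule integral_FTC_Icc_real)
      (auto intro!: derivative_eq_intros continuous_intros simp: power2_eq_square algebra_simps)
  then have eq: "(\<integral>u. (M powr (\<alpha> - 2) * (\<phi> + u * \<xi>)\<^sup>2) * indicator {0..1} u \<partial>lborel)
      = M powr (\<alpha> - 2) * (\<phi>\<^sup>2 + \<phi> * \<xi> + \<xi>\<^sup>2 / 3)" by simp
  have "M powr \<alpha> / 32 = M powr (\<alpha> - 2) * (M\<^sup>2 / 32)"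
    using M by (simp add: powr_diff powr_numeral)
  also have "\<dots> \<le> M powr (\<alpha> - 2) * (\<phi>\<^sup>2 + \<phi> * \<xi> + \<xi>\<^sup>2 / 3)"
    by (intro mult_left_mono quad) simp
  also have "\<dots> = (LINT u:{0..1}|lborel. M powr (\<alpha> - 2) * (\<phi> + u * \<xi>)\<^sup>2)"
    unfolding eq[symmetric] set_lebesgue_integral_def
    by (intro Bochner_Integration.integral_cong) simp_all
  also have "\<dots> \<le> symbol \<alpha> (\<phi>, \<xi>)"
    unfolding symbol_def fst_conv snd_conv
    by (intro set_integral_mono sq symbol_integrable \<alpha> borel_integrable_atLeastAtMost' continuous_intros)
  finally show ?thesis by (simp add: M_def)
qed

lemma power_le_fact_exp:
  fixes y :: real
  assumes "0 \<le> y"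
  shows "y ^ n / fact n \<le> exp y"
proof -
  have "y ^ n / fact n \<le> (\<Sum>k. y ^ k / fact k)"
    using sum_le_suminf[of "\<lambda>k. y ^ k / fact k" "{n}"] summable_exp[of y] assms
    by (auto simp: field_simps)
  then show ?thesis by (simp add: exp_def scaleR_conv_of_real field_simps)
qed

text \<open>The symbol grows at least like a power of \<open>\<bar>\<phi>\<bar> + \<bar>\<xi>\<bar>\<close>, so that its negative exponential is dominated by
a product of two Cauchy densities.\<close>

lemma exp_symbol_integrable:
  assumes \<alpha>: "0 < \<alpha>" "\<alpha> < 2" and "c > 0"
  shows "integrable lborel (\<lambda>\<zeta>. exp (- c * symbol \<alpha> \<zeta>))"
proof -
  define b where "b = c / 32"
  have b: "b > 0" using assms by (simp add: b_def)
  \<comment> \<open>Then \<open>M ^ 4 \<le> M powr (\<alpha> * N)\<close> for \<open>M \<ge> 1\<close>, and the term of order \<open>N\<close> of the exponential series suffices.\<close>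
  obtain N :: nat where N: "N \<ge> 4 / \<alpha>" using real_arch_simple by blast
  define K where "K = 4 + 4 * fact N / b ^ N"
  have K: "K \<ge> 4" using b by (simp add: K_def)
  have bound: "exp (- b * M powr \<alpha>) \<le> K / (1 + M\<^sup>2)\<^sup>2" if "M \<ge> 0" for M :: real
  proof -
    have "(1 + M\<^sup>2)\<^sup>2 \<le> K * exp (b * M powr \<alpha>)"
    proof (cases "M \<le> 1")
      case True
      then have "M\<^sup>2 \<le> 1" using that by (simp add: power_le_one)
      then have "(1 + M\<^sup>2)\<^sup>2 \<le> 2\<^sup>2" by (intro power_mono) auto
      also have "\<dots> \<le> K * 1" using K by simp
      also have "\<dots> \<le> K * exp (b * M powr \<alpha>)" using K b by (intro mult_left_mono) auto
      finally show ?thesis .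
    next
      case False
      then have "1 + M\<^sup>2 \<le> 2 * M\<^sup>2" by (simp add: power2_eq_square) (metis le_less_linear mult_mono' mult_1 order_less_imp_le zero_le_one)
      then have "(1 + M\<^sup>2)\<^sup>2 \<le> (2 * M\<^sup>2)\<^sup>2" by (intro power_mono) auto
      also have "\<dots> = 4 * M powr 4" using False by (simp add: powr_numeral power_mult_distrib)
      also have "\<dots> \<le> 4 * M powr (\<alpha> * N)"
        using False N \<alpha> by (intro mult_left_mono powr_mono) (auto simp: field_simps)
      also have "\<dots> = 4 * (M powr \<alpha>) ^ N"
        using False by (simp add: powr_powr[symmetric] powr_realpow)
      also have "\<dots> = 4 * fact N / b ^ N * ((b * M powr \<alpha>) ^ N / fact N)"
        using b by (simp add: power_mult_distrib)
      also have "\<dots> \<le> 4 * fact N / b ^ N * exp (b * M powr \<alpha>)"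
        using b by (intro mult_left_mono power_le_fact_exp) auto
      also have "\<dots> \<le> K * exp (b * M powr \<alpha>)" by (intro mult_right_mono) (auto simp: K_def)
      finally show ?thesis .
    qed
    moreover have "(1 + M\<^sup>2)\<^sup>2 > 0" using add_pos_nonneg[OF zero_less_one zero_le_power2[of M]] by simp
    ultimately show ?thesis by (simp add: exp_minus pos_le_divide_eq) (simp add: field_simps)
  qed
  \<comment> \<open>The majorant \<open>K / (1 + M\<^sup>2)\<^sup>2\<close> is at most \<open>K / ((1 + \<phi>\<^sup>2) * (1 + \<xi>\<^sup>2))\<close>, because \<open>\<bar>\<phi>\<bar>\<close> and \<open>\<bar>\<xi>\<bar>\<close> do not exceed \<open>M\<close>.\<close>
  have cauchy: "integrable lborel (\<lambda>x::real. inverse (1 + x\<^sup>2))"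
    using integrable_inverse_1_plus_square by (simp add: set_integrable_def)
  have "integrable (lborel \<Otimes>\<^sub>M lborel) (\<lambda>(\<phi>::real, \<xi>::real). K * (inverse (1 + \<phi>\<^sup>2) * inverse (1 + \<xi>\<^sup>2)))"
    using cauchy by (intro lborel_pair.Fubini_integrable) (auto simp: abs_mult)
  then have maj: "integrable lborel (\<lambda>\<zeta>::real\<times>real. K * (inverse (1 + (fst \<zeta>)\<^sup>2) * inverse (1 + (snd \<zeta>)\<^sup>2)))"
    by (simp add: lborel_prod case_prod_beta')
  show ?thesis
  proof (rule Bochner_Integration.integrable_bound[OF maj])
    show "(\<lambda>\<zeta>. exp (- c * symbol \<alpha> \<zeta>)) \<in> borel_measurable lborel"
      by measurable
    show "AE \<zeta> in lborel. norm (exp (- c * symbol \<alpha> \<zeta>))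
        \<le> norm (K * (inverse (1 + (fst \<zeta>)\<^sup>2) * inverse (1 + (snd \<zeta>)\<^sup>2)))"
    proof (rule AE_I2)
      fix \<zeta> :: "real \<times> real"
      obtain \<phi> \<xi> where \<zeta>: "\<zeta> = (\<phi>, \<xi>)" by (cases \<zeta>)
      define M where "M = \<bar>\<phi>\<bar> + \<bar>\<xi>\<bar>"
      have M: "M \<ge> 0" "\<phi>\<^sup>2 \<le> M\<^sup>2" "\<xi>\<^sup>2 \<le> M\<^sup>2"
        unfolding abs_le_square_iff[symmetric] by (auto simp: M_def)
      have "exp (- c * symbol \<alpha> \<zeta>) \<le> exp (- b * M powr \<alpha>)"
        using mult_left_mono[OF symbol_ge[OF \<alpha>, of \<phi> \<xi>], of c] \<open>c > 0\<close> by (simp add: \<zeta> b_def M_def)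
      also have "\<dots> \<le> K / (1 + M\<^sup>2)\<^sup>2" by (rule bound[OF M(1)])
      also have "\<dots> \<le> K / ((1 + \<phi>\<^sup>2) * (1 + \<xi>\<^sup>2))"
        unfolding power2_eq_square[of "1 + M\<^sup>2"]
        using K M by (intro divide_left_mono mult_mono mult_pos_pos add_pos_nonneg) auto
      finally show "norm (exp (- c * symbol \<alpha> \<zeta>)) \<le> norm (K * (inverse (1 + (fst \<zeta>)\<^sup>2) * inverse (1 + (snd \<zeta>)\<^sup>2)))"
        using K by (simp add: \<zeta> divide_inverse abs_mult)
    qed
  qed
qed

section \<open>Restricting the size of the jumps\<close>

lemma integral_lborel_uminus:
  fixes f :: "'a::euclidean_space \<Rightarrow> 'b::{banach, second_countable_topology}"
  assumes [measurable]: "f \<in> borel_measurable borel"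
  shows "(\<integral>y. f (- y) \<partial>lborel) = (\<integral>y. f y \<partial>lborel)"
proof -
  have "(lborel :: 'a measure) = distr lborel borel uminus"
    using lborel_affine[of "-1" "0::'a"] by (simp add: density_1)
  then have "(\<integral>y. f y \<partial>lborel) = (\<integral>y. f y \<partial>distr lborel borel uminus)" by simp
  also have "\<dots> = (\<integral>y. f (- y) \<partial>lborel)" by (rule integral_distr) auto
  finally show ?thesis ..
qed

text \<open>Jumps are classified by the size \<open>\<bar>fst y\<bar>\<close> of the velocity jump. On the cone this is comparable to the
length of \<open>y\<close>.\<close>

definition restricted_levy :: "real \<Rightarrow> real set \<Rightarrow> real \<times> real \<Rightarrow> real" where
  "restricted_levy \<alpha> S y = levy_density \<alpha> y * indicator S \<bar>fst y\<bar>"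

definition restricted_symbol :: "real \<Rightarrow> real set \<Rightarrow> real \<times> real \<Rightarrow> real" where
  "restricted_symbol \<alpha> S \<zeta> = (\<integral>y. (1 - cos (y \<bullet> \<zeta>)) * restricted_levy \<alpha> S y \<partial>lborel)"

definition jump_mass :: "real \<Rightarrow> real set \<Rightarrow> real" where
  "jump_mass \<alpha> S = (\<integral>y. restricted_levy \<alpha> S y \<partial>lborel)"

text \<open>The constant in the bound on the second moment of the jumps of size at most \<open>r\<close>, which is
\<open>moment_const \<alpha> * r powr (2 - \<alpha>)\<close>.\<close>

definition moment_const :: "real \<Rightarrow> real" where
  "moment_const \<alpha> = 2 / (2 - \<alpha>) / levy_const \<alpha>"

lemma fst_measurable_borel [measurable]: "fst \<in> borel_measurable (borel :: (real \<times> real) measure)"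
  "snd \<in> borel_measurable (borel :: (real \<times> real) measure)"
  by (auto intro!: borel_measurable_continuous_onI continuous_intros)

lemma inner_square_le:
  fixes y \<theta> :: "real \<times> real"
  assumes "\<bar>snd y\<bar> \<le> \<bar>fst y\<bar>"
  shows "(y \<bullet> \<theta>)\<^sup>2 \<le> 2 * (norm \<theta>)\<^sup>2 * (fst y)\<^sup>2"
proof -
  have "(y \<bullet> \<theta>)\<^sup>2 \<le> (norm y)\<^sup>2 * (norm \<theta>)\<^sup>2"
    using Cauchy_Schwarz_ineq[of y \<theta>] by (simp add: power2_norm_eq_inner)
  also have "(norm y)\<^sup>2 \<le> 2 * (fst y)\<^sup>2"
    using assms by (simp add: power2_norm_eq_inner inner_prod_def abs_le_square_iff flip: power2_eq_square)
  finally show ?thesis by (simp add: mult_ac mult_right_mono)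
qed

context
  fixes \<alpha> :: real
  assumes \<alpha>: "0 < \<alpha>" "\<alpha> < 2"
begin

lemma restricted_levy_measurable [measurable]:
  "S \<in> sets borel \<Longrightarrow> restricted_levy \<alpha> S \<in> borel_measurable borel"
proof -
  assume "S \<in> sets borel"
  then have "(\<lambda>y. indicat_real S \<bar>fst y\<bar>) \<in> borel_measurable (borel :: (real \<times> real) measure)"
    by (intro measurable_compose[of "\<lambda>y. \<bar>fst y\<bar>" borel borel "indicator S"]) auto
  then show ?thesis unfolding restricted_levy_def by measurable
qed

lemma restricted_levy_nonneg: "0 \<le> restricted_levy \<alpha> S y"
  by (simp add: restricted_levy_def levy_density_nonneg \<alpha>)

lemma restricted_levy_minus: "restricted_levy \<alpha> S (- y) = restricted_levy \<alpha> S y"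
  by (simp add: restricted_levy_def levy_density_minus)

lemma restricted_levy_support:
  assumes "restricted_levy \<alpha> S y \<noteq> 0"
  shows "\<bar>fst y\<bar> \<in> S" "\<bar>snd y\<bar> \<le> \<bar>fst y\<bar>"
  using assms by (auto simp: restricted_levy_def levy_density_def split: if_splits split_indicator_asm)

lemma restricted_levy_integrable:
  assumes [measurable]: "S \<in> sets borel" and S: "S \<subseteq> {r..}" "r > 0"
  shows "integrable lborel (restricted_levy \<alpha> S)"
proof (rule integrableI_bounded)
  have "(\<integral>\<^sup>+y. ennreal (norm (restricted_levy \<alpha> S y)) \<partial>lborel)
      \<le> (\<integral>\<^sup>+y. ennreal (levy_density \<alpha> y * indicator {r..} \<bar>fst y\<bar>) \<partial>lborel)"
    using S levy_density_nonneg[OF \<alpha>]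
    by (intro nn_integral_mono) (auto simp: restricted_levy_def intro!: ennreal_leI split: split_indicator)
  also have "\<dots> < \<infinity>"
    using le_less_trans[OF levy_density_tail[OF \<alpha> \<open>r > 0\<close>] ennreal_less_top] by simp
  finally show "(\<integral>\<^sup>+y. ennreal (norm (restricted_levy \<alpha> S y)) \<partial>lborel) < \<infinity>" .
qed simp

lemma truncated_levy_integrable: "0 < \<epsilon> \<Longrightarrow> integrable lborel (restricted_levy \<alpha> {\<epsilon>..<1})"
  by (rule restricted_levy_integrable[where r = \<epsilon>]) auto

lemma restricted_symbol_integrable:
  assumes [measurable]: "S \<in> sets borel"
  shows "integrable lborel (\<lambda>y. (1 - cos (y \<bullet> \<zeta>)) * restricted_levy \<alpha> S y)"
proof (rule Bochner_Integration.integrable_bound)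
  show "integrable lborel (\<lambda>y. (1 - cos (y \<bullet> \<zeta>)) * levy_density \<alpha> y)"
    using levy_khintchine[OF \<alpha>] by (rule integrable.intros)
qed (auto simp: restricted_levy_def abs_mult split: split_indicator)

lemma restricted_symbol_nonneg: "0 \<le> restricted_symbol \<alpha> S \<zeta>"
  unfolding restricted_symbol_def
  by (intro integral_nonneg_AE AE_I2 mult_nonneg_nonneg restricted_levy_nonneg) simp

lemma restricted_symbol_split:
  assumes "0 < \<epsilon>" "\<epsilon> < 1"
  shows "symbol \<alpha> \<zeta> = restricted_symbol \<alpha> {..<\<epsilon>} \<zeta> + restricted_symbol \<alpha> {\<epsilon>..<1} \<zeta> + restricted_symbol \<alpha> {1..} \<zeta>"
proof -
  have "symbol \<alpha> \<zeta> = (\<integral>y. (1 - cos (y \<bullet> \<zeta>)) * levy_density \<alpha> y \<partial>lborel)"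
    using has_bochner_integral_integral_eq[OF levy_khintchine[OF \<alpha>]] by simp
  also have "\<dots> = (\<integral>y. (1 - cos (y \<bullet> \<zeta>)) * restricted_levy \<alpha> {..<\<epsilon>} y
      + (1 - cos (y \<bullet> \<zeta>)) * restricted_levy \<alpha> {\<epsilon>..<1} y
      + (1 - cos (y \<bullet> \<zeta>)) * restricted_levy \<alpha> {1..} y \<partial>lborel)"
    using assms by (intro Bochner_Integration.integral_cong)
      (auto simp: restricted_levy_def split: split_indicator)
  also have "\<dots> = restricted_symbol \<alpha> {..<\<epsilon>} \<zeta> + restricted_symbol \<alpha> {\<epsilon>..<1} \<zeta> + restricted_symbol \<alpha> {1..} \<zeta>"
    unfolding restricted_symbol_def
    by (simp add: restricted_symbol_integrable)
  finally show ?thesis .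
qed

lemma restricted_symbol_le_mass:
  assumes "S \<in> sets borel" "S \<subseteq> {r..}" "r > 0"
  shows "restricted_symbol \<alpha> S \<zeta> \<le> 2 * jump_mass \<alpha> S"
proof -
  have "restricted_symbol \<alpha> S \<zeta> \<le> (\<integral>y. 2 * restricted_levy \<alpha> S y \<partial>lborel)"
    unfolding restricted_symbol_def
  proof (rule integral_mono)
    show "(1 - cos (y \<bullet> \<zeta>)) * restricted_levy \<alpha> S y \<le> 2 * restricted_levy \<alpha> S y" for y
      using cos_ge_minus_one[of "y \<bullet> \<zeta>"] by (intro mult_right_mono restricted_levy_nonneg) linarith
  qed (use restricted_levy_integrable[OF assms] restricted_symbol_integrable[OF assms(1)] in auto)
  then show ?thesis by (simp add: jump_mass_def)
qed

lemma fourier_restricted_levy: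
  assumes S: "S \<in> sets borel" "S \<subseteq> {r..}" "r > 0"
  shows "fourier (restricted_levy \<alpha> S) \<zeta> = of_real (jump_mass \<alpha> S - restricted_symbol \<alpha> S \<zeta>)"
proof -
  note [measurable] = S(1)
  let ?n = "restricted_levy \<alpha> S"
  note int = restricted_levy_integrable[OF S]
  have c: "integrable lborel (\<lambda>y. cos (y \<bullet> \<zeta>) * ?n y)"
    by (rule Bochner_Integration.integrable_bound[OF int]) (auto simp: abs_mult mult_left_le_one_le)
  have s: "integrable lborel (\<lambda>y. sin (y \<bullet> \<zeta>) * ?n y)"
    by (rule Bochner_Integration.integrable_bound[OF int]) (auto simp: abs_mult mult_left_le_one_le)
  have "(\<integral>y. sin (y \<bullet> \<zeta>) * ?n y \<partial>lborel) = (\<integral>y. sin (- y \<bullet> \<zeta>) * ?n (- y) \<partial>lborel)"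
    by (rule integral_lborel_uminus[symmetric]) simp
  \<comment> \<open>The jump density is even, so that its transform is real.\<close>
  then have s0: "(\<integral>y. sin (y \<bullet> \<zeta>) * ?n y \<partial>lborel) = 0"
    by (simp add: restricted_levy_minus)
  have "fourier ?n \<zeta> = (\<integral>y. complex_of_real (cos (y \<bullet> \<zeta>) * ?n y) - \<i> * complex_of_real (sin (y \<bullet> \<zeta>) * ?n y) \<partial>lborel)"
    unfolding fourier_def
    by (intro Bochner_Integration.integral_cong) (auto simp: complex_eq_iff)
  also have "\<dots> = of_real (\<integral>y. cos (y \<bullet> \<zeta>) * ?n y \<partial>lborel) - \<i> * of_real (\<integral>y. sin (y \<bullet> \<zeta>) * ?n y \<partial>lborel)"
    using c s by (subst Bochner_Integration.integral_diff) (auto simp del: of_real_mult)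
  also have "(\<integral>y. cos (y \<bullet> \<zeta>) * ?n y \<partial>lborel) = jump_mass \<alpha> S - restricted_symbol \<alpha> S \<zeta>"
    unfolding jump_mass_def restricted_symbol_def
    using int restricted_symbol_integrable[OF S(1)]
    by (subst Bochner_Integration.integral_diff[symmetric]) (auto simp: algebra_simps)
  finally show ?thesis by (simp add: s0)
qed

lemma restricted_second_moment:
  assumes [measurable]: "S \<in> sets borel" and S: "S \<subseteq> {..r}" "r \<ge> 0"
  shows "integrable lborel (\<lambda>y. (fst y)\<^sup>2 * restricted_levy \<alpha> S y)"
    and "(\<integral>y. (fst y)\<^sup>2 * restricted_levy \<alpha> S y \<partial>lborel) \<le> moment_const \<alpha> * r powr (2 - \<alpha>)"
proof -
  have le: "(\<integral>\<^sup>+y. ennreal ((fst y)\<^sup>2 * restricted_levy \<alpha> S y) \<partial>lborel) \<le> ennreal (moment_const \<alpha> * r powr (2 - \<alpha>))"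
  proof -
    have "(\<integral>\<^sup>+y. ennreal ((fst y)\<^sup>2 * restricted_levy \<alpha> S y) \<partial>lborel)
      \<le> (\<integral>\<^sup>+y. ennreal (levy_density \<alpha> y * ((fst y)\<^sup>2 * indicator {..r} \<bar>fst y\<bar>)) \<partial>lborel)"
      using S levy_density_nonneg[OF \<alpha>]
      by (intro nn_integral_mono) (auto simp: restricted_levy_def intro!: ennreal_leI split: split_indicator)
    also have "\<dots> \<le> ennreal (moment_const \<alpha> * r powr (2 - \<alpha>))"
      unfolding moment_const_def by (rule levy_density_second_moment[OF \<alpha> S(2)])
    finally show ?thesis .
  qed
  show "integrable lborel (\<lambda>y. (fst y)\<^sup>2 * restricted_levy \<alpha> S y)"
    using le_less_trans[OF le ennreal_less_top] restricted_levy_nonneg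
    by (intro integrableI_bounded) auto
  have "(\<integral>y. (fst y)\<^sup>2 * restricted_levy \<alpha> S y \<partial>lborel)
      = enn2real (\<integral>\<^sup>+y. ennreal ((fst y)\<^sup>2 * restricted_levy \<alpha> S y) \<partial>lborel)"
    by (intro integral_eq_nn_integral) (auto simp: restricted_levy_nonneg)
  also have "\<dots> \<le> moment_const \<alpha> * r powr (2 - \<alpha>)"
    using levy_const_pos[OF \<alpha>] \<alpha> by (intro enn2real_leI[OF _ le]) (simp add: moment_const_def)
  finally show "(\<integral>y. (fst y)\<^sup>2 * restricted_levy \<alpha> S y \<partial>lborel) \<le> moment_const \<alpha> * r powr (2 - \<alpha>)" .
qed

text \<open>Jumps of size below \<open>\<epsilon>\<close> contribute no more to the exponent than a Gaussian of this variance. The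
approximation below therefore replaces them by exactly that Gaussian.\<close>

lemma restricted_symbol_small:
  assumes "0 < \<epsilon>"
  shows "restricted_symbol \<alpha> {..<\<epsilon>} \<zeta> \<le> moment_const \<alpha> * \<epsilon> powr (2 - \<alpha>) * (norm \<zeta>)\<^sup>2"
proof -
  have m: "integrable lborel (\<lambda>y. (fst y)\<^sup>2 * restricted_levy \<alpha> {..<\<epsilon>} y)"
      "(\<integral>y. (fst y)\<^sup>2 * restricted_levy \<alpha> {..<\<epsilon>} y \<partial>lborel) \<le> moment_const \<alpha> * \<epsilon> powr (2 - \<alpha>)"
    using assms by (auto intro!: restricted_second_moment[where r = \<epsilon>])
  have "restricted_symbol \<alpha> {..<\<epsilon>} \<zeta> \<le> (\<integral>y. (norm \<zeta>)\<^sup>2 * ((fst y)\<^sup>2 * restricted_levy \<alpha> {..<\<epsilon>} y) \<partial>lborel)"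
    unfolding restricted_symbol_def
  proof (rule integral_mono)
    fix y
    show "(1 - cos (y \<bullet> \<zeta>)) * restricted_levy \<alpha> {..<\<epsilon>} y \<le> (norm \<zeta>)\<^sup>2 * ((fst y)\<^sup>2 * restricted_levy \<alpha> {..<\<epsilon>} y)"
    proof (cases "restricted_levy \<alpha> {..<\<epsilon>} y = 0")
      case False
      have "1 - cos (y \<bullet> \<zeta>) \<le> (norm \<zeta>)\<^sup>2 * (fst y)\<^sup>2"
        using one_minus_cos_le[of "y \<bullet> \<zeta>"] inner_square_le[OF restricted_levy_support(2)[OF False], of \<zeta>]
        by simp
      then show ?thesis
        unfolding mult.assoc[symmetric] by (intro mult_right_mono restricted_levy_nonneg)
    qed simp
  qed (use m in \<open>auto intro: restricted_symbol_integrable\<close>)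
  also have "\<dots> \<le> (norm \<zeta>)\<^sup>2 * (moment_const \<alpha> * \<epsilon> powr (2 - \<alpha>))"
    using m(2) by (simp add: mult_left_mono)
  finally show ?thesis by (simp add: mult.commute)
qed

end

section \<open>Exponentially tilted jumps\<close>

lemma exp_le_quadratic:
  fixes t :: real
  assumes "\<bar>t\<bar> \<le> 2"
  shows "exp t \<le> 1 + t + exp 2 * t\<^sup>2"
proof -
  obtain u where u: "\<bar>u\<bar> \<le> \<bar>t\<bar>" "exp t = (\<Sum>m<2. t ^ m / fact m) + exp u / fact 2 * t ^ 2"
    using Maclaurin_exp_le[of t 2] by blast
  have "exp u \<le> exp 2" using u(1) assms by simp
  then have "exp u / 2 \<le> exp 2" using exp_gt_zero[of u] by linarith
  then have "exp u / 2 * t\<^sup>2 \<le> exp 2 * t\<^sup>2"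
    by (intro mult_right_mono) auto
  with u(2) show ?thesis by (simp add: numeral_2_eq_2)
qed

context
  fixes \<alpha> \<epsilon> :: real and \<theta> :: "real \<times> real"
  assumes \<alpha>: "0 < \<alpha>" "\<alpha> < 2" and \<epsilon>: "0 < \<epsilon>" "\<epsilon> < 1"
    and \<theta>: "\<bar>fst \<theta>\<bar> \<le> 1" "\<bar>snd \<theta>\<bar> \<le> 1"
begin

private abbreviation "n \<equiv> restricted_levy \<alpha> {\<epsilon>..<1}"

lemma tilt_bounded:
  assumes "n y \<noteq> 0"
  shows "\<bar>\<theta> \<bullet> y\<bar> \<le> 2" "(\<theta> \<bullet> y)\<^sup>2 \<le> 4 * (fst y)\<^sup>2"
proof -
  have y: "\<bar>fst y\<bar> \<le> 1" "\<bar>snd y\<bar> \<le> \<bar>fst y\<bar>"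
    using restricted_levy_support[OF \<alpha> assms] by auto
  have "\<bar>\<theta> \<bullet> y\<bar> \<le> \<bar>fst \<theta>\<bar> * \<bar>fst y\<bar> + \<bar>snd \<theta>\<bar> * \<bar>snd y\<bar>"
    unfolding inner_prod_def abs_mult[symmetric] by simp
  also have "\<dots> \<le> 1 * \<bar>fst y\<bar> + 1 * \<bar>fst y\<bar>"
    using \<theta> y by (intro add_mono mult_mono) auto
  finally have le: "\<bar>\<theta> \<bullet> y\<bar> \<le> 2 * \<bar>fst y\<bar>" by simp
  then show "\<bar>\<theta> \<bullet> y\<bar> \<le> 2" using y by linarith
  have "\<bar>\<theta> \<bullet> y\<bar> \<le> \<bar>2 * fst y\<bar>" using le by simp
  then have "(\<theta> \<bullet> y)\<^sup>2 \<le> (2 * fst y)\<^sup>2" by (simp only: abs_le_square_iff)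
  then show "(\<theta> \<bullet> y)\<^sup>2 \<le> 4 * (fst y)\<^sup>2" by (simp add: power_mult_distrib)
qed

lemma tilted_levy_integrable: "integrable lborel (\<lambda>y. exp (\<theta> \<bullet> y) * n y)"
proof (rule Bochner_Integration.integrable_bound)
  show "integrable lborel (\<lambda>y. exp 2 * n y)" using truncated_levy_integrable[OF \<alpha> \<epsilon>(1)] by simp
  show "AE y in lborel. norm (exp (\<theta> \<bullet> y) * n y) \<le> norm (exp 2 * n y)"
  proof (rule AE_I2)
    fix y
    show "norm (exp (\<theta> \<bullet> y) * n y) \<le> norm (exp 2 * n y)"
    proof (cases "n y = 0")
      case False
      then have "exp (\<theta> \<bullet> y) \<le> exp 2" using tilt_bounded(1)[OF False] by simp
      then show ?thesis by (simp add: abs_mult mult_right_mono)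
    qed simp
  qed
qed (use \<alpha> in measurable)

text \<open>Since \<open>e\<^sup>t cos c - 1 = (e\<^sup>t - 1) - e\<^sup>t (1 - cos c)\<close>, tilting has two effects. The first summand has an
integral against the jump density that is bounded above, uniformly in \<open>\<epsilon>\<close>: its linear part integrates to zero by
symmetry, and the quadratic part is a second moment. The second summand keeps the oscillatory decay up
to the factor \<open>exp (-2)\<close>, because \<open>\<bar>\<theta> \<bullet> y\<bar> \<le> 2\<close> for jumps of size at most one.\<close>

lemma tilted_fourier_bound:
  "Re (fourier (\<lambda>y. exp (\<theta> \<bullet> y) * n y) \<zeta>) - jump_mass \<alpha> {\<epsilon>..<1}
    \<le> 4 * exp 2 * moment_const \<alpha> - exp (-2) * restricted_symbol \<alpha> {\<epsilon>..<1} \<zeta>"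
proof -
  have n0: "n y \<ge> 0" for y by (rule restricted_levy_nonneg[OF \<alpha>])
  have [measurable]: "n \<in> borel_measurable borel" by (rule restricted_levy_measurable[OF \<alpha>]) simp
  have i1: "integrable lborel (\<lambda>y. (\<theta> \<bullet> y) * n y)"
  proof (rule Bochner_Integration.integrable_bound)
    show "integrable lborel (\<lambda>y. 2 * n y)" using truncated_levy_integrable[OF \<alpha> \<epsilon>(1)] by simp
    show "AE y in lborel. norm ((\<theta> \<bullet> y) * n y) \<le> norm (2 * n y)"
    proof (rule AE_I2)
      fix y
      show "norm ((\<theta> \<bullet> y) * n y) \<le> norm (2 * n y)"
        using tilt_bounded(1)[of y] by (cases "n y = 0") (auto simp: abs_mult intro: mult_right_mono)
    qed
  qed measurable
  have "(\<integral>y. (\<theta> \<bullet> y) * n y \<partial>lborel) = (\<integral>y. (\<theta> \<bullet> - y) * n (- y) \<partial>lborel)"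
    by (rule integral_lborel_uminus[symmetric]) simp
  then have z1: "(\<integral>y. (\<theta> \<bullet> y) * n y \<partial>lborel) = 0"
    by (simp add: restricted_levy_minus[OF \<alpha>])
  have sub: "{\<epsilon>..<1} \<subseteq> {..1}" by auto
  have i2: "integrable lborel (\<lambda>y. (fst y)\<^sup>2 * n y)"
    and m2: "(\<integral>y. (fst y)\<^sup>2 * n y \<partial>lborel) \<le> moment_const \<alpha>"
    using restricted_second_moment[OF \<alpha>, of "{\<epsilon>..<1}" 1] sub by auto
  have i3: "integrable lborel (\<lambda>y. (1 - cos (y \<bullet> \<zeta>)) * n y)"
    by (rule restricted_symbol_integrable[OF \<alpha>]) simp
  have i4: "integrable lborel (\<lambda>y. exp (\<theta> \<bullet> y) * n y * cos (y \<bullet> \<zeta>))"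
    by (rule Bochner_Integration.integrable_bound[OF tilted_levy_integrable])
      (auto simp: abs_mult intro!: mult_left_le)
  have ci: "integrable lborel (\<lambda>y. complex_of_real (exp (\<theta> \<bullet> y) * n y) * cis (- (y \<bullet> \<zeta>)))"
    using integrable_cis_mult[of "\<lambda>y. - (y \<bullet> \<zeta>)" "\<lambda>y. complex_of_real (exp (\<theta> \<bullet> y) * n y)"]
      integrable_of_real[OF tilted_levy_integrable] by (simp add: mult.commute)
  have "Re (fourier (\<lambda>y. exp (\<theta> \<bullet> y) * n y) \<zeta>) = (\<integral>y. exp (\<theta> \<bullet> y) * n y * cos (y \<bullet> \<zeta>) \<partial>lborel)"
    unfolding fourier_def by (subst integral_Re[symmetric, OF ci]) simp
  then have "Re (fourier (\<lambda>y. exp (\<theta> \<bullet> y) * n y) \<zeta>) - jump_mass \<alpha> {\<epsilon>..<1}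
      = (\<integral>y. exp (\<theta> \<bullet> y) * n y * cos (y \<bullet> \<zeta>) - n y \<partial>lborel)"
    using i4 truncated_levy_integrable[OF \<alpha> \<epsilon>(1)] by (simp add: jump_mass_def)
  also have "\<dots> \<le> (\<integral>y. (\<theta> \<bullet> y) * n y + 4 * exp 2 * ((fst y)\<^sup>2 * n y) - exp (-2) * ((1 - cos (y \<bullet> \<zeta>)) * n y) \<partial>lborel)"
  proof (rule integral_mono)
    fix y
    show "exp (\<theta> \<bullet> y) * n y * cos (y \<bullet> \<zeta>) - n y
      \<le> (\<theta> \<bullet> y) * n y + 4 * exp 2 * ((fst y)\<^sup>2 * n y) - exp (-2) * ((1 - cos (y \<bullet> \<zeta>)) * n y)"
    proof (cases "n y = 0")
      case False
      note t = tilt_bounded[OF False]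
      have "exp (\<theta> \<bullet> y) \<le> 1 + \<theta> \<bullet> y + exp 2 * (4 * (fst y)\<^sup>2)"
        by (rule order_trans[OF exp_le_quadratic[OF t(1)]]) (intro add_left_mono mult_left_mono t(2), simp)
      moreover have "exp (-2) * (1 - cos (y \<bullet> \<zeta>)) \<le> exp (\<theta> \<bullet> y) * (1 - cos (y \<bullet> \<zeta>))"
        using t(1) by (intro mult_right_mono) auto
      ultimately have "exp (\<theta> \<bullet> y) * cos (y \<bullet> \<zeta>) - 1
        \<le> \<theta> \<bullet> y + exp 2 * (4 * (fst y)\<^sup>2) - exp (-2) * (1 - cos (y \<bullet> \<zeta>))"
        by (simp add: right_diff_distrib)
      from mult_right_mono[OF this n0[of y]] show ?thesis by (simp add: algebra_simps)
    qed simp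
  qed (use i1 i2 i3 i4 truncated_levy_integrable[OF \<alpha> \<epsilon>(1)] in auto)
  also have "\<dots> = 4 * exp 2 * (\<integral>y. (fst y)\<^sup>2 * n y \<partial>lborel) - exp (-2) * restricted_symbol \<alpha> {\<epsilon>..<1} \<zeta>"
    using i1 i2 i3 z1 by (simp add: restricted_symbol_def)
  also have "\<dots> \<le> 4 * exp 2 * moment_const \<alpha> - exp (-2) * restricted_symbol \<alpha> {\<epsilon>..<1} \<zeta>"
    using m2 by simp
  finally show ?thesis .
qed

end

section \<open>Tilted Gaussians\<close>

text \<open>The symbol of \<open>exp (t v) * normal_density 0 \<sigma> v\<close>, which is again a Gaussian, centred at \<open>\<sigma>\<^sup>2 t\<close>.\<close>

definition gauss_fourier :: "real \<Rightarrow> real \<Rightarrow> real \<Rightarrow> complex" where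
  "gauss_fourier \<sigma> t \<phi> = of_real (exp (\<sigma>\<^sup>2 * t\<^sup>2 / 2) * exp (- (\<sigma>\<^sup>2 * \<phi>\<^sup>2 / 2)) / (2 * pi)) * cis (- (\<sigma>\<^sup>2 * t * \<phi>))"

lemma gaussian_integrable:
  assumes "\<sigma> > 0"
  shows "integrable lborel (\<lambda>\<phi>::real. exp (- (\<sigma>\<^sup>2 * \<phi>\<^sup>2 / 2)))"
proof -
  have "integrable lborel (\<lambda>x. sqrt (2 * pi) * std_normal_density (0 + \<sigma> * x))"
    using assms integrable_std_normal_moment[of 0]
    by (intro integrable_mult_right lborel_integrable_real_affine) (auto simp: normal_density_def)
  then show ?thesis by (simp add: std_normal_density_def power_mult_distrib)
qed

lemma gauss_fourier_integrable:
  assumes "\<sigma> > 0"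
  shows "integrable lborel (gauss_fourier \<sigma> t)"
proof -
  have "integrable lborel (\<lambda>\<phi>. cis (- (\<sigma>\<^sup>2 * t * \<phi>)) *
      (of_real (exp (\<sigma>\<^sup>2 * t\<^sup>2 / 2) / (2 * pi)) * complex_of_real (exp (- (\<sigma>\<^sup>2 * \<phi>\<^sup>2 / 2)))))"
    using integrable_of_real[OF gaussian_integrable[OF assms]]
    by (intro integrable_cis_mult) auto
  then show ?thesis by (simp add: gauss_fourier_def[abs_def] mult_ac)
qed

lemma gauss_inv_fourier:
  assumes \<sigma>: "\<sigma> > 0"
  shows "(\<integral>\<phi>. cis (v * \<phi>) * gauss_fourier \<sigma> t \<phi> \<partial>lborel) = of_real (exp (t * v) * normal_density 0 \<sigma> v)"
proof -
  define a where "a = (v - \<sigma>\<^sup>2 * t) / \<sigma>"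
  have "complex_of_real (exp (- a\<^sup>2 / 2)) = char std_normal_distribution a"
    by (simp add: char_std_normal_distribution)
  also have "\<dots> = (\<integral>x. std_normal_density x *\<^sub>R cis (a * x) \<partial>lborel)"
    unfolding char_def by (subst integral_density) (auto simp: cis_conv_exp)
  also have "\<dots> = \<bar>\<sigma>\<bar> *\<^sub>R (\<integral>\<phi>. std_normal_density (0 + \<sigma> * \<phi>) *\<^sub>R cis (a * (0 + \<sigma> * \<phi>)) \<partial>lborel)"
    using \<sigma> by (intro lborel_integral_real_affine) simp
  also have "(\<integral>\<phi>. std_normal_density (0 + \<sigma> * \<phi>) *\<^sub>R cis (a * (0 + \<sigma> * \<phi>)) \<partial>lborel)
      = (\<integral>\<phi>. of_real (2 * pi / sqrt (2 * pi) / exp (\<sigma>\<^sup>2 * t\<^sup>2 / 2)) * (cis (v * \<phi>) * gauss_fourier \<sigma> t \<phi>) \<partial>lborel)"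
  proof (intro Bochner_Integration.integral_cong refl)
    fix \<phi> :: real
    have "a * (0 + \<sigma> * \<phi>) = v * \<phi> + (- (\<sigma>\<^sup>2 * t * \<phi>))"
      using \<sigma> by (simp add: a_def field_simps)
    then have "cis (a * (0 + \<sigma> * \<phi>)) = cis (v * \<phi>) * cis (- (\<sigma>\<^sup>2 * t * \<phi>))"
      by (simp only: cis_mult)
    then show "std_normal_density (0 + \<sigma> * \<phi>) *\<^sub>R cis (a * (0 + \<sigma> * \<phi>))
      = of_real (2 * pi / sqrt (2 * pi) / exp (\<sigma>\<^sup>2 * t\<^sup>2 / 2)) * (cis (v * \<phi>) * gauss_fourier \<sigma> t \<phi>)"
      by (simp add: gauss_fourier_def std_normal_density_def scaleR_conv_of_real power_mult_distrib)
  qed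
  also have "\<dots> = of_real (2 * pi / sqrt (2 * pi) / exp (\<sigma>\<^sup>2 * t\<^sup>2 / 2)) * (\<integral>\<phi>. cis (v * \<phi>) * gauss_fourier \<sigma> t \<phi> \<partial>lborel)"
    by (rule integral_mult_right_zero)
  finally have "complex_of_real (exp (- a\<^sup>2 / 2)) = of_real (\<sigma> * (2 * pi / sqrt (2 * pi) / exp (\<sigma>\<^sup>2 * t\<^sup>2 / 2)))
      * (\<integral>\<phi>. cis (v * \<phi>) * gauss_fourier \<sigma> t \<phi> \<partial>lborel)"
    using \<sigma> by (simp add: scaleR_conv_of_real)
  moreover have "\<sigma> * (2 * pi / sqrt (2 * pi) / exp (\<sigma>\<^sup>2 * t\<^sup>2 / 2)) \<noteq> 0" using \<sigma> by simp
  ultimately have "(\<integral>\<phi>. cis (v * \<phi>) * gauss_fourier \<sigma> t \<phi> \<partial>lborel)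
     = of_real (exp (- a\<^sup>2 / 2) / (\<sigma> * (2 * pi / sqrt (2 * pi) / exp (\<sigma>\<^sup>2 * t\<^sup>2 / 2))))"
    unfolding of_real_divide by (simp only: nonzero_eq_divide_eq of_real_eq_0_iff not_False_eq_True mult.commute)
  also have "exp (- a\<^sup>2 / 2) / (\<sigma> * (2 * pi / sqrt (2 * pi) / exp (\<sigma>\<^sup>2 * t\<^sup>2 / 2)))
     = exp (t * v) * normal_density 0 \<sigma> v"
  proof -
    \<comment> \<open>Completing the square.\<close>
    have "- a\<^sup>2 / 2 + \<sigma>\<^sup>2 * t\<^sup>2 / 2 = t * v + - (v\<^sup>2 / (2 * \<sigma>\<^sup>2))"
      using \<sigma> by (simp add: a_def power_divide field_simps power2_eq_square)
    then have e: "exp (- a\<^sup>2 / 2) * exp (\<sigma>\<^sup>2 * t\<^sup>2 / 2) = exp (t * v) * exp (- (v\<^sup>2 / (2 * \<sigma>\<^sup>2)))"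
      by (simp only: exp_add[symmetric])
    have s: "2 * pi / sqrt (2 * pi) = sqrt (2 * pi)" by (simp add: real_div_sqrt)
    have "exp (- a\<^sup>2 / 2) / (\<sigma> * (2 * pi / sqrt (2 * pi) / exp (\<sigma>\<^sup>2 * t\<^sup>2 / 2)))
       = (exp (- a\<^sup>2 / 2) * exp (\<sigma>\<^sup>2 * t\<^sup>2 / 2)) / (\<sigma> * sqrt (2 * pi))"
      unfolding s by simp
    also have "\<dots> = exp (t * v) * normal_density 0 \<sigma> v"
      unfolding e using \<sigma> by (simp add: normal_density_def real_sqrt_mult)
    finally show ?thesis .
  qed
  finally show ?thesis .
qed

lemma inv_fourier_product:
  fixes h k :: "real \<Rightarrow> complex"
  assumes "integrable lborel h" "integrable lborel k"
  shows "integrable lborel (\<lambda>\<zeta>. h (fst \<zeta>) * k (snd \<zeta>))"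
    and "inv_fourier (\<lambda>\<zeta>. h (fst \<zeta>) * k (snd \<zeta>)) z
      = (\<integral>\<phi>. cis (fst z * \<phi>) * h \<phi> \<partial>lborel) * (\<integral>\<xi>. cis (snd z * \<xi>) * k \<xi> \<partial>lborel)"
proof -
  note [measurable] = assms[THEN borel_measurable_integrable]
  have gen: "integrable (lborel \<Otimes>\<^sub>M lborel) (\<lambda>(\<phi>, \<xi>). (cis (a * \<phi>) * h \<phi>) * (cis (b * \<xi>) * k \<xi>))" for a b
    using assms by (intro lborel_pair.Fubini_integrable)
      (auto simp: norm_mult integrable_norm intro!: integrable_cis_mult integrable_mult_right integrable_mult_left)
  from gen[of 0 0] show "integrable lborel (\<lambda>\<zeta>. h (fst \<zeta>) * k (snd \<zeta>))"
    by (simp add: lborel_prod case_prod_beta')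
  have "inv_fourier (\<lambda>\<zeta>. h (fst \<zeta>) * k (snd \<zeta>)) z
      = (\<integral>\<zeta>. (\<lambda>(\<phi>, \<xi>). (cis (fst z * \<phi>) * h \<phi>) * (cis (snd z * \<xi>) * k \<xi>)) \<zeta> \<partial>(lborel \<Otimes>\<^sub>M lborel))"
    unfolding inv_fourier_def lborel_prod
    by (intro Bochner_Integration.integral_cong)
      (auto simp: inner_prod_def cis_mult[symmetric])
  also have "\<dots> = (\<integral>\<phi>. (\<integral>\<xi>. (cis (fst z * \<phi>) * h \<phi>) * (cis (snd z * \<xi>) * k \<xi>) \<partial>lborel) \<partial>lborel)"
    using lborel_pair.integral_fst[OF gen] by simp
  also have "\<dots> = (\<integral>\<phi>. cis (fst z * \<phi>) * h \<phi> \<partial>lborel) * (\<integral>\<xi>. cis (snd z * \<xi>) * k \<xi> \<partial>lborel)"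
    by simp
  finally show "inv_fourier (\<lambda>\<zeta>. h (fst \<zeta>) * k (snd \<zeta>)) z
      = (\<integral>\<phi>. cis (fst z * \<phi>) * h \<phi> \<partial>lborel) * (\<integral>\<xi>. cis (snd z * \<xi>) * k \<xi> \<partial>lborel)" .
qed

definition gauss2 :: "real \<Rightarrow> real \<times> real \<Rightarrow> real" where
  "gauss2 \<sigma> z = normal_density 0 \<sigma> (fst z) * normal_density 0 \<sigma> (snd z)"

definition gauss2_fourier :: "real \<Rightarrow> real \<times> real \<Rightarrow> real \<times> real \<Rightarrow> complex" where
  "gauss2_fourier \<sigma> \<theta> \<zeta> = gauss_fourier \<sigma> (fst \<theta>) (fst \<zeta>) * gauss_fourier \<sigma> (snd \<theta>) (snd \<zeta>)"

lemma tilted_gauss2_inv_fourier: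
  assumes "\<sigma> > 0"
  shows "integrable lborel (gauss2_fourier \<sigma> \<theta>)"
    and "of_real (exp (\<theta> \<bullet> z) * gauss2 \<sigma> z) = inv_fourier (gauss2_fourier \<sigma> \<theta>) z"
proof -
  note prod = inv_fourier_product[OF gauss_fourier_integrable[OF assms] gauss_fourier_integrable[OF assms]]
  show "integrable lborel (gauss2_fourier \<sigma> \<theta>)"
    unfolding gauss2_fourier_def[abs_def] by (rule prod)
  show "of_real (exp (\<theta> \<bullet> z) * gauss2 \<sigma> z) = inv_fourier (gauss2_fourier \<sigma> \<theta>) z"
    unfolding gauss2_fourier_def[abs_def] prod gauss_inv_fourier[OF assms]
    by (simp add: gauss2_def inner_prod_def exp_add)
qed

lemma norm_gauss_fourier:
  "norm (gauss_fourier \<sigma> t \<phi>) = exp (\<sigma>\<^sup>2 * t\<^sup>2 / 2) * exp (- (\<sigma>\<^sup>2 * \<phi>\<^sup>2 / 2)) / (2 * pi)"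
  unfolding gauss_fourier_def norm_mult[of "of_real _" "cis _"] norm_of_real norm_cis by simp

lemma norm_pair_square: "(norm w)\<^sup>2 = (fst w)\<^sup>2 + (snd w)\<^sup>2" for w :: "real \<times> real"
  by (simp add: norm_prod_def)

lemma norm_gauss2_fourier:
  "norm (gauss2_fourier \<sigma> \<theta> \<zeta>) = exp (\<sigma>\<^sup>2 * (norm \<theta>)\<^sup>2 / 2) * exp (- (\<sigma>\<^sup>2 * (norm \<zeta>)\<^sup>2 / 2)) / (2 * pi)\<^sup>2"
proof -
  have "norm (gauss2_fourier \<sigma> \<theta> \<zeta>) = (exp (\<sigma>\<^sup>2 * (fst \<theta>)\<^sup>2 / 2) * exp (\<sigma>\<^sup>2 * (snd \<theta>)\<^sup>2 / 2))
      * (exp (- (\<sigma>\<^sup>2 * (fst \<zeta>)\<^sup>2 / 2)) * exp (- (\<sigma>\<^sup>2 * (snd \<zeta>)\<^sup>2 / 2))) / (2 * pi)\<^sup>2"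
    by (simp add: gauss2_fourier_def norm_mult norm_gauss_fourier power2_eq_square)
  also have "exp (\<sigma>\<^sup>2 * (fst \<theta>)\<^sup>2 / 2) * exp (\<sigma>\<^sup>2 * (snd \<theta>)\<^sup>2 / 2) = exp (\<sigma>\<^sup>2 * (norm \<theta>)\<^sup>2 / 2)"
    by (simp add: exp_add[symmetric] norm_pair_square distrib_left add_divide_distrib)
  also have "exp (- (\<sigma>\<^sup>2 * (fst \<zeta>)\<^sup>2 / 2)) * exp (- (\<sigma>\<^sup>2 * (snd \<zeta>)\<^sup>2 / 2)) = exp (- (\<sigma>\<^sup>2 * (norm \<zeta>)\<^sup>2 / 2))"
    by (simp add: exp_add[symmetric] norm_pair_square distrib_left add_divide_distrib)
  finally show ?thesis .
qed

lemma gauss2_fourier_0: "gauss2_fourier \<sigma> 0 \<zeta> = of_real (exp (- (\<sigma>\<^sup>2 * (norm \<zeta>)\<^sup>2 / 2)) / (2 * pi)\<^sup>2)"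
proof -
  have "gauss_fourier \<sigma> 0 \<phi> = of_real (norm (gauss_fourier \<sigma> 0 \<phi>))" for \<phi>
    unfolding norm_gauss_fourier by (simp add: gauss_fourier_def)
  then have "gauss2_fourier \<sigma> 0 \<zeta> = of_real (norm (gauss2_fourier \<sigma> 0 \<zeta>))"
    by (simp add: gauss2_fourier_def norm_mult)
  then show ?thesis by (simp add: norm_gauss2_fourier)
qed

section \<open>The contribution of the small jumps\<close>

lemma moment_const_pos: "0 < \<alpha> \<Longrightarrow> \<alpha> < 2 \<Longrightarrow> moment_const \<alpha> > 0"
  using levy_const_pos[of \<alpha>] by (simp add: moment_const_def)

lemma one_le_two_pi_square: "1 \<le> (2 * pi)\<^sup>2"
  using pi_gt3 by (intro one_le_power) simp

text \<open>Chosen so that \<open>\<sigma>\<^sup>2 / 2\<close> is the coefficient in \<open>restricted_symbol_small\<close>: the Gaussian then dominates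
the jumps of size less than \<open>\<epsilon>\<close>, and it disappears as \<open>\<epsilon> \<rightarrow> 0\<close> because \<open>\<alpha> < 2\<close>.\<close>

definition approx_std :: "real \<Rightarrow> real \<Rightarrow> real" where
  "approx_std \<alpha> \<epsilon> = sqrt (2 * moment_const \<alpha> * \<epsilon> powr (2 - \<alpha>))"

definition approx_base :: "real \<Rightarrow> real \<Rightarrow> real \<times> real \<Rightarrow> real" where
  "approx_base \<alpha> \<epsilon> z = exp (- jump_mass \<alpha> {\<epsilon>..<1}) * gauss2 (approx_std \<alpha> \<epsilon>) z"

definition approx :: "real \<Rightarrow> real \<Rightarrow> real \<times> real \<Rightarrow> real" where
  "approx \<alpha> \<epsilon> = compound (restricted_levy \<alpha> {\<epsilon>..<1}) (approx_base \<alpha> \<epsilon>)"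

definition approx_fourier :: "real \<Rightarrow> real \<Rightarrow> real \<times> real \<Rightarrow> real \<times> real \<Rightarrow> complex" where
  "approx_fourier \<alpha> \<epsilon> \<theta> \<zeta> = exp (fourier (\<lambda>y. exp (\<theta> \<bullet> y) * restricted_levy \<alpha> {\<epsilon>..<1} y) \<zeta>)
     * (of_real (exp (- jump_mass \<alpha> {\<epsilon>..<1})) * gauss2_fourier (approx_std \<alpha> \<epsilon>) \<theta> \<zeta>)"

definition regular_fourier :: "real \<Rightarrow> real \<times> real \<Rightarrow> complex" where
  "regular_fourier \<alpha> \<zeta> = of_real (exp (- (symbol \<alpha> \<zeta> - restricted_symbol \<alpha> {1..} \<zeta>)) / (2 * pi)\<^sup>2)"

text \<open>The density of the part of the law that comes from jumps of size less than one. \<open>regular_part_inv_fourier\<close> shows that the real part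
discards nothing.\<close>

definition regular_part :: "real \<Rightarrow> real \<times> real \<Rightarrow> real" where
  "regular_part \<alpha> z = Re (inv_fourier (regular_fourier \<alpha>) z)"

definition dominating_const :: "real \<Rightarrow> real" where
  "dominating_const \<alpha> = exp (4 * exp 2 * moment_const \<alpha> + 2 * moment_const \<alpha> + 2 * jump_mass \<alpha> {1..})"

context
  fixes \<alpha> :: real
  assumes \<alpha>: "0 < \<alpha>" "\<alpha> < 2"
begin

lemma jump_mass_nonneg: "0 \<le> jump_mass \<alpha> S"
  unfolding jump_mass_def by (intro integral_nonneg_AE AE_I2 restricted_levy_nonneg[OF \<alpha>])

lemma restricted_symbol_measurable [measurable]:
  assumes S[measurable]: "S \<in> sets borel"
  shows "restricted_symbol \<alpha> S \<in> borel_measurable borel"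
proof -
  note [measurable] = restricted_levy_measurable[OF \<alpha> S]
  show ?thesis unfolding restricted_symbol_def by measurable
qed

context
  fixes \<epsilon> :: real
  assumes \<epsilon>: "0 < \<epsilon>" "\<epsilon> < 1"
begin

lemma approx_std_pos: "approx_std \<alpha> \<epsilon> > 0"
  and approx_std_square: "(approx_std \<alpha> \<epsilon>)\<^sup>2 / 2 = moment_const \<alpha> * \<epsilon> powr (2 - \<alpha>)"
  using \<epsilon> moment_const_pos[OF \<alpha>] by (simp_all add: approx_std_def)

lemma approx_base_inv_fourier:
  shows "integrable lborel (\<lambda>\<zeta>. of_real (exp (- jump_mass \<alpha> {\<epsilon>..<1})) * gauss2_fourier (approx_std \<alpha> \<epsilon>) \<theta> \<zeta>)"
    and "of_real (exp (\<theta> \<bullet> z) * approx_base \<alpha> \<epsilon> z)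
      = inv_fourier (\<lambda>\<zeta>. of_real (exp (- jump_mass \<alpha> {\<epsilon>..<1})) * gauss2_fourier (approx_std \<alpha> \<epsilon>) \<theta> \<zeta>) z"
proof -
  note G = tilted_gauss2_inv_fourier[OF approx_std_pos]
  show "integrable lborel (\<lambda>\<zeta>. of_real (exp (- jump_mass \<alpha> {\<epsilon>..<1})) * gauss2_fourier (approx_std \<alpha> \<epsilon>) \<theta> \<zeta>)"
    using G(1) by simp
  have "of_real (exp (\<theta> \<bullet> z) * approx_base \<alpha> \<epsilon> z)
      = of_real (exp (- jump_mass \<alpha> {\<epsilon>..<1})) * inv_fourier (gauss2_fourier (approx_std \<alpha> \<epsilon>) \<theta>) z"
    by (simp add: approx_base_def G(2)[symmetric])
  also have "\<dots> = (\<integral>\<zeta>. of_real (exp (- jump_mass \<alpha> {\<epsilon>..<1})) * (cis (z \<bullet> \<zeta>) * gauss2_fourier (approx_std \<alpha> \<epsilon>) \<theta> \<zeta>) \<partial>lborel)"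
    unfolding inv_fourier_def by (rule integral_mult_right_zero[symmetric])
  finally show "of_real (exp (\<theta> \<bullet> z) * approx_base \<alpha> \<epsilon> z)
      = inv_fourier (\<lambda>\<zeta>. of_real (exp (- jump_mass \<alpha> {\<epsilon>..<1})) * gauss2_fourier (approx_std \<alpha> \<epsilon>) \<theta> \<zeta>) z"
    by (simp add: inv_fourier_def mult_ac)
qed

lemma approx_summable:
  "summable (\<lambda>k. (convolve (restricted_levy \<alpha> {\<epsilon>..<1}) ^^ k) (approx_base \<alpha> \<epsilon>) z / fact k)"
  using compound_inv_fourier(1)[OF truncated_levy_integrable[OF \<alpha> \<epsilon>(1)] approx_base_inv_fourier(1)[of 0],
      of "approx_base \<alpha> \<epsilon>"] approx_base_inv_fourier(2)[of 0] by simp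

lemma approx_nonneg: "0 \<le> approx \<alpha> \<epsilon> z"
  unfolding approx_def
  by (intro compound_nonneg approx_summable restricted_levy_nonneg \<alpha>) (simp add: approx_base_def gauss2_def)

text \<open>Tilting the whole approximation by \<open>\<theta>\<close> amounts to tilting its jump density and its Gaussian. The
restriction on \<open>\<theta>\<close> keeps the tilt bounded on the support of the jumps.\<close>

lemma approx_tilted:
  assumes \<theta>: "\<bar>fst \<theta>\<bar> \<le> 1" "\<bar>snd \<theta>\<bar> \<le> 1"
  shows "of_real (exp (\<theta> \<bullet> z) * approx \<alpha> \<epsilon> z) = inv_fourier (approx_fourier \<alpha> \<epsilon> \<theta>) z"
  unfolding approx_def exp_compound[OF approx_summable] approx_fourier_def[abs_def]
  by (rule compound_inv_fourier(2)[OF tilted_levy_integrable[OF \<alpha> \<epsilon> \<theta>] approx_base_inv_fourier])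

lemma approx_fourier_measurable:
  assumes \<theta>: "\<bar>fst \<theta>\<bar> \<le> 1" "\<bar>snd \<theta>\<bar> \<le> 1"
  shows "approx_fourier \<alpha> \<epsilon> \<theta> \<in> borel_measurable borel"
proof -
  note [measurable] = fourier_measurable[OF tilted_levy_integrable[OF \<alpha> \<epsilon> \<theta>]]
    borel_measurable_integrable[OF tilted_gauss2_inv_fourier(1)[OF approx_std_pos]]
  show ?thesis unfolding approx_fourier_def by measurable
qed

text \<open>The majorant is independent of \<open>\<epsilon>\<close>. The jumps between \<open>\<epsilon>\<close> and \<open>1\<close> contribute their part of the symbol,
the Gaussian at least that of the jumps below \<open>\<epsilon>\<close>, and the part of the jumps above \<open>1\<close> is bounded; together
they make up the full symbol, up to a constant factor in the exponential.\<close>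

lemma norm_approx_fourier_le:
  assumes \<theta>: "\<bar>fst \<theta>\<bar> \<le> 1" "\<bar>snd \<theta>\<bar> \<le> 1"
  shows "norm (approx_fourier \<alpha> \<epsilon> \<theta> \<zeta>) \<le> dominating_const \<alpha> * exp (- exp (-2) * symbol \<alpha> \<zeta>)"
proof -
  let ?\<sigma> = "approx_std \<alpha> \<epsilon>" and ?S = "restricted_symbol \<alpha>" and ?m = "moment_const \<alpha>"
  have m: "?m > 0" by (rule moment_const_pos[OF \<alpha>])
  have e: "exp (-2) \<le> (1::real)" by simp
  have "?S {1..} \<zeta> \<le> 2 * jump_mass \<alpha> {1..}"
    by (rule restricted_symbol_le_mass[OF \<alpha>, where r = 1]) auto
  then have 1: "exp (-2) * ?S {1..} \<zeta> \<le> 2 * jump_mass \<alpha> {1..}"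
    using mult_left_le_one_le[of "?S {1..} \<zeta>" "exp (-2)"] restricted_symbol_nonneg[OF \<alpha>, of "{1..}" \<zeta>] by simp
  have "exp (-2) * ?S {..<\<epsilon>} \<zeta> \<le> ?S {..<\<epsilon>} \<zeta>"
    using mult_left_le_one_le[of "?S {..<\<epsilon>} \<zeta>" "exp (-2)"] restricted_symbol_nonneg[OF \<alpha>] by simp
  also have "\<dots> \<le> ?\<sigma>\<^sup>2 / 2 * (norm \<zeta>)\<^sup>2"
    unfolding approx_std_square by (rule restricted_symbol_small[OF \<alpha> \<epsilon>(1)])
  finally have 2: "exp (-2) * ?S {..<\<epsilon>} \<zeta> \<le> ?\<sigma>\<^sup>2 / 2 * (norm \<zeta>)\<^sup>2" .
  have 3: "?\<sigma>\<^sup>2 / 2 * (norm \<theta>)\<^sup>2 \<le> 2 * ?m"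
  proof -
    have "\<epsilon> powr (2 - \<alpha>) \<le> 1" using \<epsilon> \<alpha> by (intro powr_le1) auto
    then have a: "?\<sigma>\<^sup>2 / 2 \<le> ?m" unfolding approx_std_square using m by (simp add: mult_left_le)
    have "(fst \<theta>)\<^sup>2 \<le> 1" "(snd \<theta>)\<^sup>2 \<le> 1" using \<theta> by (simp_all add: abs_square_le_1)
    then have b: "(norm \<theta>)\<^sup>2 \<le> 2"
      by (simp add: norm_pair_square)
    have "?\<sigma>\<^sup>2 / 2 * (norm \<theta>)\<^sup>2 \<le> ?m * 2"
      using a b m by (intro mult_mono) auto
    then show ?thesis by simp
  qed
  have 4: "symbol \<alpha> \<zeta> = ?S {..<\<epsilon>} \<zeta> + ?S {\<epsilon>..<1} \<zeta> + ?S {1..} \<zeta>"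
    by (rule restricted_symbol_split[OF \<alpha> \<epsilon>])
  have 5: "Re (fourier (\<lambda>y. exp (\<theta> \<bullet> y) * restricted_levy \<alpha> {\<epsilon>..<1} y) \<zeta>) - jump_mass \<alpha> {\<epsilon>..<1}
    \<le> 4 * exp 2 * ?m - exp (-2) * ?S {\<epsilon>..<1} \<zeta>"
    by (rule tilted_fourier_bound[OF \<alpha> \<epsilon> \<theta>])
  have "norm (approx_fourier \<alpha> \<epsilon> \<theta> \<zeta>)
    = exp (Re (fourier (\<lambda>y. exp (\<theta> \<bullet> y) * restricted_levy \<alpha> {\<epsilon>..<1} y) \<zeta>) - jump_mass \<alpha> {\<epsilon>..<1}
        + ?\<sigma>\<^sup>2 / 2 * (norm \<theta>)\<^sup>2 - ?\<sigma>\<^sup>2 / 2 * (norm \<zeta>)\<^sup>2) / (2 * pi)\<^sup>2"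
    unfolding approx_fourier_def norm_mult norm_exp_eq_Re norm_of_real norm_gauss2_fourier abs_exp_cancel
      times_divide_eq_right exp_add[symmetric]
    by (simp add: algebra_simps)
  also have "\<dots> \<le> exp (Re (fourier (\<lambda>y. exp (\<theta> \<bullet> y) * restricted_levy \<alpha> {\<epsilon>..<1} y) \<zeta>) - jump_mass \<alpha> {\<epsilon>..<1}
        + ?\<sigma>\<^sup>2 / 2 * (norm \<theta>)\<^sup>2 - ?\<sigma>\<^sup>2 / 2 * (norm \<zeta>)\<^sup>2) / 1"
    by (intro frac_le one_le_two_pi_square) auto
  also have "\<dots> \<le> exp ((4 * exp 2 * ?m + 2 * ?m + 2 * jump_mass \<alpha> {1..}) - exp (-2) * symbol \<alpha> \<zeta>)"
    using 1 2 3 5 unfolding 4 by (simp add: distrib_left)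
  also have "\<dots> = dominating_const \<alpha> * exp (- exp (-2) * symbol \<alpha> \<zeta>)"
    by (simp add: dominating_const_def exp_add[symmetric])
  finally show ?thesis .
qed

lemma approx_fourier_0:
  "approx_fourier \<alpha> \<epsilon> 0 \<zeta> = of_real (exp (- (symbol \<alpha> \<zeta> - restricted_symbol \<alpha> {1..} \<zeta>
      - restricted_symbol \<alpha> {..<\<epsilon>} \<zeta> + (moment_const \<alpha> * \<epsilon> powr (2 - \<alpha>)) * (norm \<zeta>)\<^sup>2)) / (2 * pi)\<^sup>2)"
proof -
  have "fourier (restricted_levy \<alpha> {\<epsilon>..<1}) \<zeta>
      = of_real (jump_mass \<alpha> {\<epsilon>..<1} - restricted_symbol \<alpha> {\<epsilon>..<1} \<zeta>)"
    using \<epsilon> by (intro fourier_restricted_levy[OF \<alpha>]) auto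
  then have "exp (fourier (restricted_levy \<alpha> {\<epsilon>..<1}) \<zeta>)
      = of_real (exp (jump_mass \<alpha> {\<epsilon>..<1} - restricted_symbol \<alpha> {\<epsilon>..<1} \<zeta>))"
    by (simp only: exp_of_real)
  then have "approx_fourier \<alpha> \<epsilon> 0 \<zeta> = of_real (exp (jump_mass \<alpha> {\<epsilon>..<1} - restricted_symbol \<alpha> {\<epsilon>..<1} \<zeta>)
     * (exp (- jump_mass \<alpha> {\<epsilon>..<1}) * (exp (- ((approx_std \<alpha> \<epsilon>)\<^sup>2 / 2 * (norm \<zeta>)\<^sup>2)) / (2 * pi)\<^sup>2)))"
    by (simp add: approx_fourier_def gauss2_fourier_0)
  also have "exp (jump_mass \<alpha> {\<epsilon>..<1} - restricted_symbol \<alpha> {\<epsilon>..<1} \<zeta>)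
     * (exp (- jump_mass \<alpha> {\<epsilon>..<1}) * (exp (- ((approx_std \<alpha> \<epsilon>)\<^sup>2 / 2 * (norm \<zeta>)\<^sup>2)) / (2 * pi)\<^sup>2))
     = exp (- (restricted_symbol \<alpha> {\<epsilon>..<1} \<zeta> + (approx_std \<alpha> \<epsilon>)\<^sup>2 / 2 * (norm \<zeta>)\<^sup>2)) / (2 * pi)\<^sup>2"
    unfolding times_divide_eq_right exp_add[symmetric] by (simp add: algebra_simps)
  finally show ?thesis
    unfolding approx_std_square restricted_symbol_split[OF \<alpha> \<epsilon>, of \<zeta>] by simp
qed

end

lemma dominating_integrable:
  "integrable lborel (\<lambda>\<zeta>. dominating_const \<alpha> * exp (- exp (-2) * symbol \<alpha> \<zeta>))"
  by (intro integrable_mult_right exp_symbol_integrable \<alpha>) simp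

lemma regular_fourier_integrable: "integrable lborel (regular_fourier \<alpha>)"
proof (rule Bochner_Integration.integrable_bound)
  show "integrable lborel (\<lambda>\<zeta>. exp (2 * jump_mass \<alpha> {1..}) * exp (- 1 * symbol \<alpha> \<zeta>))"
    by (intro integrable_mult_right exp_symbol_integrable \<alpha>) simp
  show "AE \<zeta> in lborel. norm (regular_fourier \<alpha> \<zeta>) \<le> norm (exp (2 * jump_mass \<alpha> {1..}) * exp (- 1 * symbol \<alpha> \<zeta>))"
  proof (rule AE_I2)
    fix \<zeta>
    have "restricted_symbol \<alpha> {1..} \<zeta> \<le> 2 * jump_mass \<alpha> {1..}"
      by (rule restricted_symbol_le_mass[OF \<alpha>, where r = 1]) auto
    then have "exp (- (symbol \<alpha> \<zeta> - restricted_symbol \<alpha> {1..} \<zeta>)) \<le> exp (2 * jump_mass \<alpha> {1..} + - 1 * symbol \<alpha> \<zeta>)"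
      by simp
    then have "exp (- (symbol \<alpha> \<zeta> - restricted_symbol \<alpha> {1..} \<zeta>)) / (2 * pi)\<^sup>2
        \<le> exp (2 * jump_mass \<alpha> {1..} + - 1 * symbol \<alpha> \<zeta>) / 1"
      by (intro frac_le one_le_two_pi_square) auto
    moreover have "norm (regular_fourier \<alpha> \<zeta>) = exp (- (symbol \<alpha> \<zeta> - restricted_symbol \<alpha> {1..} \<zeta>)) / (2 * pi)\<^sup>2"
      unfolding regular_fourier_def norm_of_real by simp
    ultimately show "norm (regular_fourier \<alpha> \<zeta>) \<le> norm (exp (2 * jump_mass \<alpha> {1..}) * exp (- 1 * symbol \<alpha> \<zeta>))"
      by (simp only: real_norm_def abs_mult abs_exp_cancel exp_add div_by_1)
  qed
  show "regular_fourier \<alpha> \<in> borel_measurable lborel"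
    unfolding regular_fourier_def by measurable
qed

text \<open>Dominated convergence: as \<open>\<epsilon> \<rightarrow> 0\<close>, both the jumps below \<open>\<epsilon>\<close> and the Gaussian that replaces them
disappear from the exponent.\<close>

lemma approx_tendsto_regular:
  "(\<lambda>i. complex_of_real (approx \<alpha> (1 / real (Suc (Suc i))) z)) \<longlonglongrightarrow> inv_fourier (regular_fourier \<alpha>) z"
proof -
  define \<epsilon> where "\<epsilon> i = 1 / real (Suc (Suc i))" for i
  have \<epsilon>: "0 < \<epsilon> i" "\<epsilon> i < 1" for i by (simp_all add: \<epsilon>_def)
  have \<epsilon>0: "\<epsilon> \<longlonglongrightarrow> 0" unfolding \<epsilon>_def
    using LIMSEQ_Suc[OF LIMSEQ_inverse_real_of_nat] by (simp add: inverse_eq_divide)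
  have e0: "(\<lambda>i. moment_const \<alpha> * \<epsilon> i powr (2 - \<alpha>) * (norm \<zeta>)\<^sup>2) \<longlonglongrightarrow> 0" for \<zeta> :: "real \<times> real"
  proof -
    have "(\<lambda>i. \<epsilon> i powr (2 - \<alpha>)) \<longlonglongrightarrow> 0 powr (2 - \<alpha>)"
      by (rule tendsto_powr'[OF \<epsilon>0 tendsto_const]) (use \<alpha> \<epsilon> in \<open>auto intro!: always_eventually less_imp_le\<close>)
    then have "(\<lambda>i. moment_const \<alpha> * \<epsilon> i powr (2 - \<alpha>) * (norm \<zeta>)\<^sup>2) \<longlonglongrightarrow> moment_const \<alpha> * 0 * (norm \<zeta>)\<^sup>2"
      by (intro tendsto_intros) simp
    then show ?thesis by simp
  qed
  have s0: "(\<lambda>i. restricted_symbol \<alpha> {..<\<epsilon> i} \<zeta>) \<longlonglongrightarrow> 0" for \<zeta>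
    by (rule tendsto_sandwich[OF _ _ tendsto_const e0[of \<zeta>]])
      (auto intro!: always_eventually restricted_symbol_nonneg[OF \<alpha>] restricted_symbol_small[OF \<alpha>] \<epsilon>)
  have \<theta>0: "\<bar>fst (0::real\<times>real)\<bar> \<le> 1" "\<bar>snd (0::real\<times>real)\<bar> \<le> 1" by simp_all
  have "(\<lambda>i. \<integral>\<zeta>. cis (z \<bullet> \<zeta>) * approx_fourier \<alpha> (\<epsilon> i) 0 \<zeta> \<partial>lborel)
      \<longlonglongrightarrow> (\<integral>\<zeta>. cis (z \<bullet> \<zeta>) * regular_fourier \<alpha> \<zeta> \<partial>lborel)"
  proof (rule integral_dominated_convergence[OF _ _ dominating_integrable])
    show "(\<lambda>\<zeta>. cis (z \<bullet> \<zeta>) * regular_fourier \<alpha> \<zeta>) \<in> borel_measurable lborel"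
      using borel_measurable_integrable[OF regular_fourier_integrable] by measurable
    show "(\<lambda>\<zeta>. cis (z \<bullet> \<zeta>) * approx_fourier \<alpha> (\<epsilon> i) 0 \<zeta>) \<in> borel_measurable lborel" for i
      using approx_fourier_measurable[OF \<epsilon>[of i] \<theta>0] by measurable
    show "AE \<zeta> in lborel. norm (cis (z \<bullet> \<zeta>) * approx_fourier \<alpha> (\<epsilon> i) 0 \<zeta>)
        \<le> dominating_const \<alpha> * exp (- exp (-2) * symbol \<alpha> \<zeta>)" for i
      using norm_approx_fourier_le[OF \<epsilon>[of i] \<theta>0] by (simp add: norm_mult)
    show "AE \<zeta> in lborel. (\<lambda>i. cis (z \<bullet> \<zeta>) * approx_fourier \<alpha> (\<epsilon> i) 0 \<zeta>) \<longlonglongrightarrow> cis (z \<bullet> \<zeta>) * regular_fourier \<alpha> \<zeta>"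
    proof (rule AE_I2, rule tendsto_mult_left)
      fix \<zeta>
      have "(\<lambda>i. complex_of_real (exp (- (symbol \<alpha> \<zeta> - restricted_symbol \<alpha> {1..} \<zeta>
          - restricted_symbol \<alpha> {..<\<epsilon> i} \<zeta> + moment_const \<alpha> * \<epsilon> i powr (2 - \<alpha>) * (norm \<zeta>)\<^sup>2)) / (2 * pi)\<^sup>2))
        \<longlonglongrightarrow> of_real (exp (- (symbol \<alpha> \<zeta> - restricted_symbol \<alpha> {1..} \<zeta> - 0 + 0)) / (2 * pi)\<^sup>2)"
        by (intro tendsto_intros s0 e0) simp
      then show "(\<lambda>i. approx_fourier \<alpha> (\<epsilon> i) 0 \<zeta>) \<longlonglongrightarrow> regular_fourier \<alpha> \<zeta>"
        unfolding approx_fourier_0[OF \<epsilon>] regular_fourier_def by simp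
    qed
  qed
  then have "(\<lambda>i. inv_fourier (approx_fourier \<alpha> (\<epsilon> i) 0) z) \<longlonglongrightarrow> inv_fourier (regular_fourier \<alpha>) z"
    by (simp add: inv_fourier_def)
  then show ?thesis
    using approx_tilted[OF \<epsilon> \<theta>0, of z] by (simp add: \<epsilon>_def)
qed

lemma regular_part_tendsto:
  "(\<lambda>i. approx \<alpha> (1 / real (Suc (Suc i))) z) \<longlonglongrightarrow> regular_part \<alpha> z"
  using tendsto_Re[OF approx_tendsto_regular[of z]] by (simp add: regular_part_def)

lemma regular_part_inv_fourier: "of_real (regular_part \<alpha> z) = inv_fourier (regular_fourier \<alpha>) z"
  using tendsto_of_real[OF regular_part_tendsto[of z]] approx_tendsto_regular[of z] by (rule LIMSEQ_unique)

lemma regular_part_nonneg: "0 \<le> regular_part \<alpha> z"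
  by (rule LIMSEQ_le_const[OF regular_part_tendsto])
    (auto intro!: exI[of _ 0] approx_nonneg)

text \<open>The bound on the tilted transforms is used with \<open>\<theta>\<close> equal to the pair of signs of the coordinates of
\<open>z\<close>, for which \<open>\<theta> \<bullet> z = \<bar>fst z\<bar> + \<bar>snd z\<bar>\<close>.\<close>

lemma regular_part_exp_decay:
  obtains K where "\<And>z. regular_part \<alpha> z \<le> K * exp (- (\<bar>fst z\<bar> + \<bar>snd z\<bar>))"
proof -
  define K where "K = (\<integral>\<zeta>. dominating_const \<alpha> * exp (- exp (-2) * symbol \<alpha> \<zeta>) \<partial>lborel)"
  have "regular_part \<alpha> z \<le> K * exp (- (\<bar>fst z\<bar> + \<bar>snd z\<bar>))" for z
  proof -
    define \<theta> where "\<theta> = (sgn (fst z), sgn (snd z))"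
    have \<theta>: "\<bar>fst \<theta>\<bar> \<le> 1" "\<bar>snd \<theta>\<bar> \<le> 1" by (simp_all add: \<theta>_def abs_sgn_eq)
    have \<theta>z: "\<theta> \<bullet> z = \<bar>fst z\<bar> + \<bar>snd z\<bar>"
      by (simp add: \<theta>_def inner_prod_def abs_sgn mult.commute)
    have le: "exp (\<theta> \<bullet> z) * approx \<alpha> \<epsilon> z \<le> K" if \<epsilon>: "0 < \<epsilon>" "\<epsilon> < 1" for \<epsilon>
    proof -
      have "exp (\<theta> \<bullet> z) * approx \<alpha> \<epsilon> z \<le> norm (complex_of_real (exp (\<theta> \<bullet> z) * approx \<alpha> \<epsilon> z))"
        unfolding norm_of_real by (rule abs_ge_self)
      also have "\<dots> \<le> (\<integral>\<zeta>. norm (approx_fourier \<alpha> \<epsilon> \<theta> \<zeta>) \<partial>lborel)"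
        unfolding approx_tilted[OF \<epsilon> \<theta>] by (rule norm_inv_fourier_le)
      also have "\<dots> \<le> K" unfolding K_def
      proof (rule integral_mono[OF _ dominating_integrable norm_approx_fourier_le[OF \<epsilon> \<theta>]])
        show "integrable lborel (\<lambda>\<zeta>. norm (approx_fourier \<alpha> \<epsilon> \<theta> \<zeta>))"
        proof (rule Bochner_Integration.integrable_bound[OF dominating_integrable])
          show "AE \<zeta> in lborel. norm (norm (approx_fourier \<alpha> \<epsilon> \<theta> \<zeta>))
              \<le> norm (dominating_const \<alpha> * exp (- exp (-2) * symbol \<alpha> \<zeta>))"
          proof (rule AE_I2)
            show "norm (norm (approx_fourier \<alpha> \<epsilon> \<theta> \<zeta>))
              \<le> norm (dominating_const \<alpha> * exp (- exp (-2) * symbol \<alpha> \<zeta>))" for \<zeta>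
              unfolding real_norm_def abs_norm_cancel
              by (rule order_trans[OF norm_approx_fourier_le[OF \<epsilon> \<theta>] abs_ge_self])
          qed
        qed (use approx_fourier_measurable[OF \<epsilon> \<theta>] in measurable)
      qed
      finally show ?thesis .
    qed
    have "exp (\<theta> \<bullet> z) * regular_part \<alpha> z \<le> K"
      by (rule LIMSEQ_le_const2[OF tendsto_mult_left[OF regular_part_tendsto]])
        (auto intro!: exI[of _ 0] le)
    then show ?thesis 
      unfolding \<theta>z exp_minus divide_inverse[symmetric] by (simp add: pos_le_divide_eq mult.commute)
  qed
  then show ?thesis by (rule that)
qed

end

text \<open>The regular part is continuous, and its value at the origin is the integral of a positive function.\<close>

lemma regular_part_lower_near_0:
  assumes \<alpha>: "0 < \<alpha>" "\<alpha> < 2"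
  obtains \<delta> c where "0 < \<delta>" "\<delta> \<le> 1 / 8" "c > 0"
    "\<And>w. \<bar>fst w\<bar> \<le> \<delta> \<Longrightarrow> \<bar>snd w\<bar> \<le> \<delta> \<Longrightarrow> c \<le> regular_part \<alpha> w"
proof -
  define h where "h \<zeta> = exp (- (symbol \<alpha> \<zeta> - restricted_symbol \<alpha> {1..} \<zeta>)) / (2 * pi)\<^sup>2" for \<zeta>
  have h: "regular_fourier \<alpha> = (\<lambda>\<zeta>. of_real (h \<zeta>))" by (simp add: regular_fourier_def h_def fun_eq_iff)
  have hpos: "h \<zeta> > 0" for \<zeta> by (simp add: h_def)
  have hint: "integrable lborel h"
    using integrable_Re[OF regular_fourier_integrable[OF \<alpha>]] by (simp add: h)
  have "regular_part \<alpha> 0 = (\<integral>\<zeta>. h \<zeta> \<partial>lborel)"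
    by (simp add: regular_part_def inv_fourier_def h)
  moreover have "(\<integral>\<zeta>. h \<zeta> \<partial>lborel) \<noteq> 0"
  proof
    assume "(\<integral>\<zeta>. h \<zeta> \<partial>lborel) = 0"
    then have "AE \<zeta> in lborel. h \<zeta> = 0"
      using integral_nonneg_eq_0_iff_AE[OF hint AE_I2[OF less_imp_le[OF hpos]]] by blast
    then have "AE \<zeta> in (lborel :: (real \<times> real) measure). False"
      using hpos by (auto elim!: eventually_mono simp: less_le)
    then have "ae_filter (lborel :: (real \<times> real) measure) = bot"
      by (simp add: trivial_limit_def)
    then show False by (simp add: ae_filter_eq_bot_iff)
  qed
  moreover have "(\<integral>\<zeta>. h \<zeta> \<partial>lborel) \<ge> 0" using hpos by (intro integral_nonneg_AE AE_I2 less_imp_le)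
  ultimately have pos: "regular_part \<alpha> 0 > 0" by simp
  have "continuous_on UNIV (regular_part \<alpha>)"
    unfolding regular_part_def[abs_def]
    by (intro continuous_on_Re continuous_inv_fourier regular_fourier_integrable \<alpha>)
  then have "continuous (at 0) (regular_part \<alpha>)"
    using continuous_on_eq_continuous_at[OF open_UNIV] by blast
  then obtain d where d: "d > 0" "\<And>w. dist w 0 < d \<Longrightarrow> dist (regular_part \<alpha> w) (regular_part \<alpha> 0) < regular_part \<alpha> 0 / 2"
    using pos unfolding continuous_at_eps_delta by (metis half_gt_zero)
  show ?thesis
  proof (rule that[of "min (d / 3) (1 / 8)" "regular_part \<alpha> 0 / 2"])
    fix w :: "real \<times> real" assume w: "\<bar>fst w\<bar> \<le> min (d / 3) (1 / 8)" "\<bar>snd w\<bar> \<le> min (d / 3) (1 / 8)"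
    have "norm w \<le> \<bar>fst w\<bar> + \<bar>snd w\<bar>" using norm_Pair_le[of "fst w" "snd w"] by simp
    also have "\<dots> < d" using w d(1) by simp
    finally have "\<bar>regular_part \<alpha> w - regular_part \<alpha> 0\<bar> < regular_part \<alpha> 0 / 2"
      using d(2)[of w] by (simp add: dist_real_def)
    then show "regular_part \<alpha> 0 / 2 \<le> regular_part \<alpha> w" by linarith
  qed (use d pos in auto)
qed

section \<open>The kernel as a sum over the number of large jumps\<close>

text \<open>Integrability of the exponential of the symbol over the plane identifies the iterated integral in the
definition of the kernel with a planar one.\<close>

lemma kolmogorov_kernel_inv_fourier:
  fixes s :: real
  assumes s: "0 < s" "s < 1"
  shows "kolmogorov_kernel s 1 x v
    = inv_fourier (\<lambda>\<zeta>. of_real (exp (- symbol (2 * s) \<zeta>) / (2 * pi)\<^sup>2)) (v, x)"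
proof -
  let ?F = "\<lambda>\<zeta>. cis ((v, x) \<bullet> \<zeta>) * complex_of_real (exp (- 1 * symbol (2 * s) \<zeta>))"
  have "integrable lborel (\<lambda>\<zeta>. complex_of_real (exp (- 1 * symbol (2 * s) \<zeta>)))"
    using s by (intro integrable_of_real exp_symbol_integrable) auto
  then have int: "integrable lborel ?F" by (intro integrable_cis_mult) auto
  have "kolmogorov_kernel s 1 x v = of_real (1 / (2 * pi)\<^sup>2) * (LINT \<phi>|lborel. LINT \<xi>|lborel. ?F (\<phi>, \<xi>))"
    unfolding kolmogorov_kernel_def
    by (simp add: symbol_def inner_prod_def cis_conv_exp mult.commute add.commute)
  also have "(LINT \<phi>|lborel. LINT \<xi>|lborel. ?F (\<phi>, \<xi>)) = (\<integral>\<zeta>. ?F \<zeta> \<partial>lborel)"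
    using int unfolding lborel_prod[symmetric] by (rule lborel_pair.integral_fst')
  also have "of_real (1 / (2 * pi)\<^sup>2) * (\<integral>\<zeta>. ?F \<zeta> \<partial>lborel) = (\<integral>\<zeta>. of_real (1 / (2 * pi)\<^sup>2) * ?F \<zeta> \<partial>lborel)"
    by (rule integral_mult_right_zero[symmetric])
  also have "\<dots> = inv_fourier (\<lambda>\<zeta>. of_real (exp (- symbol (2 * s) \<zeta>) / (2 * pi)\<^sup>2)) (v, x)"
    unfolding inv_fourier_def by (simp add: mult_ac)
  finally show ?thesis .
qed

text \<open>The large jumps enter the exponent as \<open>fourier n\<^sub>1 - \<integral> n\<^sub>1\<close>. The first term generates the series, the
second one is the normalising factor in \<open>g\<close>.\<close>

lemma kolmogorov_kernel_compound:
  fixes s :: real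
  assumes s: "0 < s" "s < 1"
  defines "\<alpha> \<equiv> 2 * s"
  defines "g \<equiv> \<lambda>z. exp (- jump_mass \<alpha> {1..}) * regular_part \<alpha> z"
  shows "summable (\<lambda>k. (convolve (restricted_levy \<alpha> {1..}) ^^ k) g z / fact k)"
    and "kolmogorov_kernel s 1 x v = of_real (compound (restricted_levy \<alpha> {1..}) g (v, x))"
proof -
  have \<alpha>: "0 < \<alpha>" "\<alpha> < 2" using s by (simp_all add: \<alpha>_def)
  let ?n = "restricted_levy \<alpha> {1..}"
  have n: "integrable lborel ?n" by (rule restricted_levy_integrable[OF \<alpha>, where r = 1]) auto
  define m where "m \<zeta> = of_real (exp (- jump_mass \<alpha> {1..})) * regular_fourier \<alpha> \<zeta>" for \<zeta>
  have m: "integrable lborel m"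
    unfolding m_def by (intro integrable_mult_right regular_fourier_integrable \<alpha>)
  have g: "of_real (g z) = inv_fourier m z" for z
  proof -
    have "of_real (g z) = of_real (exp (- jump_mass \<alpha> {1..})) * inv_fourier (regular_fourier \<alpha>) z"
      by (simp add: g_def regular_part_inv_fourier[OF \<alpha>])
    also have "\<dots> = (\<integral>\<zeta>. of_real (exp (- jump_mass \<alpha> {1..})) * (cis (z \<bullet> \<zeta>) * regular_fourier \<alpha> \<zeta>) \<partial>lborel)"
      unfolding inv_fourier_def by (rule integral_mult_right_zero[symmetric])
    finally show ?thesis by (simp add: inv_fourier_def m_def mult_ac)
  qed
  show "summable (\<lambda>k. (convolve ?n ^^ k) g z / fact k)"
    by (rule compound_inv_fourier(1)[OF n m g])
  have "exp (fourier ?n \<zeta>) * m \<zeta> = of_real (exp (- symbol \<alpha> \<zeta>) / (2 * pi)\<^sup>2)" for \<zeta>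
  proof -
    have F: "exp (fourier ?n \<zeta>) = of_real (exp (jump_mass \<alpha> {1..} - restricted_symbol \<alpha> {1..} \<zeta>))"
      by (subst fourier_restricted_levy[OF \<alpha>, where r = 1]) (auto simp only: exp_of_real, auto)
    have "exp (fourier ?n \<zeta>) * m \<zeta> = of_real (exp (jump_mass \<alpha> {1..} - restricted_symbol \<alpha> {1..} \<zeta>)
      * (exp (- jump_mass \<alpha> {1..}) * (exp (- (symbol \<alpha> \<zeta> - restricted_symbol \<alpha> {1..} \<zeta>)) / (2 * pi)\<^sup>2)))"
      unfolding F m_def regular_fourier_def of_real_mult ..
    also have "\<dots> = of_real (exp (- symbol \<alpha> \<zeta>) / (2 * pi)\<^sup>2)"
      unfolding times_divide_eq_right exp_add[symmetric] by simp
    finally show ?thesis .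
  qed
  then show "kolmogorov_kernel s 1 x v = of_real (compound ?n g (v, x))"
    unfolding compound_inv_fourier(2)[OF n m g] kolmogorov_kernel_inv_fourier[OF s] \<alpha>_def[symmetric] by simp
qed

section \<open>The profile and the upper bound\<close>

text \<open>In the coordinates \<open>(v, x)\<close> of the kernel the axis of the cone is \<open>x = v / 2\<close>, whence the shear in the
following two quantities. They are the distances from the origin and from the cone, up to constants
and increased by one.\<close>

definition spread :: "real \<times> real \<Rightarrow> real" where
  "spread z = 1 + \<bar>snd z - fst z / 2\<bar> + \<bar>fst z\<bar>"

definition excess :: "real \<times> real \<Rightarrow> real" where
  "excess z = 1 + max (2 * \<bar>snd z - fst z / 2\<bar> - \<bar>fst z\<bar>) 0"

definition profile :: "real \<Rightarrow> real \<times> real \<Rightarrow> real" where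
  "profile \<alpha> z = spread z powr (- (2 + \<alpha>)) * excess z powr (- \<alpha>)"

lemma kolmogorov_profile_eq: "kolmogorov_profile s x v = profile (2 * s) (v, x + v / 2)"
  unfolding kolmogorov_profile_def profile_def spread_def excess_def powr_minus_divide by simp

lemma spread_excess_measurable [measurable]:
  "spread \<in> borel_measurable borel" "excess \<in> borel_measurable borel" "profile \<alpha> \<in> borel_measurable borel"
proof -
  show [measurable]: "spread \<in> borel_measurable borel" "excess \<in> borel_measurable borel"
    unfolding spread_def excess_def by measurable
  show "profile \<alpha> \<in> borel_measurable borel"
    unfolding profile_def by measurable
qed

lemma spread_ge_1: "1 \<le> spread z" and excess_ge_1: "1 \<le> excess z" and excess_le_spread: "excess z \<le> 2 * spread z"
  by (auto simp: spread_def excess_def)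

lemma profile_pos: "0 < profile \<alpha> z"
  using spread_ge_1[of z] excess_ge_1[of z] by (simp add: profile_def)

lemma spread_tail:
  fixes \<alpha> r :: real
  assumes \<alpha>: "\<alpha> > 0" and r: "r > 0"
  shows "(\<integral>\<^sup>+y. ennreal (spread (z - y) powr (- (2 + \<alpha>)) * indicator {r..} (spread (z - y))) \<partial>lborel)
    \<le> ennreal (2 powr (2 + \<alpha>) * (2 / (1 + \<alpha>)) * (2 / \<alpha>) * r powr (- \<alpha>))"
proof -
  obtain v x where z: "z = (v, x)" by (cases z)
  have "(\<integral>\<^sup>+y. ennreal (spread (z - y) powr (- (2 + \<alpha>)) * indicator {r..} (spread (z - y))) \<partial>lborel)
    \<le> (\<integral>\<^sup>+y. ennreal (2 powr (2 + \<alpha>)) * ennreal ((r + \<bar>v - fst y\<bar> + \<bar>(x - (v - fst y) / 2) - snd y\<bar>) powr (-1 - (1 + \<alpha>))) \<partial>lborel)"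
  proof (rule nn_integral_mono)
    fix y :: "real \<times> real"
    let ?W = "spread (z - y)"
    have "?W powr (- (2 + \<alpha>)) * indicator {r..} ?W
      \<le> 2 powr (2 + \<alpha>) * (r + \<bar>v - fst y\<bar> + \<bar>(x - (v - fst y) / 2) - snd y\<bar>) powr (- (2 + \<alpha>))"
    proof (cases "r \<le> ?W")
      case True
      have "?W powr (- (2 + \<alpha>)) \<le> 2 powr (2 + \<alpha>) * (r + ?W) powr (- (2 + \<alpha>))"
        using True r \<alpha> by (intro powr_le_shifted_powr) auto
      also have "(r + ?W) powr (- (2 + \<alpha>)) \<le> (r + \<bar>v - fst y\<bar> + \<bar>(x - (v - fst y) / 2) - snd y\<bar>) powr (- (2 + \<alpha>))"
        using r \<alpha> by (intro powr_mono2') (auto simp: spread_def z algebra_simps)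
      finally show ?thesis using True by simp
    qed simp
    then show "ennreal (?W powr (- (2 + \<alpha>)) * indicator {r..} ?W)
      \<le> ennreal (2 powr (2 + \<alpha>)) * ennreal ((r + \<bar>v - fst y\<bar> + \<bar>(x - (v - fst y) / 2) - snd y\<bar>) powr (-1 - (1 + \<alpha>)))"
      by (simp add: ennreal_mult'[symmetric] ennreal_leI)
  qed
  also have "\<dots> = ennreal (2 powr (2 + \<alpha>)) * (\<integral>\<^sup>+y. ennreal ((r + \<bar>v - fst y\<bar> + \<bar>(x - (v - fst y) / 2) - snd y\<bar>) powr (-1 - (1 + \<alpha>))) \<partial>lborel)"
    by (rule nn_integral_cmult) measurable
  also have "(\<integral>\<^sup>+y. ennreal ((r + \<bar>v - fst y\<bar> + \<bar>(x - (v - fst y) / 2) - snd y\<bar>) powr (-1 - (1 + \<alpha>))) \<partial>lborel)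
    = (\<integral>\<^sup>+a. (\<integral>\<^sup>+b. ennreal ((r + \<bar>v - a\<bar> + \<bar>(x - (v - a) / 2) - b\<bar>) powr (-1 - (1 + \<alpha>))) \<partial>lborel) \<partial>lborel)"
    unfolding lborel_prod[symmetric] by (subst lborel.nn_integral_fst[symmetric]) auto
  also have "\<dots> \<le> (\<integral>\<^sup>+a. ennreal (2 / (1 + \<alpha>)) * ennreal ((r + \<bar>v - a\<bar>) powr (-1 - \<alpha>)) \<partial>lborel)"
  proof (rule nn_integral_mono)
    fix a :: real
    have "(\<integral>\<^sup>+b. ennreal ((r + \<bar>v - a\<bar> + \<bar>(x - (v - a) / 2) - b\<bar>) powr (-1 - (1 + \<alpha>))) \<partial>lborel)
      \<le> ennreal (2 / (1 + \<alpha>) * (r + \<bar>v - a\<bar>) powr (- (1 + \<alpha>)))"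
      using r \<alpha> by (intro nn_integral_centred_powr_le) auto
    then show "(\<integral>\<^sup>+b. ennreal ((r + \<bar>v - a\<bar> + \<bar>(x - (v - a) / 2) - b\<bar>) powr (-1 - (1 + \<alpha>))) \<partial>lborel)
      \<le> ennreal (2 / (1 + \<alpha>)) * ennreal ((r + \<bar>v - a\<bar>) powr (-1 - \<alpha>))"
      using \<alpha> by (simp add: ennreal_mult'[symmetric])
  qed
  also have "\<dots> = ennreal (2 / (1 + \<alpha>)) * (\<integral>\<^sup>+a. ennreal ((r + \<bar>v - a\<bar>) powr (-1 - \<alpha>)) \<partial>lborel)"
    by (rule nn_integral_cmult) measurable
  also have "\<dots> \<le> ennreal (2 / (1 + \<alpha>)) * ennreal (2 / \<alpha> * r powr (- \<alpha>))"
    using r \<alpha> by (intro mult_left_mono nn_integral_centred_powr_le) auto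
  finally have "(\<integral>\<^sup>+y. ennreal (spread (z - y) powr (- (2 + \<alpha>)) * indicator {r..} (spread (z - y))) \<partial>lborel)
    \<le> ennreal (2 powr (2 + \<alpha>)) * (ennreal (2 / (1 + \<alpha>)) * ennreal (2 / \<alpha> * r powr (- \<alpha>)))"
    by (simp add: mult_left_mono)
  also have "\<dots> = ennreal (2 powr (2 + \<alpha>) * (2 / (1 + \<alpha>)) * (2 / \<alpha>) * r powr (- \<alpha>))"
    using \<alpha> by (simp add: ennreal_mult'[symmetric] mult.assoc)
  finally show ?thesis .
qed

text \<open>The profile is bounded below by a multiple of the power \<open>-6\<close> of \<open>spread\<close>, since \<open>2 + 2\<alpha> \<le> 6\<close>.\<close>

lemma exp_decay_le_profile:
  assumes \<alpha>: "0 < \<alpha>" "\<alpha> < 2"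
  shows "exp (- (\<bar>fst z\<bar> + \<bar>snd z\<bar>)) \<le> 4 * 2 ^ 6 * fact 6 * exp 1 * profile \<alpha> z"
proof -
  define M where "M = \<bar>fst z\<bar> + \<bar>snd z\<bar>"
  have M: "M \<ge> 0" by (simp add: M_def)
  note W = spread_ge_1[of z] and D = excess_ge_1[of z]
  have "spread z \<le> 2 * (1 + M)"
    using abs_triangle_ineq4[of "snd z" "fst z / 2"] unfolding spread_def M_def by simp
  \<comment> \<open>The sixth power is absorbed by \<open>exp (1 + M) \<ge> (1 + M) ^ 6 / 6!\<close>.\<close>
  have "spread z powr (2 + \<alpha>) * excess z powr \<alpha> \<le> spread z powr (2 + \<alpha>) * (2 * spread z) powr \<alpha>"
    using \<alpha> D excess_le_spread[of z] by (intro mult_left_mono powr_mono2) auto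
  also have "\<dots> = 2 powr \<alpha> * spread z powr (2 + \<alpha> + \<alpha>)"
  proof -
    have "(2 * spread z) powr \<alpha> = 2 powr \<alpha> * spread z powr \<alpha>" using W by (simp add: powr_mult)
    then show ?thesis by (simp only: powr_add mult_ac)
  qed
  also have "\<dots> \<le> 2 powr 2 * spread z powr 6"
    using \<alpha> W by (intro mult_mono powr_mono) auto
  also have "\<dots> = 4 * spread z ^ 6" using W by (simp add: powr_numeral)
  also have "\<dots> \<le> 4 * (2 * (1 + M)) ^ 6"
    using W \<open>spread z \<le> 2 * (1 + M)\<close> by (intro mult_left_mono power_mono) auto
  also have "\<dots> = 4 * 2 ^ 6 * fact 6 * ((1 + M) ^ 6 / fact 6)"
    by (simp only: power_mult_distrib) simp
  also have "\<dots> \<le> 4 * 2 ^ 6 * fact 6 * exp (1 + M)"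
    using M by (intro mult_left_mono power_le_fact_exp) auto
  finally have le: "spread z powr (2 + \<alpha>) * excess z powr \<alpha> \<le> 4 * 2 ^ 6 * fact 6 * exp 1 * exp M"
    by (simp only: exp_add mult.assoc)
  have "profile \<alpha> z = 1 / (spread z powr (2 + \<alpha>) * excess z powr \<alpha>)"
    unfolding profile_def powr_minus_divide by simp
  moreover have "spread z powr (2 + \<alpha>) * excess z powr \<alpha> > 0" using W D by simp
  ultimately have "1 \<le> 4 * 2 ^ 6 * fact 6 * exp 1 * exp M * profile \<alpha> z"
    using le by (simp add: pos_le_divide_eq)
  then show ?thesis
    unfolding M_def[symmetric] exp_minus[of M] by (simp add: field_simps)
qed

lemma divide_powr_minus:
  fixes x k p :: real
  assumes "x > 0" "k > 0"
  shows "(x / k) powr (- p) = k powr p * x powr (- p)"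
  using assms by (simp add: powr_divide powr_minus divide_simps)

text \<open>Let \<open>R\<close> and \<open>D\<close> be the spread and the excess of \<open>z\<close>, and \<open>t\<close> the size of the jump \<open>y\<close>. As \<open>y\<close> lies in
the cone, \<open>z - y\<close> is at least about as far from the cone as \<open>D\<close>, minus a multiple of \<open>t\<close>.
\<^item> If \<open>t \<le> D / 4\<close>, neither \<open>R\<close> nor \<open>D\<close> changes by more than a constant factor, and the total mass of the
  jumps is finite.
\<^item> If \<open>D / 4 < t \<le> R / 4\<close>, then \<open>R\<close> still changes by a constant factor only, and the jumps of this size
  have mass at most a multiple of \<open>D\<^sup>-\<^sup>\<alpha>\<close>.
\<^item> If \<open>t > R / 4\<close>, the jump density is at most a multiple of \<open>R\<^sup>-\<^sup>2\<^sup>-\<^sup>\<alpha>\<close>. The point \<open>z - y\<close> has spread at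
  least \<open>D / 2\<close>, whatever \<open>y\<close> in the cone, and the profile has mass at most a multiple of \<open>D\<^sup>-\<^sup>\<alpha>\<close> there.\<close>

lemma profile_convolution_bound:
  assumes \<alpha>: "0 < \<alpha>" "\<alpha> < 2"
  obtains K where "K \<ge> 0"
    "\<And>z. (\<integral>\<^sup>+y. ennreal (restricted_levy \<alpha> {1..} y * profile \<alpha> (z - y)) \<partial>lborel) \<le> ennreal (K * profile \<alpha> z)"
proof -
  let ?n = "restricted_levy \<alpha> {1..}"
  define A1 where "A1 = (4::real) powr (2 + \<alpha>) * 2 powr \<alpha>"
  define A2 where "A2 = (2::real) powr (2 + \<alpha>)"
  define A3 where "A3 = 4 powr (2 + \<alpha>) / levy_const \<alpha>"
  define B1 where "B1 = jump_mass \<alpha> {1..}"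
  define B2 where "B2 = 2 powr (1 + \<alpha>) * (2 / \<alpha>) / levy_const \<alpha> * 4 powr \<alpha>"
  define B3 where "B3 = 2 powr (2 + \<alpha>) * (2 / (1 + \<alpha>)) * (2 / \<alpha>) * 2 powr \<alpha>"
  have lc: "levy_const \<alpha> > 0" by (rule levy_const_pos[OF \<alpha>])
  have A: "A1 \<ge> 0" "A2 \<ge> 0" "A3 \<ge> 0" using lc by (simp_all add: A1_def A2_def A3_def)
  have B: "B1 \<ge> 0" "B2 \<ge> 0" "B3 \<ge> 0"
    using lc \<alpha> jump_mass_nonneg[OF \<alpha>] by (simp_all add: B1_def B2_def B3_def)
  have [measurable]: "?n \<in> borel_measurable borel" by (rule restricted_levy_measurable[OF \<alpha>]) simp
  have n0: "?n y \<ge> 0" for y by (rule restricted_levy_nonneg[OF \<alpha>])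
  have l0: "levy_density \<alpha> y \<ge> 0" for y by (rule levy_density_nonneg[OF \<alpha>])
  have "(\<integral>\<^sup>+y. ennreal (?n y * profile \<alpha> (z - y)) \<partial>lborel)
      \<le> ennreal ((A1 * B1 + A2 * B2 + A3 * B3) * profile \<alpha> z)" for z
  proof -
    define R where "R = spread z"
    define D where "D = excess z"
    have R: "R \<ge> 1" and D: "D \<ge> 1" and DR: "D \<le> 2 * R"
      using spread_ge_1 excess_ge_1 excess_le_spread by (auto simp: R_def D_def)
    have Pz: "profile \<alpha> z = R powr (- (2 + \<alpha>)) * D powr (- \<alpha>)" by (simp add: profile_def R_def D_def)
    let ?t1 = "\<lambda>y. ?n y"
    let ?t2 = "\<lambda>y. levy_density \<alpha> y * indicator {D / 4..} \<bar>fst y\<bar>"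
    let ?t3 = "\<lambda>y. spread (z - y) powr (- (2 + \<alpha>)) * indicator {D / 2..} (spread (z - y))"
    let ?P = "R powr (- (2 + \<alpha>))"
    have pw: "?n y * profile \<alpha> (z - y) \<le> (A1 * profile \<alpha> z) * ?t1 y + (A2 * ?P) * ?t2 y + (A3 * ?P) * ?t3 y" for y
    proof (cases "?n y = 0")
      case True
      then show ?thesis using A l0[of y] by (auto simp: Pz intro!: add_nonneg_nonneg mult_nonneg_nonneg)
    next
      case False
      define t where "t = \<bar>fst y\<bar>"
      have t1: "t \<ge> 1" using restricted_levy_support(1)[OF \<alpha> False] by (simp add: t_def)
      have cone: "\<bar>2 * snd y - fst y\<bar> \<le> t"
        using False by (auto simp: restricted_levy_def levy_density_def t_def split: if_splits)
      have n_eq: "?n y = levy_density \<alpha> y" using t1 by (simp add: restricted_levy_def t_def)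
      have n_val: "?n y = t powr (- (2 + \<alpha>)) / levy_const \<alpha>"
        using cone by (simp add: n_eq levy_density_def t_def)
      define a where "a = snd z - fst z / 2"
      define b where "b = snd y - fst y / 2"
      have zy: "snd (z - y) - (fst z - fst y) / 2 = a - b" by (simp add: a_def b_def field_simps)
      have "2 * snd y - fst y = 2 * b" by (simp add: b_def)
      then have b: "2 * \<bar>b\<bar> \<le> t" using cone by (simp add: abs_mult)
      have tri: "\<bar>a\<bar> \<le> \<bar>a - b\<bar> + \<bar>b\<bar>" "\<bar>fst z\<bar> \<le> \<bar>fst z - fst y\<bar> + t" "\<bar>fst z - fst y\<bar> \<le> \<bar>fst z\<bar> + t"
        by (simp_all add: t_def)
      have Wy: "R \<le> spread (z - y) + 3 / 2 * t"
        using b tri unfolding R_def spread_def fst_diff zy a_def[symmetric] by linarith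
      have D_le: "D \<le> c" if "1 \<le> c" "1 + (2 * \<bar>a\<bar> - \<bar>fst z\<bar>) \<le> c" for c
        using that unfolding D_def excess_def a_def[symmetric] by simp
      have Dy: "D \<le> excess (z - y) + 2 * t"
      proof (rule D_le)
        show "1 \<le> excess (z - y) + 2 * t" using excess_ge_1[of "z - y"] t1 by simp
        have "1 + (2 * \<bar>a - b\<bar> - \<bar>fst z - fst y\<bar>) \<le> excess (z - y)"
          unfolding excess_def fst_diff zy by simp
        then show "1 + (2 * \<bar>a\<bar> - \<bar>fst z\<bar>) \<le> excess (z - y) + 2 * t" using b tri by linarith
      qed
      have DW: "D \<le> 2 * spread (z - y)"
      proof (rule D_le)
        show "1 \<le> 2 * spread (z - y)" using spread_ge_1[of "z - y"] by simp
        have "t \<le> \<bar>fst z\<bar> + \<bar>fst z - fst y\<bar>" by (simp add: t_def)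
        moreover have "1 + (2 * A - Z) \<le> 2 * (1 + C + W)"
          if "t \<le> Z + W" "2 * B \<le> t" "A \<le> C + B" "0 \<le> W" for A B C Z W
          using that by argo
        ultimately show "1 + (2 * \<bar>a\<bar> - \<bar>fst z\<bar>) \<le> 2 * spread (z - y)"
          unfolding spread_def fst_diff zy using b tri(1) abs_ge_zero by blast
      qed
      have prof_le: "profile \<alpha> (z - y) \<le> a powr (- (2 + \<alpha>)) * b powr (- \<alpha>)"
        if "0 < a" "a \<le> spread (z - y)" "0 < b" "b \<le> excess (z - y)" for a b
        unfolding profile_def using that \<alpha> by (intro mult_mono powr_mono2') auto
      have s2: "(R / 2) powr (- (2 + \<alpha>)) = 2 powr (2 + \<alpha>) * ?P"
        and s4: "(R / 4) powr (- (2 + \<alpha>)) = 4 powr (2 + \<alpha>) * ?P"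
        and d2: "(D / 2) powr (- \<alpha>) = 2 powr \<alpha> * D powr (- \<alpha>)"
        by (rule divide_powr_minus; use R D in simp)+
      have nn: "(A1 * profile \<alpha> z) * ?t1 y \<ge> 0" "(A2 * ?P) * ?t2 y \<ge> 0" "(A3 * ?P) * ?t3 y \<ge> 0"
        using A n0[of y] l0[of y] profile_pos[of \<alpha> z] by (auto intro!: mult_nonneg_nonneg)
      consider "t \<le> D / 4" | "D / 4 < t" "t \<le> R / 4" | "R / 4 < t" by linarith
      then show ?thesis
      proof cases
        case 1
        have "profile \<alpha> (z - y) \<le> (R / 4) powr (- (2 + \<alpha>)) * (D / 2) powr (- \<alpha>)"
          using R D DR Wy Dy 1 by (intro prof_le) auto
        also have "\<dots> = A1 * profile \<alpha> z"
          unfolding s4 d2 A1_def Pz by (simp only: mult_ac)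
        finally have "?n y * profile \<alpha> (z - y) \<le> (A1 * profile \<alpha> z) * ?t1 y"
          unfolding mult.commute[of "?n y"] by (rule mult_right_mono[OF _ n0])
        also have "\<dots> \<le> (A1 * profile \<alpha> z) * ?t1 y + (A2 * ?P) * ?t2 y + (A3 * ?P) * ?t3 y"
          using nn by linarith
        finally show ?thesis .
      next
        case 2
        have "profile \<alpha> (z - y) \<le> (R / 2) powr (- (2 + \<alpha>)) * 1 powr (- \<alpha>)"
          using R Wy 2 excess_ge_1 by (intro prof_le) auto
        also have "\<dots> = A2 * ?P" unfolding s2 A2_def by simp
        finally have "?n y * profile \<alpha> (z - y) \<le> (A2 * ?P) * ?n y"
          unfolding mult.commute[of "?n y"] by (rule mult_right_mono[OF _ n0])
        also have "\<dots> = (A2 * ?P) * ?t2 y" using 2 by (simp add: n_eq t_def)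
        also have "\<dots> \<le> (A1 * profile \<alpha> z) * ?t1 y + (A2 * ?P) * ?t2 y + (A3 * ?P) * ?t3 y"
          using nn by linarith
        finally show ?thesis .
      next
        case 3
        have "?n y \<le> (R / 4) powr (- (2 + \<alpha>)) / levy_const \<alpha>"
          unfolding n_val using 3 R \<alpha> lc by (intro divide_right_mono powr_mono2') auto
        also have "\<dots> = A3 * ?P" unfolding s4 A3_def by simp
        finally have a: "?n y \<le> A3 * ?P" .
        have "profile \<alpha> (z - y) \<le> spread (z - y) powr (- (2 + \<alpha>)) * 1 powr (- \<alpha>)"
          using spread_ge_1[of "z - y"] excess_ge_1[of "z - y"] by (intro prof_le) auto
        also have "\<dots> = ?t3 y" using DW by simp
        finally have b: "profile \<alpha> (z - y) \<le> ?t3 y" .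
        have "?n y * profile \<alpha> (z - y) \<le> (A3 * ?P) * ?t3 y"
          using A profile_pos[of \<alpha> "z - y"] by (intro mult_mono a b) auto
        also have "\<dots> \<le> (A1 * profile \<alpha> z) * ?t1 y + (A2 * ?P) * ?t2 y + (A3 * ?P) * ?t3 y"
          using nn by linarith
        finally show ?thesis .
      qed
    qed
    have i1: "(\<integral>\<^sup>+y. ennreal (?t1 y) \<partial>lborel) = ennreal B1"
      unfolding B1_def jump_mass_def
      by (rule nn_integral_eq_integral[OF restricted_levy_integrable[OF \<alpha>, where r = 1]]) (auto simp: n0)
    have i2: "(\<integral>\<^sup>+y. ennreal (?t2 y) \<partial>lborel) \<le> ennreal (B2 * D powr (- \<alpha>))"
    proof -
      have "(D / 4) powr (- \<alpha>) = 4 powr \<alpha> * D powr (- \<alpha>)"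
        using D by (simp add: powr_divide powr_minus divide_simps)
      then show ?thesis
        using levy_density_tail[OF \<alpha>, of "D / 4"] D by (simp add: B2_def mult.assoc)
    qed
    have i3: "(\<integral>\<^sup>+y. ennreal (?t3 y) \<partial>lborel) \<le> ennreal (B3 * D powr (- \<alpha>))"
    proof -
      have "(D / 2) powr (- \<alpha>) = 2 powr \<alpha> * D powr (- \<alpha>)"
        using D by (simp add: powr_divide powr_minus divide_simps)
      then show ?thesis
        using spread_tail[of \<alpha> "D / 2" z] \<alpha> D by (simp add: B3_def mult.assoc)
    qed
    have cst: "A1 * profile \<alpha> z \<ge> 0" "A2 * ?P \<ge> 0" "A3 * ?P \<ge> 0"
      using A profile_pos[of \<alpha> z] by auto
    have "(\<integral>\<^sup>+y. ennreal (?n y * profile \<alpha> (z - y)) \<partial>lborel)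
      \<le> (\<integral>\<^sup>+y. ennreal (A1 * profile \<alpha> z) * ennreal (?t1 y) + (ennreal (A2 * ?P) * ennreal (?t2 y)
          + ennreal (A3 * ?P) * ennreal (?t3 y)) \<partial>lborel)"
    proof (rule nn_integral_mono)
      fix y
      have "ennreal (A1 * profile \<alpha> z) * ennreal (?t1 y) + (ennreal (A2 * ?P) * ennreal (?t2 y) + ennreal (A3 * ?P) * ennreal (?t3 y))
        = ennreal ((A1 * profile \<alpha> z) * ?t1 y + ((A2 * ?P) * ?t2 y + (A3 * ?P) * ?t3 y))"
        using cst n0[of y] l0[of y] by (simp add: ennreal_mult ennreal_plus)
      then show "ennreal (?n y * profile \<alpha> (z - y))
        \<le> ennreal (A1 * profile \<alpha> z) * ennreal (?t1 y) + (ennreal (A2 * ?P) * ennreal (?t2 y) + ennreal (A3 * ?P) * ennreal (?t3 y))"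
        using pw[of y] by (simp add: ennreal_leI add.assoc)
    qed
    also have "\<dots> = ennreal (A1 * profile \<alpha> z) * (\<integral>\<^sup>+y. ennreal (?t1 y) \<partial>lborel)
        + (ennreal (A2 * ?P) * (\<integral>\<^sup>+y. ennreal (?t2 y) \<partial>lborel) + ennreal (A3 * ?P) * (\<integral>\<^sup>+y. ennreal (?t3 y) \<partial>lborel))"
    proof -
      have [measurable]: "?t2 \<in> borel_measurable borel" "?t3 \<in> borel_measurable borel"
      proof -
        show "?t2 \<in> borel_measurable borel"
          using restricted_levy_measurable[OF \<alpha>, of "{D / 4..}"] by (simp add: restricted_levy_def[abs_def])
        have "(\<lambda>y. indicat_real {D / 2..} (spread (z - y))) \<in> borel_measurable borel"
          by (intro measurable_compose[of "\<lambda>y. spread (z - y)" borel borel "indicator {D / 2..}"]) auto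
        then show "?t3 \<in> borel_measurable borel" by measurable
      qed
      have "(\<integral>\<^sup>+y. ennreal (A1 * profile \<alpha> z) * ennreal (?t1 y) + (ennreal (A2 * ?P) * ennreal (?t2 y)
          + ennreal (A3 * ?P) * ennreal (?t3 y)) \<partial>lborel)
        = (\<integral>\<^sup>+y. ennreal (A1 * profile \<alpha> z) * ennreal (?t1 y) \<partial>lborel)
          + (\<integral>\<^sup>+y. ennreal (A2 * ?P) * ennreal (?t2 y) + ennreal (A3 * ?P) * ennreal (?t3 y) \<partial>lborel)"
        by (rule nn_integral_add) measurable
      also have "(\<integral>\<^sup>+y. ennreal (A2 * ?P) * ennreal (?t2 y) + ennreal (A3 * ?P) * ennreal (?t3 y) \<partial>lborel)
        = (\<integral>\<^sup>+y. ennreal (A2 * ?P) * ennreal (?t2 y) \<partial>lborel) + (\<integral>\<^sup>+y. ennreal (A3 * ?P) * ennreal (?t3 y) \<partial>lborel)"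
        by (rule nn_integral_add) measurable
      finally show ?thesis by (simp add: nn_integral_cmult)
    qed
    also have "\<dots> \<le> ennreal (A1 * profile \<alpha> z) * ennreal B1
        + (ennreal (A2 * ?P) * ennreal (B2 * D powr (- \<alpha>)) + ennreal (A3 * ?P) * ennreal (B3 * D powr (- \<alpha>)))"
      unfolding i1 by (intro add_mono mult_left_mono i2 i3) auto
    also have "\<dots> = ennreal ((A1 * profile \<alpha> z) * B1 + ((A2 * ?P) * (B2 * D powr (- \<alpha>)) + (A3 * ?P) * (B3 * D powr (- \<alpha>))))"
      using cst B by (simp add: ennreal_mult ennreal_plus)
    also have "(A1 * profile \<alpha> z) * B1 + ((A2 * ?P) * (B2 * D powr (- \<alpha>)) + (A3 * ?P) * (B3 * D powr (- \<alpha>)))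
      = (A1 * B1 + A2 * B2 + A3 * B3) * profile \<alpha> z"
      by (simp add: Pz algebra_simps)
    finally show ?thesis .
  qed
  then show ?thesis using A B by (intro that[of "A1 * B1 + A2 * B2 + A3 * B3"]) auto
qed

section \<open>Two jumps reach every point\<close>

lemma convolve_ge_on_box:
  fixes n f :: "'a::euclidean_space \<Rightarrow> real"
  assumes int: "integrable lborel (\<lambda>y. n y * f (z - y))"
    and n: "\<And>y. n y \<ge> 0" and f: "\<And>y. f y \<ge> 0"
    and box: "\<And>y. y \<in> cbox p q \<Longrightarrow> b \<le> n y \<and> c \<le> f (z - y)" and b: "b \<ge> 0" and c: "c \<ge> 0"
  shows "b * c * measure lborel (cbox p q) \<le> convolve n f z"
proof -
  have "b * c * measure lborel (cbox p q) = (\<integral>y. b * c * indicator (cbox p q) y \<partial>lborel)"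
    by simp
  also have "\<dots> \<le> convolve n f z"
    unfolding convolve_def
  proof (rule integral_mono[OF _ int])
    show "b * c * indicator (cbox p q) y \<le> n y * f (z - y)" for y
      using box[of y] n[of y] f[of "z - y"] b c by (auto intro!: mult_mono split: split_indicator)
    show "integrable lborel (\<lambda>y. b * c * indicator (cbox p q) y)"
      by (intro integrable_mult_right integrable_real_indicator emeasure_lborel_cbox_finite) simp
  qed
  finally show ?thesis .
qed

lemma convolve_integrand_integrable:
  fixes n f :: "'a::euclidean_space \<Rightarrow> real"
  assumes n: "integrable lborel n" and [measurable]: "f \<in> borel_measurable borel" and B: "\<And>z. \<bar>f z\<bar> \<le> B"
  shows "integrable lborel (\<lambda>y. n y * f (z - y))"
proof (rule Bochner_Integration.integrable_bound)
  note [measurable] = borel_measurable_integrable[OF n]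
  show "integrable lborel (\<lambda>y. B * n y)" using n by simp
  have "B \<ge> 0" using B[of 0] by simp
  then show "AE y in lborel. norm (n y * f (z - y)) \<le> norm (B * n y)"
    using B by (intro AE_I2) (auto simp: abs_mult mult.commute[of B] intro!: mult_left_mono)
  show "(\<lambda>y. n y * f (z - y)) \<in> borel_measurable lborel" by measurable
qed

lemma measure_square:
  fixes r :: real
  assumes "r \<ge> 0"
  shows "measure lborel (cbox (a - r, b - r) (a + r, b + r)) = (2 * r)\<^sup>2"
  using assms by (simp add: content_Pair power2_eq_square)

lemma mem_square:
  fixes a b r :: real
  shows "y \<in> cbox (a - r, b - r) (a + r, b + r) \<longleftrightarrow> \<bar>fst y - a\<bar> \<le> r \<and> \<bar>snd y - b\<bar> \<le> r"
  by (cases y) (auto simp: cbox_Pair_eq abs_le_iff)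

text \<open>A jump against the sign of \<open>v\<close>, whose size is about twice the excess \<open>D\<close> and whose direction is tilted
towards \<open>a = x - v / 2\<close>, leads from the origin to a position from which the remaining displacement lies
in the cone: the velocity that is still missing has grown to \<open>\<bar>v\<bar> + 2D\<close>, while the distance to the axis
has not grown beyond what this permits. The margins are large enough for the first jump to vary in a
square of side \<open>D / 4\<close> and for an additional displacement \<open>w\<close> of size \<open>\<delta>\<close>.\<close>

lemma two_jump_geometry:
  fixes v a \<delta> :: real
  assumes \<delta>: "0 < \<delta>" "\<delta> \<le> 1 / 8"
    and D: "D = 1 + max (2 * \<bar>a\<bar> - \<bar>v\<bar>) 0"
    and \<tau>: "\<tau> = (if v \<ge> 0 then 1 else -1)" and \<rho>: "\<rho> = (if a \<ge> 0 then 1 else -1)"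
    and y: "\<bar>y1 - (- \<tau> * (17 / 8 * D))\<bar> \<le> D / 8" "\<bar>y2 - (- \<tau> * D + \<rho> * D / 4)\<bar> \<le> D / 8"
    and w: "\<bar>w1\<bar> \<le> \<delta>" "\<bar>w2\<bar> \<le> \<delta>"
  shows "1 \<le> \<bar>y1\<bar>" "\<bar>y1\<bar> \<le> 4 * D" "\<bar>2 * y2 - y1\<bar> \<le> \<bar>y1\<bar>"
    "1 \<le> \<bar>v - y1 - w1\<bar>" "\<bar>v - y1 - w1\<bar> \<le> 6 * (1 + \<bar>a\<bar> + \<bar>v\<bar>)"
    "\<bar>2 * (a + v / 2 - y2 - w2) - (v - y1 - w1)\<bar> \<le> \<bar>v - y1 - w1\<bar>"
proof -
  \<comment> \<open>The size of the first jump, and its signed offset from the axis of the cone, both normalised by the signs of \<open>v\<close> and \<open>a\<close>.\<close>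
  define s where "s = - \<tau> * y1"
  define e where "e = \<rho> * (y2 - y1 / 2)"
  have \<tau>2: "\<tau> = 1 \<or> \<tau> = -1" and \<rho>2: "\<rho> = 1 \<or> \<rho> = -1" using \<tau> \<rho> by auto
  have D1: "D \<ge> 1" "2 * \<bar>a\<bar> - \<bar>v\<bar> \<le> D - 1" "D \<le> 2 * (1 + \<bar>a\<bar> + \<bar>v\<bar>)" using D by auto
  have y1b: "- (D / 8) \<le> y1 + \<tau> * (17 / 8 * D)" "y1 + \<tau> * (17 / 8 * D) \<le> D / 8"
    using abs_le_D1[OF y(1)] abs_le_D2[OF y(1)] by linarith+
  have y2b: "- (D / 8) \<le> y2 + \<tau> * D - \<rho> * D / 4" "y2 + \<tau> * D - \<rho> * D / 4 \<le> D / 8"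
    using abs_le_D1[OF y(2)] abs_le_D2[OF y(2)] by linarith+
  have s: "2 * D \<le> s" "s \<le> 9 / 4 * D"
    using y1b \<tau>2 by (elim disjE; simp only: s_def; linarith)+
  have e: "0 \<le> e" "e \<le> D / 2"
  proof -
    from \<tau>2 \<rho>2 consider "\<tau> = 1" "\<rho> = 1" | "\<tau> = 1" "\<rho> = -1" | "\<tau> = -1" "\<rho> = 1" | "\<tau> = -1" "\<rho> = -1"
      by blast
    then have "0 \<le> e \<and> e \<le> D / 2"
      by cases (insert y1b y2b D1(1); simp add: e_def)+
    then show "0 \<le> e" "e \<le> D / 2" by auto
  qed
  have y1: "\<bar>y1\<bar> = s" using s(1) D1 \<tau>2 by (auto simp: s_def)
  have ye: "\<bar>2 * y2 - y1\<bar> = 2 * e" using e(1) \<rho>2 by (auto simp: e_def abs_if)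
  show "1 \<le> \<bar>y1\<bar>" "\<bar>y1\<bar> \<le> 4 * D" "\<bar>2 * y2 - y1\<bar> \<le> \<bar>y1\<bar>"
    unfolding y1 ye using s e D1 by linarith+
  have vy: "\<bar>v - y1\<bar> = \<bar>v\<bar> + s"
    using s(1) D1 \<tau> by (auto simp: s_def split: if_splits)
  have tri: "\<bar>v - y1\<bar> - \<bar>w1\<bar> \<le> \<bar>v - y1 - w1\<bar>" "\<bar>v - y1 - w1\<bar> \<le> \<bar>v - y1\<bar> + \<bar>w1\<bar>"
    by linarith+
  show "1 \<le> \<bar>v - y1 - w1\<bar>" "\<bar>v - y1 - w1\<bar> \<le> 6 * (1 + \<bar>a\<bar> + \<bar>v\<bar>)"
  proof -
    show "1 \<le> \<bar>v - y1 - w1\<bar>" using tri(1) s(1) D1(1) w(1) \<delta> abs_ge_zero[of v] unfolding vy by argo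
    show "\<bar>v - y1 - w1\<bar> \<le> 6 * (1 + \<bar>a\<bar> + \<bar>v\<bar>)"
      using tri(2) s(2) D1(3) w(1) \<delta>(2) abs_ge_zero[of a] abs_ge_zero[of v] unfolding vy by argo
  qed
  have ae: "\<bar>a - (y2 - y1 / 2)\<bar> = \<bar>\<bar>a\<bar> - e\<bar>"
    using \<rho> by (auto simp: e_def abs_if split: if_splits)
  have "\<bar>2 * (a + v / 2 - y2 - w2) - (v - y1 - w1)\<bar> = \<bar>2 * (a - (y2 - y1 / 2)) - (2 * w2 - w1)\<bar>"
    by (simp add: field_simps)
  also have "\<dots> \<le> 2 * \<bar>\<bar>a\<bar> - e\<bar> + (2 * \<bar>w2\<bar> + \<bar>w1\<bar>)"
    using abs_triangle_ineq4[of "2 * (a - (y2 - y1 / 2))" "2 * w2 - w1"] abs_triangle_ineq4[of "2 * w2" w1]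
    unfolding ae[symmetric] abs_mult abs_numeral by argo
  also have "\<dots> \<le> \<bar>v\<bar> + s - \<delta>"
  proof -
    have "\<bar>\<bar>a\<bar> - e\<bar> \<le> (\<bar>v\<bar> + D) / 2"
      using e D1(1,2) abs_ge_zero[of a] abs_ge_zero[of v] by (intro abs_leI) argo+
    then show ?thesis using s(1) D1(1) w \<delta> by argo
  qed
  also have "\<dots> \<le> \<bar>v - y1 - w1\<bar>" using tri(1) w unfolding vy by argo
  finally show "\<bar>2 * (a + v / 2 - y2 - w2) - (v - y1 - w1)\<bar> \<le> \<bar>v - y1 - w1\<bar>" .
qed

lemma restricted_levy_lower:
  assumes \<alpha>: "0 < \<alpha>" "\<alpha> < 2" and "1 \<le> \<bar>fst y\<bar>" "\<bar>fst y\<bar> \<le> r" "\<bar>2 * snd y - fst y\<bar> \<le> \<bar>fst y\<bar>"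
  shows "r powr (- (2 + \<alpha>)) / levy_const \<alpha> \<le> restricted_levy \<alpha> {1..} y"
proof -
  have "r powr (- (2 + \<alpha>)) / levy_const \<alpha> \<le> \<bar>fst y\<bar> powr (- (2 + \<alpha>)) / levy_const \<alpha>"
    using assms levy_const_pos[OF \<alpha>] by (intro divide_right_mono powr_mono2') auto
  then show ?thesis using assms by (simp add: restricted_levy_def levy_density_def)
qed

text \<open>The first jump varies over a square of area \<open>D\<^sup>2 / 16\<close> on which the jump density is at least a multiple
of \<open>D\<^sup>-\<^sup>2\<^sup>-\<^sup>\<alpha>\<close>, which yields the factor \<open>D\<^sup>-\<^sup>\<alpha>\<close>. The second jump has size comparable to \<open>R\<close> at most, hence
density at least a multiple of \<open>R\<^sup>-\<^sup>2\<^sup>-\<^sup>\<alpha>\<close>, and \<open>g\<close> absorbs a displacement in a fixed small square.\<close>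

lemma two_jump_lower_bound:
  assumes \<alpha>: "0 < \<alpha>" "\<alpha> < 2" and \<delta>: "0 < \<delta>" "\<delta> \<le> 1 / 8" and c0: "c0 > 0"
    and g_meas: "g \<in> borel_measurable borel" and g0: "\<And>z. 0 \<le> g z" and gB: "\<And>z. g z \<le> B"
    and gc: "\<And>w. \<bar>fst w\<bar> \<le> \<delta> \<Longrightarrow> \<bar>snd w\<bar> \<le> \<delta> \<Longrightarrow> c0 \<le> g w"
  shows "4 powr (- (2 + \<alpha>)) * 6 powr (- (2 + \<alpha>)) * c0 * \<delta>\<^sup>2 / 4 / (levy_const \<alpha>)\<^sup>2 * profile \<alpha> z
    \<le> (convolve (restricted_levy \<alpha> {1..}) ^^ 2) g z"
proof -
  let ?n = "restricted_levy \<alpha> {1..}"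
  obtain v x where z: "z = (v, x)" by (cases z)
  define a where "a = x - v / 2"
  define R where "R = 1 + \<bar>a\<bar> + \<bar>v\<bar>"
  define D where "D = 1 + max (2 * \<bar>a\<bar> - \<bar>v\<bar>) 0"
  define \<tau> where "\<tau> = (if v \<ge> 0 then 1 else - 1 :: real)"
  define \<rho> where "\<rho> = (if a \<ge> 0 then 1 else - 1 :: real)"
  define b1 where "b1 = (6 * R) powr (- (2 + \<alpha>)) / levy_const \<alpha>"
  define b2 where "b2 = (4 * D) powr (- (2 + \<alpha>)) / levy_const \<alpha>"
  have lc: "levy_const \<alpha> > 0" by (rule levy_const_pos[OF \<alpha>])
  have R: "R \<ge> 1" and D: "D \<ge> 1" by (simp_all add: R_def D_def)
  have b: "b1 \<ge> 0" "b2 \<ge> 0" using lc by (simp_all add: b1_def b2_def)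
  have n0: "?n y \<ge> 0" for y by (rule restricted_levy_nonneg[OF \<alpha>])
  have nint: "integrable lborel ?n" by (rule restricted_levy_integrable[OF \<alpha>, where r = 1]) auto
  have nm: "?n \<in> borel_measurable borel" by (rule restricted_levy_measurable[OF \<alpha>]) simp
  note [measurable] = g_meas nm
  have int1: "integrable lborel (\<lambda>y. ?n y * g (u - y))" for u
    by (rule convolve_integrand_integrable[OF nint g_meas, of B]) (use g0 gB in auto)
  have c1_0: "0 \<le> convolve ?n g u" for u
    using convolve_power_nonneg[of ?n g 1 u] n0 g0 by simp
  have c1_B: "\<bar>convolve ?n g u\<bar> \<le> (\<integral>y. ?n y * B \<partial>lborel)" for u
    using c1_0[of u] unfolding convolve_def
    by (simp del: integral_mult_left_zero, intro integral_mono int1 mult_left_mono gB n0) (use nint in auto)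
  have int2: "integrable lborel (\<lambda>y. ?n y * convolve ?n g (z - y))"
    by (rule convolve_integrand_integrable[OF nint _ c1_B]) measurable
  \<comment> \<open>The centre of the square in which the first jump varies.\<close>
  let ?p = "(- \<tau> * (17 / 8 * D), - \<tau> * D + \<rho> * D / 4)"
  have geo: "1 \<le> \<bar>fst y\<bar>" "\<bar>fst y\<bar> \<le> 4 * D" "\<bar>2 * snd y - fst y\<bar> \<le> \<bar>fst y\<bar>"
    "1 \<le> \<bar>v - fst y - fst w\<bar>" "\<bar>v - fst y - fst w\<bar> \<le> 6 * R"
    "\<bar>2 * (x - snd y - snd w) - (v - fst y - fst w)\<bar> \<le> \<bar>v - fst y - fst w\<bar>"
    if "y \<in> cbox (fst ?p - D / 8, snd ?p - D / 8) (fst ?p + D / 8, snd ?p + D / 8)"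
      "\<bar>fst w\<bar> \<le> \<delta>" "\<bar>snd w\<bar> \<le> \<delta>" for y w
  proof -
    have 1: "\<bar>fst y - (- \<tau> * (17 / 8 * D))\<bar> \<le> D / 8" "\<bar>snd y - (- \<tau> * D + \<rho> * D / 4)\<bar> \<le> D / 8"
      using that(1) unfolding mem_square fst_conv snd_conv by blast+
    note two_jump_geometry[OF \<delta> D_def \<tau>_def \<rho>_def 1 that(2,3)]
    then show "1 \<le> \<bar>fst y\<bar>" "\<bar>fst y\<bar> \<le> 4 * D" "\<bar>2 * snd y - fst y\<bar> \<le> \<bar>fst y\<bar>"
      "1 \<le> \<bar>v - fst y - fst w\<bar>" "\<bar>v - fst y - fst w\<bar> \<le> 6 * R"
      "\<bar>2 * (x - snd y - snd w) - (v - fst y - fst w)\<bar> \<le> \<bar>v - fst y - fst w\<bar>"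
      by (simp_all add: R_def a_def)
  qed
  have inner: "b1 * c0 * (2 * \<delta>)\<^sup>2 \<le> convolve ?n g (z - y)"
    if y: "y \<in> cbox (fst ?p - D / 8, snd ?p - D / 8) (fst ?p + D / 8, snd ?p + D / 8)" for y
  proof -
    define u where "u = z - y"
    have "b1 * c0 * measure lborel (cbox (fst u - \<delta>, snd u - \<delta>) (fst u + \<delta>, snd u + \<delta>)) \<le> convolve ?n g u"
    proof (rule convolve_ge_on_box[OF int1 n0 g0 _ b(1)])
      fix y' assume y': "y' \<in> cbox (fst u - \<delta>, snd u - \<delta>) (fst u + \<delta>, snd u + \<delta>)"
      define w where "w = u - y'"
      have w: "\<bar>fst w\<bar> \<le> \<delta>" "\<bar>snd w\<bar> \<le> \<delta>"
        using y' unfolding mem_square w_def by (simp_all add: abs_minus_commute)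
      have y'_eq: "fst y' = v - fst y - fst w" "snd y' = x - snd y - snd w"
        by (simp_all add: w_def u_def z)
      have "b1 \<le> ?n y'"
        unfolding b1_def using geo(4-6)[OF y w] by (intro restricted_levy_lower \<alpha>) (simp_all only: y'_eq)
      then show "b1 \<le> ?n y' \<and> c0 \<le> g (u - y')"
        using gc[OF w] by (simp add: w_def)
    qed (use c0 in simp)
    then show ?thesis using measure_square[of \<delta> "fst u" "snd u"] \<delta> by (simp add: u_def)
  qed
  have "b2 * (b1 * c0 * (2 * \<delta>)\<^sup>2)
      * measure lborel (cbox (fst ?p - D / 8, snd ?p - D / 8) (fst ?p + D / 8, snd ?p + D / 8))
    \<le> convolve ?n (convolve ?n g) z"
  proof (rule convolve_ge_on_box[OF int2 n0 c1_0 _ b(2)])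
    fix y assume y: "y \<in> cbox (fst ?p - D / 8, snd ?p - D / 8) (fst ?p + D / 8, snd ?p + D / 8)"
    have "b2 \<le> ?n y"
      unfolding b2_def using geo(1-3)[OF y, of 0] \<delta> by (intro restricted_levy_lower \<alpha>) simp_all
    then show "b2 \<le> ?n y \<and> b1 * c0 * (2 * \<delta>)\<^sup>2 \<le> convolve ?n g (z - y)"
      using inner[OF y] by simp
  qed (use b c0 in simp)
  also have "measure lborel (cbox (fst ?p - D / 8, snd ?p - D / 8) (fst ?p + D / 8, snd ?p + D / 8)) = (D / 4)\<^sup>2"
    using measure_square[of "D / 8" "fst ?p" "snd ?p"] D by simp
  also have "b2 * (b1 * c0 * (2 * \<delta>)\<^sup>2) * (D / 4)\<^sup>2
    = 4 powr (- (2 + \<alpha>)) * 6 powr (- (2 + \<alpha>)) * c0 * \<delta>\<^sup>2 / 4 / (levy_const \<alpha>)\<^sup>2 * profile \<alpha> z"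
  proof -
    have pz: "profile \<alpha> z = R powr (- (2 + \<alpha>)) * D powr (- \<alpha>)"
      by (simp add: profile_def spread_def excess_def z R_def D_def a_def)
    have DD: "D powr (- (2 + \<alpha>)) * D\<^sup>2 = D powr (- \<alpha>)"
      using D power2_mult_powr[of D "- (2 + \<alpha>)"] by (simp add: mult.commute)
    have "b2 * (b1 * c0 * (2 * \<delta>)\<^sup>2) * (D / 4)\<^sup>2
      = 4 powr (- (2 + \<alpha>)) * 6 powr (- (2 + \<alpha>)) * c0 * \<delta>\<^sup>2 / 4 / (levy_const \<alpha>)\<^sup>2
        * (R powr (- (2 + \<alpha>)) * (D powr (- (2 + \<alpha>)) * D\<^sup>2))"
      using R D by (simp add: b1_def b2_def powr_mult power_mult_distrib power_divide power2_eq_square)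
    then show ?thesis unfolding DD pz .
  qed
  finally show ?thesis by (simp add: numeral_2_eq_2)
qed

section \<open>Two-sided bound for the kernel\<close>

theorem theorem1p1:
  fixes s :: real
  assumes "0 < s" and "s < 1"
  shows "\<exists>C::real. C \<ge> 1 \<and>
    (\<forall>x v :: real.
       kolmogorov_kernel s 1 (x + v / 2) v \<in> \<real> \<and>
       inverse C * kolmogorov_profile s x v \<le> Re (kolmogorov_kernel s 1 (x + v / 2) v) \<and>
       Re (kolmogorov_kernel s 1 (x + v / 2) v) \<le> C * kolmogorov_profile s x v)"
proof -
  define \<alpha> where "\<alpha> = 2 * s"
  have \<alpha>: "0 < \<alpha>" "\<alpha> < 2" using assms by (simp_all add: \<alpha>_def)
  let ?n = "restricted_levy \<alpha> {1..}"
  define g where "g z = exp (- jump_mass \<alpha> {1..}) * regular_part \<alpha> z" for z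
  have sum: "summable (\<lambda>k. (convolve ?n ^^ k) g z / fact k)" for z
    using kolmogorov_kernel_compound(1)[OF assms] unfolding g_def[abs_def] \<alpha>_def .
  have kernel: "kolmogorov_kernel s 1 x v = of_real (compound ?n g (v, x))" for x v
    using kolmogorov_kernel_compound(2)[OF assms] unfolding g_def[abs_def] \<alpha>_def .
  have n_meas: "?n \<in> borel_measurable borel" by (rule restricted_levy_measurable[OF \<alpha>]) simp
  have n0: "?n y \<ge> 0" for y by (rule restricted_levy_nonneg[OF \<alpha>])
  have g0: "g z \<ge> 0" for z by (simp add: g_def regular_part_nonneg[OF \<alpha>])
  have g_meas: "g \<in> borel_measurable borel"
  proof -
    have [measurable]: "inv_fourier (regular_fourier \<alpha>) \<in> borel_measurable borel"
      by (rule inv_fourier_measurable[OF regular_fourier_integrable[OF \<alpha>]])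
    show ?thesis unfolding g_def[abs_def] regular_part_def by measurable
  qed
  obtain K0 where K0: "\<And>z. regular_part \<alpha> z \<le> K0 * exp (- (\<bar>fst z\<bar> + \<bar>snd z\<bar>))"
    using regular_part_exp_decay[OF \<alpha>] by blast
  have K0_0: "K0 \<ge> 0" using order_trans[OF regular_part_nonneg[OF \<alpha>, of 0] K0[of 0]] by simp
  have g_le: "g z \<le> K0 * exp (- (\<bar>fst z\<bar> + \<bar>snd z\<bar>))" for z
  proof -
    have "g z \<le> 1 * regular_part \<alpha> z"
      unfolding g_def using jump_mass_nonneg[OF \<alpha>] by (intro mult_right_mono regular_part_nonneg[OF \<alpha>]) simp
    then show ?thesis using K0[of z] by simp
  qed
  define A where "A = K0 * (4 * 2 ^ 6 * fact 6 * exp 1)"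
  have A: "A \<ge> 0" using K0_0 by (simp add: A_def)
  have g_prof: "g z \<le> A * profile \<alpha> z" for z
    using order_trans[OF g_le[of z] mult_left_mono[OF exp_decay_le_profile[OF \<alpha>, of z] K0_0]]
    by (simp add: A_def mult.assoc)
  obtain K where K: "K \<ge> 0"
    "\<And>z. (\<integral>\<^sup>+y. ennreal (?n y * profile \<alpha> (z - y)) \<partial>lborel) \<le> ennreal (K * profile \<alpha> z)"
    using profile_convolution_bound[OF \<alpha>] by blast
  have upper: "compound ?n g z \<le> A * exp K * profile \<alpha> z" for z
    by (rule compound_le[OF n_meas g_meas _ n0 g0 g_prof A K(1) _ K(2) sum])
      (auto intro: less_imp_le profile_pos)
  obtain \<delta> c where \<delta>: "0 < \<delta>" "\<delta> \<le> 1 / 8" and c: "c > 0"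
    and near: "\<And>w. \<bar>fst w\<bar> \<le> \<delta> \<Longrightarrow> \<bar>snd w\<bar> \<le> \<delta> \<Longrightarrow> c \<le> regular_part \<alpha> w"
    using regular_part_lower_near_0[OF \<alpha>] by blast
  define c0 where "c0 = exp (- jump_mass \<alpha> {1..}) * c"
  have c0: "c0 > 0" using c by (simp add: c0_def)
  have g_near: "c0 \<le> g w" if "\<bar>fst w\<bar> \<le> \<delta>" "\<bar>snd w\<bar> \<le> \<delta>" for w
    using near[OF that] by (simp add: c0_def g_def)
  have g_B: "g z \<le> K0" for z
  proof -
    have "exp (- (\<bar>fst z\<bar> + \<bar>snd z\<bar>)) \<le> 1" by simp
    from order_trans[OF g_le mult_left_le[OF this K0_0]] show ?thesis .
  qed
  define L where "L = 4 powr (- (2 + \<alpha>)) * 6 powr (- (2 + \<alpha>)) * c0 * \<delta>\<^sup>2 / 4 / (levy_const \<alpha>)\<^sup>2 / 2"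
  have L: "L > 0" using c0 \<delta> levy_const_pos[OF \<alpha>] by (simp add: L_def)
  have lower: "L * profile \<alpha> z \<le> compound ?n g z" for z
  proof -
    have "L * profile \<alpha> z \<le> (convolve ?n ^^ 2) g z / fact 2"
      using two_jump_lower_bound[OF \<alpha> \<delta> c0 g_meas g0 g_B g_near, of z] by (simp add: L_def mult_ac)
    also have "\<dots> \<le> compound ?n g z" by (rule compound_ge_term[OF n0 g0 sum])
    finally show ?thesis .
  qed
  define C where "C = max 1 (max (A * exp K) (inverse L))"
  have C: "C \<ge> 1" "A * exp K \<le> C" "inverse C \<le> L"
    using L by (auto simp: C_def inverse_le_imp_le le_max_iff_disj intro!: inverse_le_imp_le[of _ L])
  show ?thesis
  proof (intro exI[of _ C] conjI allI C)
    fix x v :: real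
    have p: "kolmogorov_profile s x v = profile \<alpha> (v, x + v / 2)" by (simp add: kolmogorov_profile_eq \<alpha>_def)
    note pos = profile_pos[of \<alpha> "(v, x + v / 2)", THEN less_imp_le]
    show "kolmogorov_kernel s 1 (x + v / 2) v \<in> \<real>" by (simp add: kernel)
    show "inverse C * kolmogorov_profile s x v \<le> Re (kolmogorov_kernel s 1 (x + v / 2) v)"
      unfolding p kernel using order_trans[OF mult_right_mono[OF C(3) pos] lower] by simp
    show "Re (kolmogorov_kernel s 1 (x + v / 2) v) \<le> C * kolmogorov_profile s x v"
      unfolding p kernel using order_trans[OF upper mult_right_mono[OF C(2) pos]] by simp
  qed
qed

end
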